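(* Let $\lambda\in\mathbb R$ and let $\phi:Z\to[-\infty,+\infty]$ be proper and closed. Suppose that Assumption (A3)(ii), Assumption (A1), and Assumption (A2) (for this $\lambda$) hold. Then for every $w_0\in\overline{D\phi}$ there exists a unique solution $S[w_0]=w=(u,v):(0,+\infty)\to X\times Y$ of $\mathrm{EVIs}_\lambda(X,Y,\phi)$ with $\lim_{t\downarrow0}w_t=w_0$. Moreover, if $(w_0^n)_{n\ge1}\subset\overline{D\phi}$ and $w_0^n\to w_0\in\overline{D\phi}$, then $S_t[w_0^n]\to S_t[w_0]$ as $n\to\infty$ for every $t>0$ (where $S_t[w_0]$ denotes the value at time $t$ of $S[w_0]$).
   Context: $(X,\mathsf d_X)$, $(Y,\mathsf d_Y)$ are complete metric spaces; $Z=X\times Y$ carries the metric $\mathsf d_Z((x,y),(x',y'))=(\mathsf d_X^2(x,x')+\mathsf d_Y^2(y,y'))^{1/2}$. For $\phi:Z\to[-\infty,+\infty]$ set $D_X\phi=\{x\in X:\phi(x,y)<+\infty\ \forall y\in Y\}$, $D_Y\phi=\{y\in Y:\phi(x,y)>-\infty\ \forall x\in X\}$, $D\phi=D_X\phi\times D_Y\phi$; $\phi$ is proper if $D\phi\ne\emptyset$. $\phi$ is closed if for every $x\in D_X\phi$ the map $y\mapsto\phi(x,y)$ is upper semicontinuous on $Y$ and for every $y\in D_Y\phi$ the map $x\mapsto\phi(x,y)$ is lower semicontinuous on $X$. Assumption (A1): $\phi=+\infty$ on $(X\setminus D_X\phi)\times D_Y\phi$ and $\phi=-\infty$ on $D_X\phi\times(Y\setminus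 D_Y\phi)$. For $\lambda\in\mathbb R$ put $\lambda^-=\max\{-\lambda,0\}$, with $1/\lambda^-:=+\infty$ if $\lambda^-=0$. For $\tau>0$, $\Phi_\tau(x,y;x',y')=\phi(x',y')+\frac1{2\tau}(\mathsf d_X^2(x',x)-\mathsf d_Y^2(y',y))$. A curve is a continuous map on $[0,1]$. A function $f:Z\to[-\infty,+\infty]$ is $\mu$-convex-concave along curves $\gamma:[0,1]\to X$, $\sigma:[0,1]\to Y$ if for all $t\in[0,1]$: $f(\gamma_t,y)\le(1-t)f(\gamma_0,y)+tf(\gamma_1,y)-\frac\mu2t(1-t)\mathsf d_X^2(\gamma_0,\gamma_1)$ for every $y\in Y$, and $f(x,\sigma_t)\ge(1-t)f(x,\sigma_0)+tf(x,\sigma_1)+\frac\mu2t(1-t)\mathsf d_Y^2(\sigma_0,\sigma_1)$ for every $x\in X$. Assumption (A2) (for $\lambda$): for every $(x,y)\in Z$ and every $(x_0,y_0),(x_1,y_1)\in D\phi$ there exist curves $\gamma$ from $x_0$ to $x_1$ and $\sigma$ from $y_0$ to $y_1$ such that for every $\tau\in(0,1/\lambda^-)$ the map $(x',y')\mapsto\Phi_\tau(x,y;x',y')$ is $(\tau^{-1}+\lambda)$-convex-concave along $\gamma$ and $\sigma$. Assumption (A3): there exist $\varphi:Z\to\mathbb R$, a lower semicontinuous $\psi_X:X\to(-\infty,+\infty]$ and an upper semicontinuous $\psi_Y:Y\to[-\infty,+\infty)$ with $\phi(x,y)=\varphi(x,y)+\psi_X(x)+\psi_Y(y)$ for all $(x,y)\in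 D\phi$, and moreover (i) $\varphi$ is continuous, resp. (ii) $\varphi$ is locally Lipschitz. A solution of $\mathrm{EVIs}_\lambda(X,Y,\phi)$ is a pair of continuous curves $w=(u,v):(0,+\infty)\to D\phi$ such that for every $t>0$ and every $(x,y)\in D\phi$: $\frac12\frac{d^+}{dt}\mathsf d_X^2(u_t,x)+\frac\lambda2\mathsf d_X^2(u_t,x)+\phi(u_t,v_t)\le\phi(x,v_t)$ and $\frac12\frac{d^+}{dt}\mathsf d_Y^2(v_t,y)+\frac\lambda2\mathsf d_Y^2(v_t,y)+\phi(u_t,y)\le\phi(u_t,v_t)$, where $\frac{d^+}{dt}f(t)=\limsup_{h\downarrow0}(f(t+h)-f(t))/h$. *)

theory Defs
  imports "HOL-Analysis.Analysis" "HOL-Library.Extended_Real"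
begin

definition lsc :: "('a::topological_space \<Rightarrow> ereal) \<Rightarrow> bool" where
  "lsc f \<longleftrightarrow> (\<forall>x. f x \<le> Liminf (at x) f)"

definition usc :: "('a::topological_space \<Rightarrow> ereal) \<Rightarrow> bool" where
  "usc f \<longleftrightarrow> (\<forall>x. Limsup (at x) f \<le> f x)"

definition locally_lipschitz :: "('a::metric_space \<Rightarrow> real) \<Rightarrow> bool" where
  "locally_lipschitz f \<longleftrightarrow>
     (\<forall>z. \<exists>r>0. \<exists>L. \<forall>p\<in>ball z r. \<forall>q\<in>ball z r. dist (f p) (f q) \<le> L * dist p q)"

definition DX :: "('a \<Rightarrow> 'b \<Rightarrow> ereal) \<Rightarrow> 'a set" where
  "DX \<phi> = {x. \<forall>y. \<phi> x y < \<infinity>}"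

definition DY :: "('a \<Rightarrow> 'b \<Rightarrow> ereal) \<Rightarrow> 'b set" where
  "DY \<phi> = {y. \<forall>x. \<phi> x y > -\<infinity>}"

definition Dom :: "('a \<Rightarrow> 'b \<Rightarrow> ereal) \<Rightarrow> ('a \<times> 'b) set" where
  "Dom \<phi> = DX \<phi> \<times> DY \<phi>"

definition proper_sp :: "('a \<Rightarrow> 'b \<Rightarrow> ereal) \<Rightarrow> bool" where
  "proper_sp \<phi> \<longleftrightarrow> Dom \<phi> \<noteq> {}"

definition closed_sp :: "('a::topological_space \<Rightarrow> 'b::topological_space \<Rightarrow> ereal) \<Rightarrow> bool" where
  "closed_sp \<phi> \<longleftrightarrow> (\<forall>x\<in>DX \<phi>. usc (\<lambda>y. \<phi> x y)) \<and> (\<forall>y\<in>DY \<phi>. lsc (\<lambda>x. \<phi> x y))"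

definition A1 :: "('a \<Rightarrow> 'b \<Rightarrow> ereal) \<Rightarrow> bool" where
  "A1 \<phi> \<longleftrightarrow> (\<forall>x y. x \<notin> DX \<phi> \<and> y \<in> DY \<phi> \<longrightarrow> \<phi> x y = \<infinity>) \<and>
              (\<forall>x y. x \<in> DX \<phi> \<and> y \<notin> DY \<phi> \<longrightarrow> \<phi> x y = -\<infinity>)"

definition Phi_tau :: "real \<Rightarrow> ('a::metric_space \<Rightarrow> 'b::metric_space \<Rightarrow> ereal) \<Rightarrow> 'a \<Rightarrow> 'b \<Rightarrow> 'a \<Rightarrow> 'b \<Rightarrow> ereal" where
  "Phi_tau \<tau> \<phi> x y x' y' = \<phi> x' y' + ereal (1 / (2 * \<tau>) * ((dist x' x)\<^sup>2 - (dist y' y)\<^sup>2))"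

definition convex_concave_along ::
  "real \<Rightarrow> ('a::metric_space \<Rightarrow> 'b::metric_space \<Rightarrow> ereal) \<Rightarrow> (real \<Rightarrow> 'a) \<Rightarrow> (real \<Rightarrow> 'b) \<Rightarrow> bool" where
  "convex_concave_along \<mu> f \<gamma> \<sigma> \<longleftrightarrow>
     (\<forall>t\<in>{0..1}.
        (\<forall>y. f (\<gamma> t) y \<le> ereal (1 - t) * f (\<gamma> 0) y + ereal t * f (\<gamma> 1) y
                         - ereal (\<mu> / 2 * t * (1 - t) * (dist (\<gamma> 0) (\<gamma> 1))\<^sup>2)) \<and>
        (\<forall>x. f x (\<sigma> t) \<ge> ereal (1 - t) * f x (\<sigma> 0) + ereal t * f x (\<sigma> 1)
                         + ereal (\<mu> / 2 * t * (1 - t) * (dist (\<sigma> 0) (\<sigma> 1))\<^sup>2)))"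

(* Assumption (A2) for lambda; tau \<in> (0, 1/lambda^-) written as 0 < tau and tau * lambda^- < 1 *)
definition A2 :: "real \<Rightarrow> ('a::metric_space \<Rightarrow> 'b::metric_space \<Rightarrow> ereal) \<Rightarrow> bool" where
  "A2 lam \<phi> \<longleftrightarrow>
     (\<forall>x y x0 y0 x1 y1. (x0, y0) \<in> Dom \<phi> \<and> (x1, y1) \<in> Dom \<phi> \<longrightarrow>
        (\<exists>\<gamma> \<sigma>. continuous_on {0..1} \<gamma> \<and> \<gamma> 0 = x0 \<and> \<gamma> 1 = x1 \<and>
                 continuous_on {0..1} \<sigma> \<and> \<sigma> 0 = y0 \<and> \<sigma> 1 = y1 \<and>
                 (\<forall>\<tau>. 0 < \<tau> \<and> \<tau> * max (-lam) 0 < 1 \<longrightarrow>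
                      convex_concave_along (1 / \<tau> + lam) (Phi_tau \<tau> \<phi> x y) \<gamma> \<sigma>)))"

definition A3_ii :: "('a::metric_space \<Rightarrow> 'b::metric_space \<Rightarrow> ereal) \<Rightarrow> bool" where
  "A3_ii \<phi> \<longleftrightarrow>
     (\<exists>(\<psi>X :: 'a \<Rightarrow> ereal) (\<psi>Y :: 'b \<Rightarrow> ereal) (\<Phi>0 :: 'a \<times> 'b \<Rightarrow> real).
        lsc \<psi>X \<and> (\<forall>x. \<psi>X x \<noteq> -\<infinity>) \<and>
        usc \<psi>Y \<and> (\<forall>y. \<psi>Y y \<noteq> \<infinity>) \<and>
        locally_lipschitz \<Phi>0 \<and>
        (\<forall>x y. (x, y) \<in> Dom \<phi> \<longrightarrow> \<phi> x y = ereal (\<Phi>0 (x, y)) + \<psi>X x + \<psi>Y y))"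

definition dini_upper :: "(real \<Rightarrow> real) \<Rightarrow> real \<Rightarrow> ereal" where
  "dini_upper f t = Limsup (at_right 0) (\<lambda>h. ereal ((f (t + h) - f t) / h))"

definition EVI_solution ::
  "real \<Rightarrow> ('a::metric_space \<Rightarrow> 'b::metric_space \<Rightarrow> ereal) \<Rightarrow> (real \<Rightarrow> 'a) \<Rightarrow> (real \<Rightarrow> 'b) \<Rightarrow> bool" where
  "EVI_solution lam \<phi> u v \<longleftrightarrow>
     continuous_on {0<..} u \<and> continuous_on {0<..} v \<and>
     (\<forall>t>0. (u t, v t) \<in> Dom \<phi>) \<and>
     (\<forall>t>0. \<forall>x y. (x, y) \<in> Dom \<phi> \<longrightarrow>
        ereal (1/2) * dini_upper (\<lambda>s. (dist (u s) x)\<^sup>2) t + ereal (lam/2 * (dist (u t) x)\<^sup>2) + \<phi> (u t) (v t)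
           \<le> \<phi> x (v t) \<and>
        ereal (1/2) * dini_upper (\<lambda>s. (dist (v s) y)\<^sup>2) t + ereal (lam/2 * (dist (v t) y)\<^sup>2) + \<phi> (u t) y
           \<le> \<phi> (u t) (v t))"

end

theory Submission
  imports Defs
begin

text \<open>For small \<open>\<tau>\<close> the functional \<open>Phi_tau\<close> is strongly convex-concave and has a saddle point, which
  defines an implicit time step. A discrete (or continuous) solution \<open>w\<close> satisfies, for every test
  point \<open>z\<close>, an inequality whose right-hand side \<open>beta z w\<close> is antisymmetric; testing two solutions
  against each other, it cancels. For two discrete solutions this leaves the Crandall--Liggett
  recursion for the squared distances, hence convergence of the scheme; for an EVI solution against
  a discrete one it leaves a differential recursion with the same explicit solution, hence
  uniqueness and stability. The limit satisfies the EVI pointwise because the right-hand side of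
  the EVI is upper semicontinuous in the solution, and it lies in the domain for positive times
  because of a local energy estimate, the only place where Lipschitz continuity (rather than
  continuity) of the coupling matters.\<close>

text \<open>Convexity is available only for the penalized functional and only along curves that
  depend on the centre of the penalty, and there is no compactness for a minimax theorem. The saving
  feature is that one curve serves all small \<tau> and all values of the other variable: letting
  \<tau> tend to 0 controls how far the curve moves (\<open>curve_dist\<close>), and an infimum over
  the other variable stays concave along it (\<open>saddle_exists\<close>). (A1) keeps sublevel sets
  inside the domain, so the whole argument runs with real values on
  \<open>DX \<phi> \<times> DY \<phi>\<close>. The comparison estimates start from initial data of
  bounded slope. A single implicit step produces such data close to any given point of the closure,
  and the slope bound disappears from the estimates at equal times as the step size tends to 0, so
  the flow extends to the closure. In the summed inequalities \<open>lam\<close> is replaced by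
  -|\<open>lam\<close>|; this gives up the sharp exponential rate and avoids distinguishing signs.
  The exact \<open>lam\<close> is kept in each component, where the limit EVI is derived.\<close>

section \<open>Minimization of strongly convex functions and elementary estimates\<close>

lemma strongly_convex_min:
  fixes g :: "'a::complete_space \<Rightarrow> real"
  assumes "A \<noteq> {}" and mu: "\<mu> > 0"
    and lower: "\<And>x. x \<in> A \<Longrightarrow> m \<le> g x"
    and mid: "\<And>x0 x1. x0 \<in> A \<Longrightarrow> x1 \<in> A \<Longrightarrow>
                \<exists>z\<in>A. g z \<le> (g x0 + g x1) / 2 - \<mu> / 8 * (dist x0 x1)\<^sup>2"
    and lsc: "\<And>X x c. (\<And>n. X n \<in> A) \<Longrightarrow> X \<longlonglongrightarrow> x \<Longrightarrow> (\<lambda>n. g (X n)) \<longlonglongrightarrow> c \<Longrightarrow> x \<in> A \<and> g x \<le> c"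
  shows "\<exists>x\<in>A. \<forall>z\<in>A. g x \<le> g z"
proof -
  define I where "I = (INF x\<in>A. g x)"
  have bdd: "bdd_below (g ` A)" using lower by (auto intro!: bdd_belowI[of _ m])
  have I_le: "I \<le> g x" if "x \<in> A" for x
    unfolding I_def using bdd that by (rule cINF_lower)
  have "\<exists>x\<in>A. g x < I + 1 / real (Suc n)" for n
    using cINF_less_iff[OF \<open>A \<noteq> {}\<close> bdd, of "I + 1 / real (Suc n)"] by (simp add: I_def)
  then obtain X where XA: "\<And>n. X n \<in> A" and XI: "\<And>n. g (X n) < I + 1 / real (Suc n)"
    by metis
  have glim: "(\<lambda>n. g (X n)) \<longlonglongrightarrow> I"
  proof (rule tendsto_sandwich[where f = "\<lambda>_. I" and h = "\<lambda>n. I + 1 / real (Suc n)"])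
    show "(\<lambda>n. I + 1 / real (Suc n)) \<longlonglongrightarrow> I"
      using tendsto_add[OF tendsto_const LIMSEQ_Suc[OF lim_1_over_n], of I] by simp
    show "\<forall>\<^sub>F n in sequentially. g (X n) \<le> I + 1 / real (Suc n)"
      by (rule always_eventually) (use XI less_imp_le in blast)
    show "\<forall>\<^sub>F n in sequentially. I \<le> g (X n)"
      by (rule always_eventually) (use I_le XA in blast)
  qed simp
  \<comment> \<open>The midpoint value is at least \<open>I\<close>, so the convexity gain is
    bounded by the mean excess of the two values over \<open>I\<close>.\<close>
  have dist_le: "(dist (X i) (X j))\<^sup>2 \<le> 8 / \<mu> * (1 / real (Suc N))" if "i \<ge> N" "j \<ge> N" for i j N
  proof -
    obtain z where "z \<in> A" "g z \<le> (g (X i) + g (X j)) / 2 - \<mu> / 8 * (dist (X i) (X j))\<^sup>2"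
      using mid XA by blast
    moreover have "1 / real (Suc i) \<le> 1 / real (Suc N)" "1 / real (Suc j) \<le> 1 / real (Suc N)"
      using that by (auto simp: frac_le)
    ultimately have "\<mu> / 8 * (dist (X i) (X j))\<^sup>2 \<le> 1 / real (Suc N)"
      using I_le[OF \<open>z \<in> A\<close>] XI[of i] XI[of j] by argo
    then have "8 / \<mu> * (\<mu> / 8 * (dist (X i) (X j))\<^sup>2) \<le> 8 / \<mu> * (1 / real (Suc N))"
      using mu by (intro mult_left_mono) auto
    then show ?thesis using mu by simp
  qed
  have "Cauchy X"
  proof (rule metric_CauchyI)
    fix e :: real assume "e > 0"
    obtain N where N: "inverse (real (Suc N)) < \<mu> / 8 * e\<^sup>2"
      using reals_Archimedean[of "\<mu> / 8 * e\<^sup>2"] \<open>e > 0\<close> mu by auto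
    have "dist (X i) (X j) < e" if "i \<ge> N" "j \<ge> N" for i j
    proof -
      have "(dist (X i) (X j))\<^sup>2 < e\<^sup>2"
      proof -
        have "8 / \<mu> * (1 / real (Suc N)) < 8 / \<mu> * (\<mu> / 8 * e\<^sup>2)"
          using N mu by (intro mult_strict_left_mono) (auto simp: inverse_eq_divide)
        then have "8 / \<mu> * (1 / real (Suc N)) < e\<^sup>2" using mu by simp
        then show ?thesis using dist_le[OF that] by linarith
      qed
      then show ?thesis by (rule power2_less_imp_less) (use \<open>e > 0\<close> in simp)
    qed
    then show "\<exists>M. \<forall>m\<ge>M. \<forall>n\<ge>M. dist (X m) (X n) < e" by blast
  qed
  then obtain x where "X \<longlonglongrightarrow> x" using Cauchy_convergent_iff convergent_def by blast
  \<comment> \<open>\<open>A\<close> need not be closed: the semicontinuity assumption also returns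
    the limit to \<open>A\<close>.\<close>
  then have "x \<in> A \<and> g x \<le> I" using lsc XA glim by blast
  then show ?thesis using I_le by force
qed

text \<open>Removes a first-order error in a parameter: the step size in \<open>curve_dist\<close>,
  the curve parameter in \<open>minimizer_strong\<close>.\<close>

lemma le_of_small_perturbation:
  fixes a b c e :: real
  assumes "e > 0" and "\<And>s. 0 < s \<Longrightarrow> s < e \<Longrightarrow> a \<le> b + s * c"
  shows "a \<le> b"
proof (rule tendsto_le[of "at_right 0"])
  show "((\<lambda>s. b + s * c) \<longlongrightarrow> b) (at_right 0)" by (auto intro!: tendsto_eq_intros)
  show "\<forall>\<^sub>F s in at_right 0. a \<le> b + s * c"
    using assms by (auto simp: eventually_at_right_field)
qed auto

lemma sq_dist_le_double: "(dist a c)\<^sup>2 \<le> 2 * (dist a b)\<^sup>2 + 2 * (dist b c)\<^sup>2"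
proof -
  have "(dist a c)\<^sup>2 \<le> (dist a b + dist b c)\<^sup>2" by (intro power_mono dist_triangle) auto
  also have "\<dots> \<le> 2 * (dist a b)\<^sup>2 + 2 * (dist b c)\<^sup>2"
    using zero_le_power2[of "dist a b - dist b c"] by (simp add: power2_eq_square algebra_simps)
  finally show ?thesis .
qed

text \<open>The assumptions on the second variable are stated for \<open>- F\<close>, so that exchanging the
  variables and changing the sign maps the locale to itself.\<close>

locale saddle_system =
  fixes lam :: real and A :: "'a::complete_space set" and B :: "'b::complete_space set"
    and F P :: "'a \<Rightarrow> 'b \<Rightarrow> real" and p :: "'a \<Rightarrow> real" and q :: "'b \<Rightarrow> real"
  assumes A_nonempty: "A \<noteq> {}" and B_nonempty: "B \<noteq> {}"
    and closedX: "y \<in> B \<Longrightarrow> closed {x \<in> A. F x y \<le> c}"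
    and closedY: "x \<in> A \<Longrightarrow> closed {y \<in> B. - F x y \<le> c}"
    and convX: "x0 \<in> A \<Longrightarrow> x1 \<in> A \<Longrightarrow> \<exists>\<gamma>. \<forall>t\<in>{0..1}. \<gamma> t \<in> A \<and>
      (\<forall>\<tau> y. 0 < \<tau> \<and> \<tau> * \<bar>lam\<bar> < 1 \<and> y \<in> B \<longrightarrow>
        F (\<gamma> t) y + (dist (\<gamma> t) x')\<^sup>2 / (2 * \<tau>)
          \<le> (1 - t) * (F x0 y + (dist x0 x')\<^sup>2 / (2 * \<tau>)) + t * (F x1 y + (dist x1 x')\<^sup>2 / (2 * \<tau>))
            - (1 / \<tau> + lam) / 2 * t * (1 - t) * (dist x0 x1)\<^sup>2)"
    and convY: "y0 \<in> B \<Longrightarrow> y1 \<in> B \<Longrightarrow> \<exists>\<sigma>. \<forall>t\<in>{0..1}. \<sigma> t \<in> B \<and>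
      (\<forall>\<tau> x. 0 < \<tau> \<and> \<tau> * \<bar>lam\<bar> < 1 \<and> x \<in> A \<longrightarrow>
        - F x (\<sigma> t) + (dist (\<sigma> t) y')\<^sup>2 / (2 * \<tau>)
          \<le> (1 - t) * (- F x y0 + (dist y0 y')\<^sup>2 / (2 * \<tau>)) + t * (- F x y1 + (dist y1 y')\<^sup>2 / (2 * \<tau>))
            - (1 / \<tau> + lam) / 2 * t * (1 - t) * (dist y0 y1)\<^sup>2)"
    and split: "x \<in> A \<Longrightarrow> y \<in> B \<Longrightarrow> F x y = P x y + p x + q y"
    and lipschitzP: "\<exists>r>0. \<exists>L\<ge>0. \<forall>x1\<in>ball x r. \<forall>x2\<in>ball x r. \<forall>y1\<in>ball y r. \<forall>y2\<in>ball y r.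
        \<bar>P x1 y1 - P x2 y2\<bar> \<le> L * (dist x1 x2 + dist y1 y2)"
begin

lemma swap: "saddle_system lam B A (\<lambda>y x. - F x y) (\<lambda>y x. - P x y) (\<lambda>y. - q y) (\<lambda>x. - p x)"
proof
  fix y :: 'b and x :: 'a
  obtain r L where "r > 0" "L \<ge> 0" and *: "\<forall>x1\<in>ball x r. \<forall>x2\<in>ball x r. \<forall>y1\<in>ball y r. \<forall>y2\<in>ball y r.
        \<bar>P x1 y1 - P x2 y2\<bar> \<le> L * (dist x1 x2 + dist y1 y2)"
    using lipschitzP by meson
  have "\<bar>- P y1 x1 - - P y2 x2\<bar> \<le> L * (dist x1 x2 + dist y1 y2)"
    if "x1 \<in> ball y r" "x2 \<in> ball y r" "y1 \<in> ball x r" "y2 \<in> ball x r" for x1 x2 y1 y2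
  proof -
    have "\<bar>P y1 x1 - P y2 x2\<bar> \<le> L * (dist y1 y2 + dist x1 x2)" using * that by blast
    then show ?thesis by (simp add: abs_minus_commute add.commute)
  qed
  then show "\<exists>r>0. \<exists>L\<ge>0. \<forall>x1\<in>ball y r. \<forall>x2\<in>ball y r. \<forall>y1\<in>ball x r. \<forall>y2\<in>ball x r.
        \<bar>- P y1 x1 - - P y2 x2\<bar> \<le> L * (dist x1 x2 + dist y1 y2)"
    using \<open>r > 0\<close> \<open>L \<ge> 0\<close> by blast
qed (unfold minus_minus, (rule A_nonempty B_nonempty closedX closedY convX convY | assumption | simp add: split)+)

section \<open>One variable: semicontinuity, growth and penalized minimizers\<close>

text \<open>Sequential form of \<open>closedX\<close> with a bound that varies along the sequence:
  the sublevel set at height \<open>C + e\<close> eventually contains \<open>X n\<close>. Since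
  \<open>A\<close> need not be closed, membership of the limit comes from the finite bound on
  \<open>F\<close>.\<close>

lemma lscX_seq:
  assumes "y \<in> B" "\<And>n. X n \<in> A" "X \<longlonglongrightarrow> x" "c \<longlonglongrightarrow> C" "\<And>n. F (X n) y \<le> c n"
  shows "x \<in> A \<and> F x y \<le> C"
proof -
  have *: "x \<in> {x \<in> A. F x y \<le> C + e}" if "e > 0" for e
  proof (rule Lim_in_closed_set[OF closedX[OF \<open>y \<in> B\<close>] _ _ \<open>X \<longlonglongrightarrow> x\<close>])
    have "\<forall>\<^sub>F n in sequentially. c n < C + e"
      using \<open>c \<longlonglongrightarrow> C\<close> that by (simp add: order_tendstoD(2))
    then show "\<forall>\<^sub>F n in sequentially. X n \<in> {x \<in> A. F x y \<le> C + e}"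
      by eventually_elim (use assms(2,5) in \<open>force intro: order_trans less_imp_le\<close>)
  qed auto
  then show ?thesis using zero_less_one field_le_epsilon by blast
qed

text \<open>\<open>convX\<close> is applied with the penalty centred at the starting point. The
  curve is the same for all small \<tau>, so multiplying by 2 \<tau> and letting \<tau> tend to 0
  removes \<open>F\<close> and leaves d(\<gamma> t, x0)^2 \<le> t d^2 - t (1 - t) d^2 = (t
  d)^2.\<close>

lemma curve_dist:
  assumes "x0 \<in> A" "x1 \<in> A"
  shows "\<exists>\<gamma>. \<forall>t\<in>{0..1}. \<gamma> t \<in> A \<and> dist (\<gamma> t) x0 \<le> t * dist x0 x1 \<and>
      (\<forall>\<tau> y. 0 < \<tau> \<and> \<tau> * \<bar>lam\<bar> < 1 \<and> y \<in> B \<longrightarrow>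
        F (\<gamma> t) y + (dist (\<gamma> t) x0)\<^sup>2 / (2 * \<tau>)
          \<le> (1 - t) * F x0 y + t * (F x1 y + (dist x1 x0)\<^sup>2 / (2 * \<tau>))
            - (1 / \<tau> + lam) / 2 * t * (1 - t) * (dist x0 x1)\<^sup>2)"
proof -
  obtain \<gamma> where \<gamma>: "\<And>t. t \<in> {0..1} \<Longrightarrow> \<gamma> t \<in> A"
    "\<And>t \<tau> y. t \<in> {0..1} \<Longrightarrow> 0 < \<tau> \<Longrightarrow> \<tau> * \<bar>lam\<bar> < 1 \<Longrightarrow> y \<in> B \<Longrightarrow>
      F (\<gamma> t) y + (dist (\<gamma> t) x0)\<^sup>2 / (2 * \<tau>)
          \<le> (1 - t) * F x0 y + t * (F x1 y + (dist x1 x0)\<^sup>2 / (2 * \<tau>))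
            - (1 / \<tau> + lam) / 2 * t * (1 - t) * (dist x0 x1)\<^sup>2"
    using convX[OF assms, of x0] by (simp only: dist_self power_zero_numeral div_0 add_0_right) metis
  obtain y where "y \<in> B" using B_nonempty by blast
  have "dist (\<gamma> t) x0 \<le> t * dist x0 x1" if t: "t \<in> {0..1}" for t
  proof -
    define d where "d = dist x0 x1"
    \<comment> \<open>\<open>K\<close> collects what accompanies the squared distances after
      multiplication by 2 \<tau>; it is constant in \<tau>, hence negligible in the limit.\<close>
    define K where "K = 2 * ((1 - t) * F x0 y + t * F x1 y - F (\<gamma> t) y) - lam * t * (1 - t) * d\<^sup>2"
    have "(dist (\<gamma> t) x0)\<^sup>2 \<le> (t * d)\<^sup>2"
    proof (rule le_of_small_perturbation[where e = "1 / (\<bar>lam\<bar> + 1)" and c = K])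
      fix \<tau> :: real assume \<tau>: "0 < \<tau>" "\<tau> < 1 / (\<bar>lam\<bar> + 1)"
      then have "\<tau> * \<bar>lam\<bar> < 1" by (simp add: field_simps)
      from \<gamma>(2)[OF t \<tau>(1) this \<open>y \<in> B\<close>]
      have "2 * \<tau> * (F (\<gamma> t) y + (dist (\<gamma> t) x0)\<^sup>2 / (2 * \<tau>))
        \<le> 2 * \<tau> * ((1 - t) * F x0 y + t * (F x1 y + d\<^sup>2 / (2 * \<tau>))
            - (1 / \<tau> + lam) / 2 * t * (1 - t) * d\<^sup>2)"
        using \<tau>(1) by (intro mult_left_mono) (auto simp: d_def dist_commute)
      moreover have "2 * \<tau> * (F (\<gamma> t) y + (dist (\<gamma> t) x0)\<^sup>2 / (2 * \<tau>))
          = 2 * \<tau> * F (\<gamma> t) y + (dist (\<gamma> t) x0)\<^sup>2"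
        using \<tau>(1) by (simp add: field_simps)
      moreover have "2 * \<tau> * ((1 - t) * F x0 y + t * (F x1 y + d\<^sup>2 / (2 * \<tau>))
            - (1 / \<tau> + lam) / 2 * t * (1 - t) * d\<^sup>2)
          = \<tau> * K + 2 * \<tau> * F (\<gamma> t) y + (t * d)\<^sup>2"
        using \<tau>(1) by (simp add: K_def field_simps power2_eq_square)
      ultimately show "(dist (\<gamma> t) x0)\<^sup>2 \<le> (t * d)\<^sup>2 + \<tau> * K" by linarith
    qed auto
    then show ?thesis using t by (auto simp: d_def intro: power2_le_imp_le)
  qed
  then show ?thesis using \<gamma> by blast
qed

text \<open>Semicontinuity bounds \<open>F\<close> from below on a ball around \<open>x0\<close>. A
  distant \<open>x\<close> is joined to \<open>x0\<close> by a curve whose initial piece lies in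
  that ball, and convexity converts the bound there into one at \<open>x\<close> that deteriorates
  at most quadratically.\<close>

lemma growth:
  assumes "y \<in> B" "x0 \<in> A"
  shows "\<exists>C. \<forall>x\<in>A. - C - (\<bar>lam\<bar> + 2) * (dist x x0)\<^sup>2 \<le> F x y"
proof -
  \<comment> \<open>The penalty coefficient 1 / (2 \<tau>) is then |\<open>lam\<close>| + 1; the
    additional 1 in the statement comes from the arithmetic-geometric inequality for the term linear
    in the distance.\<close>
  define \<tau> where "\<tau> = 1 / (2 * (\<bar>lam\<bar> + 1))"
  have \<tau>: "\<tau> > 0" "\<tau> * \<bar>lam\<bar> < 1" by (auto simp: \<tau>_def field_simps)
  have mu: "1 / \<tau> + lam \<ge> 0" by (auto simp: \<tau>_def)
  have "open (- {x \<in> A. F x y \<le> F x0 y - 1})" using closedX[OF \<open>y \<in> B\<close>] by blast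
  moreover have "x0 \<in> - {x \<in> A. F x y \<le> F x0 y - 1}" by simp
  ultimately obtain r where r: "r > 0" "ball x0 r \<subseteq> - {x \<in> A. F x y \<le> F x0 y - 1}"
    by (rule openE)
  have "- (1 / r\<^sup>2 + 1 - F x0 y) - (\<bar>lam\<bar> + 2) * (dist x x0)\<^sup>2 \<le> F x y" if xA: "x \<in> A" for x
  proof (cases "dist x x0 < r")
    case True
    then have "F x0 y - 1 < F x y" using r(2) that by (auto simp: subset_iff dist_commute)
    moreover have "0 \<le> (\<bar>lam\<bar> + 2) * (dist x x0)\<^sup>2" "0 \<le> 1 / r\<^sup>2" by auto
    ultimately show ?thesis by linarith
  next
    case False
    define d where "d = dist x0 x"
    have d: "d \<ge> r" using False by (simp add: d_def dist_commute)
    obtain \<gamma> where \<gamma>: "\<And>t. t \<in> {0..1} \<Longrightarrow> \<gamma> t \<in> A \<and> dist (\<gamma> t) x0 \<le> t * d"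
      "\<And>t. t \<in> {0..1} \<Longrightarrow> F (\<gamma> t) y + (dist (\<gamma> t) x0)\<^sup>2 / (2 * \<tau>)
          \<le> (1 - t) * F x0 y + t * (F x y + d\<^sup>2 / (2 * \<tau>))
            - (1 / \<tau> + lam) / 2 * t * (1 - t) * d\<^sup>2"
      using curve_dist[OF \<open>x0 \<in> A\<close> xA] \<tau> \<open>y \<in> B\<close> unfolding d_def dist_commute[of x x0] by meson
    \<comment> \<open>The parameter at which the curve has moved at most half the radius of the
      ball.\<close>
    define t where "t = r / (2 * d)"
    have t: "0 < t" "t \<le> 1" and td: "t * d = r / 2" using d r(1) by (auto simp: t_def)
    have "dist (\<gamma> t) x0 < r" using \<gamma>(1)[of t] t td r(1) by auto
    then have "F x0 y - 1 < F (\<gamma> t) y" using r(2) \<gamma>(1)[of t] t by (auto simp: subset_iff dist_commute)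
    moreover have "0 \<le> (dist (\<gamma> t) x0)\<^sup>2 / (2 * \<tau>)" using \<tau> by simp
    moreover have "0 \<le> (1 / \<tau> + lam) / 2 * t * (1 - t) * d\<^sup>2" using mu t by simp
    ultimately have "F x0 y - 1 \<le> (1 - t) * F x0 y + t * (F x y + d\<^sup>2 / (2 * \<tau>))"
      using \<gamma>(2)[of t] t unfolding atLeastAtMost_iff by argo
    then have "- 1 \<le> t * (F x y - F x0 y + d\<^sup>2 / (2 * \<tau>))" by (simp add: algebra_simps)
    then have "- (1 / t) \<le> F x y - F x0 y + d\<^sup>2 / (2 * \<tau>)" using t(1) by (simp add: field_simps)
    moreover have "1 / t = 2 * (1 / r) * d" using d r(1) by (simp add: t_def)
    moreover have "2 * (1 / r) * d \<le> 1 / r\<^sup>2 + d\<^sup>2"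
      using sum_squares_bound[of "1 / r" d] by (simp add: power_divide)
    moreover have "d\<^sup>2 / (2 * \<tau>) = (\<bar>lam\<bar> + 1) * d\<^sup>2" by (simp add: \<tau>_def)
    ultimately have "- (1 / r\<^sup>2) - (\<bar>lam\<bar> + 2) * d\<^sup>2 \<le> F x y - F x0 y" by (simp add: algebra_simps)
    then show ?thesis by (simp add: d_def dist_commute)
  qed
  then show ?thesis by blast
qed

text \<open>At this step size the penalty coefficient 1 / (2 \<tau>) equals 2 (|\<open>lam\<close>|
  + 2), the loss from \<open>growth\<close> after the factor 2 of \<open>sq_dist_le_double\<close>.
  It also yields \<tau> |\<open>lam\<close>| \<le> 1/4.\<close>

definition tau0 :: real where "tau0 = 1 / (4 * (\<bar>lam\<bar> + 2))"

lemma tau0_pos: "tau0 > 0" by (simp add: tau0_def)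

lemma tau0D:
  assumes "0 < \<tau>" "\<tau> \<le> tau0"
  shows "\<tau> * \<bar>lam\<bar> \<le> 1 / 4" "2 * (\<bar>lam\<bar> + 2) \<le> 1 / (2 * \<tau>)" "1 / \<tau> + lam > 0" "\<tau> \<le> 1"
    "\<tau> * \<bar>lam\<bar> < 1"
proof -
  have *: "\<tau> * \<bar>lam\<bar> + 2 * \<tau> \<le> 1 / 4"
    using assms(2) by (simp add: tau0_def field_simps)
  then show 1: "\<tau> * \<bar>lam\<bar> \<le> 1 / 4" using assms by linarith
  then show "\<tau> * \<bar>lam\<bar> < 1" by simp
  show "2 * (\<bar>lam\<bar> + 2) \<le> 1 / (2 * \<tau>)" using * assms by (simp add: field_simps)
  have "0 \<le> \<tau> * \<bar>lam\<bar>" using assms by simp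
  then show "\<tau> \<le> 1" using * by linarith
  have "\<bar>\<tau> * lam\<bar> \<le> 1 / 4" using 1 assms by (simp add: abs_mult)
  then have "1 + \<tau> * lam > 0" by linarith
  then show "1 / \<tau> + lam > 0" using assms by (simp add: field_simps)
qed

lemma bounded_below_penalized:
  assumes "y \<in> B" "0 < \<tau>" "\<tau> \<le> tau0"
  shows "\<exists>m. \<forall>x\<in>A. m \<le> F x y + (dist x x')\<^sup>2 / (2 * \<tau>)"
proof -
  obtain x0 where x0: "x0 \<in> A" using A_nonempty by blast
  obtain C where C: "\<And>x. x \<in> A \<Longrightarrow> - C - (\<bar>lam\<bar> + 2) * (dist x x0)\<^sup>2 \<le> F x y"
    using growth[OF \<open>y \<in> B\<close> x0] by blast
  have "- C - (\<bar>lam\<bar> + 2) * (2 * (dist x' x0)\<^sup>2) \<le> F x y + (dist x x')\<^sup>2 / (2 * \<tau>)" if "x \<in> A" for x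
  proof -
    have "(\<bar>lam\<bar> + 2) * (dist x x0)\<^sup>2 \<le> (\<bar>lam\<bar> + 2) * (2 * (dist x x')\<^sup>2 + 2 * (dist x' x0)\<^sup>2)"
      by (intro mult_left_mono sq_dist_le_double) auto
    moreover have "2 * (\<bar>lam\<bar> + 2) * (dist x x')\<^sup>2 \<le> 1 / (2 * \<tau>) * (dist x x')\<^sup>2"
      by (intro mult_right_mono tau0D(2) assms) auto
    ultimately show ?thesis using C[OF that] by (simp add: algebra_simps)
  qed
  then show ?thesis by blast
qed

text \<open>The minimizer is compared with the point at parameter t on the curve to
  \<open>z\<close>; division by t and t tending to 0 turn convexity into quadratic growth with the
  full constant.\<close>

lemma minimizer_strong:
  assumes "y \<in> B" "0 < \<tau>" "\<tau> \<le> tau0" "x \<in> A" "z \<in> A"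
    and min: "\<And>z. z \<in> A \<Longrightarrow> F x y + (dist x x')\<^sup>2 / (2 * \<tau>) \<le> F z y + (dist z x')\<^sup>2 / (2 * \<tau>)"
  shows "F x y + (dist x x')\<^sup>2 / (2 * \<tau>) + (1 / \<tau> + lam) / 2 * (dist x z)\<^sup>2 \<le> F z y + (dist z x')\<^sup>2 / (2 * \<tau>)"
proof -
  define f where "f z = F z y + (dist z x')\<^sup>2 / (2 * \<tau>)" for z
  define M where "M = (1 / \<tau> + lam) / 2 * (dist x z)\<^sup>2"
  obtain \<gamma> where \<gamma>: "\<And>t. t \<in> {0..1} \<Longrightarrow> \<gamma> t \<in> A"
    "\<And>t. t \<in> {0..1} \<Longrightarrow> f (\<gamma> t) \<le> (1 - t) * f x + t * f z - (1 / \<tau> + lam) / 2 * t * (1 - t) * (dist x z)\<^sup>2"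
    using convX[OF \<open>x \<in> A\<close> \<open>z \<in> A\<close>, of x'] assms(1,2) tau0D(5)[OF assms(2,3)] unfolding f_def by blast
  have "f x + M \<le> f z"
  proof (rule le_of_small_perturbation[where e = 1 and c = M])
    fix t :: real assume t: "0 < t" "t < 1"
    then have "f x \<le> f (\<gamma> t)" using min \<gamma>(1) by (auto simp: f_def)
    also have "\<dots> \<le> (1 - t) * f x + t * f z - t * (1 - t) * M"
      using \<gamma>(2)[of t] t by (simp add: M_def mult_ac)
    finally have "0 \<le> t * (f z + t * M - f x - M)" by (simp add: algebra_simps)
    then have "0 \<le> f z + t * M - f x - M" using t(1) by (simp add: zero_le_mult_iff)
    then show "f x + M \<le> f z + t * M" by linarith
  qed simp
  then show ?thesis by (simp add: f_def M_def)
qed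

lemma minimizer_exists:
  assumes "y \<in> B" "0 < \<tau>" "\<tau> \<le> tau0"
  shows "\<exists>x\<in>A. \<forall>z\<in>A. F x y + (dist x x')\<^sup>2 / (2 * \<tau>) + (1 / \<tau> + lam) / 2 * (dist x z)\<^sup>2
                    \<le> F z y + (dist z x')\<^sup>2 / (2 * \<tau>)"
proof -
  define f where "f z = F z y + (dist z x')\<^sup>2 / (2 * \<tau>)" for z
  obtain m where m: "\<And>x. x \<in> A \<Longrightarrow> m \<le> f x"
    using bounded_below_penalized[OF assms] unfolding f_def by blast
  have "\<exists>x\<in>A. \<forall>z\<in>A. f x \<le> f z"
  proof (rule strongly_convex_min[OF A_nonempty tau0D(3)[OF assms(2,3)] m])
    fix x0 x1 assume "x0 \<in> A" "x1 \<in> A"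
    then obtain \<gamma> where \<gamma>: "\<And>t. t \<in> {0..1} \<Longrightarrow> \<gamma> t \<in> A"
    "\<And>t. t \<in> {0..1} \<Longrightarrow> f (\<gamma> t) \<le> (1 - t) * f x0 + t * f x1 - (1 / \<tau> + lam) / 2 * t * (1 - t) * (dist x0 x1)\<^sup>2"
      using convX[of x0 x1 x'] assms(1,2) tau0D(5)[OF assms(2,3)] unfolding f_def by blast
    show "\<exists>z\<in>A. f z \<le> (f x0 + f x1) / 2 - (1 / \<tau> + lam) / 8 * (dist x0 x1)\<^sup>2"
      using \<gamma>(1)[of "1/2"] \<gamma>(2)[of "1/2"] by (intro bexI[of _ "\<gamma> (1/2)"]) (auto simp: field_simps)
  next
    fix X x c assume X: "\<And>n. X n \<in> A" "X \<longlonglongrightarrow> x" "(\<lambda>n. f (X n)) \<longlonglongrightarrow> c"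
    have "x \<in> A \<and> F x y \<le> c - (dist x x')\<^sup>2 / (2 * \<tau>)"
    proof (rule lscX_seq[OF \<open>y \<in> B\<close> X(1,2)])
      show "(\<lambda>n. f (X n) - (dist (X n) x')\<^sup>2 / (2 * \<tau>)) \<longlonglongrightarrow> c - (dist x x')\<^sup>2 / (2 * \<tau>)"
        by (intro tendsto_intros X) (use assms in auto)
    qed (simp add: f_def)
    then show "x \<in> A \<and> f x \<le> c" by (simp add: f_def)
  qed
  then obtain x where "x \<in> A" "\<And>z. z \<in> A \<Longrightarrow> f x \<le> f z" by blast
  then show ?thesis using minimizer_strong[OF assms \<open>x \<in> A\<close>] unfolding f_def by blast
qed

end

section \<open>Saddle points of the penalized functional\<close>

context saddle_system
begin

text \<open>Existence of a saddle point without compactness: let \<open>b\<close> maximize \<open>G = inf f\<close> over the first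
  variable. For \<open>z\<close> in \<open>B\<close>, the minimizers belonging to points on the curve from \<open>b\<close> to \<open>z\<close> converge
  to the minimizer \<open>a\<close> belonging to \<open>b\<close>, by strong convexity; maximality of \<open>b\<close> then passes to the
  limit and gives the saddle inequality at \<open>(a, b)\<close>.\<close>

lemma saddle_exists:
  assumes tau: "0 < \<tau>" "\<tau> \<le> tau0"
  shows "\<exists>x1\<in>A. \<exists>y1\<in>B.
    (\<forall>z\<in>A. F x1 y1 + (dist x1 x)\<^sup>2 / (2 * \<tau>) + (1 / \<tau> + lam) / 2 * (dist x1 z)\<^sup>2
              \<le> F z y1 + (dist z x)\<^sup>2 / (2 * \<tau>)) \<and>
    (\<forall>z\<in>B. - F x1 y1 + (dist y1 y)\<^sup>2 / (2 * \<tau>) + (1 / \<tau> + lam) / 2 * (dist y1 z)\<^sup>2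
              \<le> - F x1 z + (dist z y)\<^sup>2 / (2 * \<tau>))"
proof -
  interpret sw: saddle_system lam B A "\<lambda>y x. - F x y" "\<lambda>y x. - P x y" "\<lambda>y. - q y" "\<lambda>x. - p x"
    by (rule swap)
  define \<mu> where "\<mu> = 1 / \<tau> + lam"
  have mu: "\<mu> > 0" using tau0D(3)[OF tau] by (simp add: \<mu>_def)
  define dX where "dX z = (dist z x)\<^sup>2 / (2 * \<tau>)" for z
  define dY where "dY z = (dist z y)\<^sup>2 / (2 * \<tau>)" for z
  have "\<exists>xm. \<forall>b\<in>B. xm b \<in> A \<and> (\<forall>z\<in>A. F (xm b) b + dX (xm b) + \<mu> / 2 * (dist (xm b) z)\<^sup>2 \<le> F z b + dX z)"
    by (rule bchoice) (use minimizer_exists[OF _ tau, of _ x] in \<open>force simp: dX_def \<mu>_def\<close>)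
  then obtain xm where xmA: "\<And>b. b \<in> B \<Longrightarrow> xm b \<in> A" and
    xm: "\<And>b z. b \<in> B \<Longrightarrow> z \<in> A \<Longrightarrow> F (xm b) b + dX (xm b) + \<mu> / 2 * (dist (xm b) z)\<^sup>2 \<le> F z b + dX z"
    by blast
  define G where "G b = F (xm b) b + dX (xm b) - dY b" for b
  have G_le: "G b \<le> F z b + dX z - dY b" if "b \<in> B" "z \<in> A" for b z
  proof -
    have "0 \<le> \<mu> / 2 * (dist (xm b) z)\<^sup>2" using mu by simp
    then show ?thesis using xm[OF that] by (simp add: G_def)
  qed
  \<comment> \<open>The curve is the same for every \<open>a\<close>, so the inequality survives the
    infimum over \<open>a\<close> and makes \<open>G\<close> strongly concave along it.\<close>
  have concave: "\<exists>\<sigma>. \<forall>t\<in>{0..1}. \<sigma> t \<in> B \<and> (\<forall>a\<in>A. (1 - t) * (F a b0 - dY b0) + t * (F a b1 - dY b1)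
        + \<mu> / 2 * t * (1 - t) * (dist b0 b1)\<^sup>2 \<le> F a (\<sigma> t) - dY (\<sigma> t))" if b: "b0 \<in> B" "b1 \<in> B" for b0 b1
  proof -
    obtain \<sigma> where \<sigma>: "\<forall>t\<in>{0..1}. \<sigma> t \<in> B \<and> (\<forall>\<tau> x. 0 < \<tau> \<and> \<tau> * \<bar>lam\<bar> < 1 \<and> x \<in> A \<longrightarrow>
        - F x (\<sigma> t) + (dist (\<sigma> t) y)\<^sup>2 / (2 * \<tau>)
          \<le> (1 - t) * (- F x b0 + (dist b0 y)\<^sup>2 / (2 * \<tau>)) + t * (- F x b1 + (dist b1 y)\<^sup>2 / (2 * \<tau>))
            - (1 / \<tau> + lam) / 2 * t * (1 - t) * (dist b0 b1)\<^sup>2)"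
      using convY[OF b, of y] by blast
    have "\<sigma> t \<in> B \<and> (\<forall>a\<in>A. (1 - t) * (F a b0 - dY b0) + t * (F a b1 - dY b1)
        + \<mu> / 2 * t * (1 - t) * (dist b0 b1)\<^sup>2 \<le> F a (\<sigma> t) - dY (\<sigma> t))" if "t \<in> {0..1}" for t
    proof (intro conjI ballI)
      show "\<sigma> t \<in> B" using \<sigma> that by blast
      fix a assume "a \<in> A"
      then have "- F a (\<sigma> t) + dY (\<sigma> t) \<le> (1 - t) * (- F a b0 + dY b0) + t * (- F a b1 + dY b1)
            - \<mu> / 2 * t * (1 - t) * (dist b0 b1)\<^sup>2"
        using \<sigma>[rule_format, OF that] tau(1) tau0D(5)[OF tau] unfolding dY_def \<mu>_def by blast
      then show "(1 - t) * (F a b0 - dY b0) + t * (F a b1 - dY b1)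
        + \<mu> / 2 * t * (1 - t) * (dist b0 b1)\<^sup>2 \<le> F a (\<sigma> t) - dY (\<sigma> t)"
        by (simp add: algebra_simps)
    qed
    then show ?thesis by blast
  qed
  obtain a0 where a0: "a0 \<in> A" using A_nonempty by blast
  obtain m where m: "\<And>b. b \<in> B \<Longrightarrow> m \<le> - F a0 b + dY b"
    using sw.bounded_below_penalized[OF a0 tau, of y] by (auto simp: dY_def)
  have "\<exists>b\<in>B. \<forall>z\<in>B. - G b \<le> - G z"
  proof (rule strongly_convex_min[OF B_nonempty mu])
    fix b assume "b \<in> B"
    then show "m - dX a0 \<le> - G b" using m[of b] G_le[OF _ a0, of b] by simp
  next
    fix b0 b1 assume b: "b0 \<in> B" "b1 \<in> B"
    obtain \<sigma> where \<sigma>: "\<forall>t\<in>{0..1}. \<sigma> t \<in> B \<and> (\<forall>a\<in>A. (1 - t) * (F a b0 - dY b0) + t * (F a b1 - dY b1)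
        + \<mu> / 2 * t * (1 - t) * (dist b0 b1)\<^sup>2 \<le> F a (\<sigma> t) - dY (\<sigma> t))"
      using concave[OF b] by blast
    define z where "z = \<sigma> (1/2)"
    have z: "z \<in> B" "\<And>a. a \<in> A \<Longrightarrow> (1 / 2) * (F a b0 - dY b0) + (1 / 2) * (F a b1 - dY b1)
        + \<mu> / 8 * (dist b0 b1)\<^sup>2 \<le> F a z - dY z"
      using \<sigma>[rule_format, of "1/2"] by (auto simp: z_def)
    \<comment> \<open>The inequality is evaluated at \<open>xm z\<close>, where the infimum
      \<open>G z\<close> is attained; at \<open>b0\<close> and \<open>b1\<close> this point is
      merely a competitor.\<close>
    have "- G z \<le> (- G b0 + - G b1) / 2 - \<mu> / 8 * (dist b0 b1)\<^sup>2"
      using z(2)[OF xmA[OF z(1)]] G_le[OF b(1) xmA[OF z(1)]] G_le[OF b(2) xmA[OF z(1)]]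
      unfolding G_def by argo
    then show "\<exists>z\<in>B. - G z \<le> (- G b0 + - G b1) / 2 - \<mu> / 8 * (dist b0 b1)\<^sup>2" using z(1) by blast
  next
    fix Y b c assume Y: "\<And>n. Y n \<in> B" "Y \<longlonglongrightarrow> b" "(\<lambda>n. - G (Y n)) \<longlonglongrightarrow> c"
    \<comment> \<open>\<open>G\<close> is upper semicontinuous as an infimum of upper semicontinuous
      functions: every \<open>a\<close> gives a bound in the limit, and \<open>a = xm b\<close>
      gives the required one.\<close>
    have *: "b \<in> B \<and> - F a b \<le> c + dX a - dY b" if "a \<in> A" for a
    proof (rule sw.lscX_seq[OF that Y(1,2)])
      show "(\<lambda>n. - G (Y n) + dX a - dY (Y n)) \<longlonglongrightarrow> c + dX a - dY b"
        unfolding dY_def by (intro tendsto_intros Y) (use tau in auto)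
      show "- F a (Y n) \<le> - G (Y n) + dX a - dY (Y n)" for n using G_le[OF Y(1) that, of n] by simp
    qed
    have "b \<in> B" using *[OF a0] by blast
    then show "b \<in> B \<and> - G b \<le> c" using *[OF xmA[OF \<open>b \<in> B\<close>]] by (simp add: G_def)
  qed
  then obtain b where b: "b \<in> B" and bmax: "\<And>z. z \<in> B \<Longrightarrow> G z \<le> G b" by auto
  define a where "a = xm b"
  have a: "a \<in> A" using xmA b by (simp add: a_def)
  have saddle: "F a z - dY z \<le> F a b - dY b" if z: "z \<in> B" for z
  proof -
    obtain \<sigma> where \<sigma>: "\<forall>t\<in>{0..1}. \<sigma> t \<in> B \<and> (\<forall>a\<in>A. (1 - t) * (F a b - dY b) + t * (F a z - dY z)
        + \<mu> / 2 * t * (1 - t) * (dist b z)\<^sup>2 \<le> F a (\<sigma> t) - dY (\<sigma> t))"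
      using concave[OF b z] by blast
    \<comment> \<open>The double \<open>Suc\<close> keeps \<open>t n\<close> at most 1/2, hence
      \<open>1 - t n\<close> at least 1/2 in \<open>bound\<close>.\<close>
    define t where "t n = 1 / real (Suc (Suc n))" for n
    have t: "0 < t n" "t n \<le> 1 / 2" "t n \<in> {0..1}" for n by (auto simp: t_def)
    have tlim: "t \<longlonglongrightarrow> 0"
      unfolding t_def using LIMSEQ_Suc[OF LIMSEQ_Suc[OF lim_1_over_n]] by simp
    define X where "X n = xm (\<sigma> (t n))" for n
    have \<sigma>B: "\<sigma> (t n) \<in> B" for n using \<sigma> t(3) by blast
    have XA: "X n \<in> A" for n using \<sigma>B xmA by (simp add: X_def)
    \<comment> \<open>Concavity from below and maximality of \<open>b\<close> from above, both at
      the curve point paired with its own minimizer \<open>X n\<close>.\<close>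
    have conc: "(1 - t n) * (F (X n) b + dX (X n) - dY b) + t n * (F (X n) z + dX (X n) - dY z) \<le> G b" for n
    proof -
      have "(1 - t n) * (F (X n) b - dY b) + t n * (F (X n) z - dY z)
          + \<mu> / 2 * t n * (1 - t n) * (dist b z)\<^sup>2 \<le> F (X n) (\<sigma> (t n)) - dY (\<sigma> (t n))"
        using \<sigma> t(3) XA by blast
      moreover have "0 \<le> \<mu> / 2 * t n * (1 - t n) * (dist b z)\<^sup>2" using mu t[of n] by simp
      moreover have "F (X n) (\<sigma> (t n)) + dX (X n) - dY (\<sigma> (t n)) \<le> G b"
        using bmax[OF \<sigma>B] by (simp add: G_def X_def)
      moreover have "(1 - t n) * (F (X n) b + dX (X n) - dY b) + t n * (F (X n) z + dX (X n) - dY z)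
          = (1 - t n) * (F (X n) b - dY b) + t n * (F (X n) z - dY z) + dX (X n)"
        by (simp add: algebra_simps)
      ultimately show ?thesis by linarith
    qed
    have near: "G b + \<mu> / 2 * (dist a (X n))\<^sup>2 \<le> F (X n) b + dX (X n) - dY b" for n
      using xm[OF b XA[of n]] by (simp add: G_def a_def)
    \<comment> \<open>\<open>near\<close> inserts the squared distance of \<open>X n\<close> from
      \<open>a\<close> into \<open>conc\<close>, where everything else is of order
      \<open>t n\<close>.\<close>
    have bound: "(dist (X n) a)\<^sup>2 \<le> t n * (4 / \<mu> * (G b - G z))" for n
    proof -
      have "(1 - t n) * (G b + \<mu> / 2 * (dist a (X n))\<^sup>2) + t n * G z \<le> G b"
      proof -
        have "(1 - t n) * (G b + \<mu> / 2 * (dist a (X n))\<^sup>2) \<le> (1 - t n) * (F (X n) b + dX (X n) - dY b)"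
          using near[of n] t[of n] by (intro mult_left_mono) auto
        moreover have "t n * G z \<le> t n * (F (X n) z + dX (X n) - dY z)"
          using G_le[OF z XA[of n]] t[of n] by (intro mult_left_mono) auto
        ultimately show ?thesis using conc[of n] by linarith
      qed
      then have "(1 - t n) * (\<mu> / 2 * (dist a (X n))\<^sup>2) \<le> t n * (G b - G z)"
        by (simp add: algebra_simps)
      moreover have "1 / 2 * (\<mu> / 2 * (dist a (X n))\<^sup>2) \<le> (1 - t n) * (\<mu> / 2 * (dist a (X n))\<^sup>2)"
        using t[of n] mu by (intro mult_right_mono) auto
      ultimately have "\<mu> / 4 * (dist (X n) a)\<^sup>2 \<le> t n * (G b - G z)" by (simp add: dist_commute)
      then show ?thesis using mu by (simp add: field_simps)
    qed
    have "(\<lambda>n. (dist (X n) a)\<^sup>2) \<longlonglongrightarrow> 0"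
    proof (rule tendsto_sandwich[where f = "\<lambda>_. 0" and h = "\<lambda>n. t n * (4 / \<mu> * (G b - G z))"])
      show "(\<lambda>n. t n * (4 / \<mu> * (G b - G z))) \<longlonglongrightarrow> 0" by (rule tendsto_mult_left_zero[OF tlim])
    qed (use bound in auto)
    then have "(\<lambda>n. sqrt ((dist (X n) a)\<^sup>2)) \<longlonglongrightarrow> sqrt 0" by (intro tendsto_real_sqrt)
    then have Xlim: "X \<longlonglongrightarrow> a" by (subst tendsto_dist_iff) simp
    have "a \<in> A \<and> F a z \<le> G b - dX a + dY z"
    proof (rule lscX_seq[OF z XA Xlim])
      show "(\<lambda>n. G b - dX (X n) + dY z) \<longlonglongrightarrow> G b - dX a + dY z"
        unfolding dX_def by (intro tendsto_intros Xlim) (use tau in auto)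
      fix n
      \<comment> \<open>By \<open>near\<close> the first summand of \<open>conc\<close> is at least
        \<open>(1 - t n) * G b\<close>; what remains can be divided by \<open>t n\<close>.\<close>
      have "0 \<le> \<mu> / 2 * (dist a (X n))\<^sup>2" using mu by simp
      then have "(1 - t n) * G b \<le> (1 - t n) * (F (X n) b + dX (X n) - dY b)"
        using near[of n] t[of n] by (intro mult_left_mono) auto
      then have "t n * (F (X n) z + dX (X n) - dY z) \<le> t n * G b"
        using conc[of n] by (simp add: algebra_simps)
      then have "F (X n) z + dX (X n) - dY z \<le> G b" using t(1)[of n] by (simp only: mult_le_cancel_left_pos)
      then show "F (X n) z \<le> G b - dX (X n) + dY z" by simp
    qed
    then show ?thesis by (simp add: G_def a_def)
  qed
  have "- F a b + (dist b y)\<^sup>2 / (2 * \<tau>) \<le> - F a z + (dist z y)\<^sup>2 / (2 * \<tau>)" if "z \<in> B" for z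
    using saddle[OF that] by (simp add: dY_def)
  then have "- F a b + dY b + \<mu> / 2 * (dist b z)\<^sup>2 \<le> - F a z + dY z" if "z \<in> B" for z
    using sw.minimizer_strong[OF a tau b that, of y] unfolding dY_def \<mu>_def by blast
  then show ?thesis using a b xm[OF b] unfolding dX_def dY_def \<mu>_def a_def by blast
qed

section \<open>Discrete evolution variational inequalities\<close>

text \<open>Strong minimality from \<open>saddle_exists\<close> multiplied by 2 \<tau>, the discrete
  form of the EVI. Later arguments use a step only through membership in the domain, this inequality
  and its counterpart \<open>stepY\<close>.\<close>

definition stepX :: "real \<Rightarrow> 'a \<Rightarrow> 'a \<Rightarrow> 'b \<Rightarrow> bool" where
  "stepX \<tau> x x1 y1 \<longleftrightarrow> (\<forall>z\<in>A. (1 + lam * \<tau>) * (dist x1 z)\<^sup>2 - (dist x z)\<^sup>2 + (dist x1 x)\<^sup>2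
                              \<le> 2 * \<tau> * (F z y1 - F x1 y1))"

definition stepY :: "real \<Rightarrow> 'b \<Rightarrow> 'a \<Rightarrow> 'b \<Rightarrow> bool" where
  "stepY \<tau> y x1 y1 \<longleftrightarrow> (\<forall>z\<in>B. (1 + lam * \<tau>) * (dist y1 z)\<^sup>2 - (dist y z)\<^sup>2 + (dist y1 y)\<^sup>2
                              \<le> 2 * \<tau> * (F x1 y1 - F x1 z))"

definition step :: "real \<Rightarrow> 'a \<times> 'b \<Rightarrow> 'a \<times> 'b \<Rightarrow> bool" where
  "step \<tau> w w1 \<longleftrightarrow> w1 \<in> A \<times> B \<and> stepX \<tau> (fst w) (fst w1) (snd w1) \<and> stepY \<tau> (snd w) (fst w1) (snd w1)"

lemma step_exists:
  assumes "0 < \<tau>" "\<tau> \<le> tau0"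
  shows "\<exists>w1. step \<tau> w w1"
proof -
  have scale: "(1 + lam * \<tau>) * d1 - d2 + d3 \<le> 2 * \<tau> * (f2 - f1)"
    if "f1 + d3 / (2 * \<tau>) + (1 / \<tau> + lam) / 2 * d1 \<le> f2 + d2 / (2 * \<tau>)" for f1 f2 d1 d2 d3
  proof -
    have "2 * \<tau> * (f1 + d3 / (2 * \<tau>) + (1 / \<tau> + lam) / 2 * d1) \<le> 2 * \<tau> * (f2 + d2 / (2 * \<tau>))"
      using that assms by (intro mult_left_mono) auto
    moreover have "2 * \<tau> * (f1 + d3 / (2 * \<tau>) + (1 / \<tau> + lam) / 2 * d1) = 2 * \<tau> * f1 + d3 + (1 + lam * \<tau>) * d1"
      using assms by (simp add: field_simps)
    moreover have "2 * \<tau> * (f2 + d2 / (2 * \<tau>)) = 2 * \<tau> * f2 + d2"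
      using assms by (simp add: field_simps)
    ultimately show ?thesis by (simp add: algebra_simps)
  qed
  obtain x1 y1 where "x1 \<in> A" "y1 \<in> B" and
    X: "\<And>z. z \<in> A \<Longrightarrow> F x1 y1 + (dist x1 (fst w))\<^sup>2 / (2 * \<tau>) + (1 / \<tau> + lam) / 2 * (dist x1 z)\<^sup>2
              \<le> F z y1 + (dist z (fst w))\<^sup>2 / (2 * \<tau>)" and
    Y: "\<And>z. z \<in> B \<Longrightarrow> - F x1 y1 + (dist y1 (snd w))\<^sup>2 / (2 * \<tau>) + (1 / \<tau> + lam) / 2 * (dist y1 z)\<^sup>2
              \<le> - F x1 z + (dist z (snd w))\<^sup>2 / (2 * \<tau>)"
    using saddle_exists[OF assms, of "fst w" "snd w"] by blast
  have "stepX \<tau> (fst w) x1 y1"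
    unfolding stepX_def using scale[OF X] by (simp add: dist_commute)
  moreover have "stepY \<tau> (snd w) x1 y1"
    unfolding stepY_def
  proof
    fix z assume "z \<in> B"
    from scale[OF Y[OF this]] show "(1 + lam * \<tau>) * (dist y1 z)\<^sup>2 - (dist (snd w) z)\<^sup>2 + (dist y1 (snd w))\<^sup>2
        \<le> 2 * \<tau> * (F x1 y1 - F x1 z)" by (simp add: dist_commute)
  qed
  ultimately have "step \<tau> w (x1, y1)" using \<open>x1 \<in> A\<close> \<open>y1 \<in> B\<close> by (simp add: step_def)
  then show ?thesis ..
qed

end

section \<open>The minimizing movement scheme\<close>

lemma sq_dist_Pair: "(dist w z)\<^sup>2 = (dist (fst w) (fst z))\<^sup>2 + (dist (snd w) (snd z))\<^sup>2"
  by (simp add: dist_prod_def)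

text \<open>The bracket depends on two step counts. Lowering one of them shifts the difference of
  the two times by -\<open>t\<close> with weight \<open>s\<close>, or by \<open>s\<close> with
  weight \<open>t\<close>. The mean shift is 0, and the variance s t^2 + t s^2 is offset by the
  summand t^2 or s^2 that is lost.\<close>

lemma crandall_liggett_identity:
  fixes a c i j s t :: real
  shows "s * (a + c * ((i * t - (1 + j) * s)\<^sup>2 + i * t\<^sup>2 + (1 + j) * s\<^sup>2))
      + t * (a + c * (((1 + i) * t - j * s)\<^sup>2 + (1 + i) * t\<^sup>2 + j * s\<^sup>2))
    = (s + t) * (a + c * (((1 + i) * t - (1 + j) * s)\<^sup>2 + (1 + i) * t\<^sup>2 + (1 + j) * s\<^sup>2))"
  by (simp add: power2_eq_square algebra_simps)

lemma weights_add:
  fixes \<eta> \<tau> c e a b a' \<beta> :: real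
  assumes "\<eta> * (c * a - b) \<le> \<eta> * (2 * \<tau> * \<beta>)" "\<tau> * (e * a - a') \<le> \<tau> * (2 * \<eta> * - \<beta>)"
  shows "(\<eta> * c + \<tau> * e) * a \<le> \<eta> * b + \<tau> * a'"
  using assms by (simp add: algebra_simps)

lemma weights_combine:
  fixes c e s t :: real
  assumes "\<eta> * c = c * e * s" "\<tau> * e = c * e * t"
  shows "\<eta> * (c * (W * R)) + \<tau> * (e * (W * R')) = W * (c * e) * (s * R + t * R')"
  using assms by algebra

context saddle_system
begin

definition beta :: "'a \<times> 'b \<Rightarrow> 'a \<times> 'b \<Rightarrow> real" where
  "beta z w = F (fst z) (snd w) - F (fst w) (snd z)"

lemma beta_swap: "beta z w = - beta w z"
  by (simp add: beta_def)

text \<open>In terms of the sum of both components only the quantity \<open>beta\<close> remains; its antisymmetry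
  makes it cancel whenever two (discrete or continuous) solutions are tested against each other.\<close>

lemma step_sum:
  assumes "step \<tau> w w1" "0 < \<tau>" "z \<in> A \<times> B"
  shows "(1 - \<bar>lam\<bar> * \<tau>) * (dist w1 z)\<^sup>2 - (dist w z)\<^sup>2 + (dist w1 w)\<^sup>2 \<le> 2 * \<tau> * beta z w1"
proof -
  have "(1 + lam * \<tau>) * (dist (fst w1) (fst z))\<^sup>2 - (dist (fst w) (fst z))\<^sup>2 + (dist (fst w1) (fst w))\<^sup>2
      \<le> 2 * \<tau> * (F (fst z) (snd w1) - F (fst w1) (snd w1))"
    "(1 + lam * \<tau>) * (dist (snd w1) (snd z))\<^sup>2 - (dist (snd w) (snd z))\<^sup>2 + (dist (snd w1) (snd w))\<^sup>2
      \<le> 2 * \<tau> * (F (fst w1) (snd w1) - F (fst w1) (snd z))"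
    using assms(1,3) by (auto simp: step_def stepX_def stepY_def mem_Times_iff)
  \<comment> \<open>Adding the components cancels the value of \<open>F\<close> at
    \<open>w1\<close>.\<close>
  then have "(1 + lam * \<tau>) * (dist w1 z)\<^sup>2 - (dist w z)\<^sup>2 + (dist w1 w)\<^sup>2 \<le> 2 * \<tau> * beta z w1"
    by (simp add: sq_dist_Pair beta_def algebra_simps)
  moreover have "(1 - \<bar>lam\<bar> * \<tau>) * (dist w1 z)\<^sup>2 \<le> (1 + lam * \<tau>) * (dist w1 z)\<^sup>2"
    using mult_right_mono[of "- \<bar>lam\<bar>" lam \<tau>] assms(2) by (intro mult_right_mono) auto
  ultimately show ?thesis by linarith
qed

section \<open>Slope bounds and comparison of two schemes\<close>

text \<open>The analogue of a bound \<open>K\<close> on the metric slope at \<open>w\<close>, in the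
  global form familiar from semiconvex functions: linear decrease with a quadratic
  correction.\<close>

definition slope_le :: "real \<Rightarrow> 'a \<times> 'b \<Rightarrow> bool" where
  "slope_le K w \<longleftrightarrow> w \<in> A \<times> B \<and> 0 \<le> K \<and>
     (\<forall>z\<in>A \<times> B. beta w z \<le> K * dist w z + \<bar>lam\<bar> / 2 * (dist w z)\<^sup>2)"

lemma slope_leD:
  assumes "slope_le K w" "z \<in> A \<times> B"
  shows "beta w z \<le> K * dist w z + \<bar>lam\<bar> / 2 * (dist w z)\<^sup>2"
  using assms unfolding slope_le_def by (elim conjE) (erule bspec)

lemma slope_le_mono:
  assumes "slope_le K w" "K \<le> K'"
  shows "slope_le K' w"
  unfolding slope_le_def
proof (intro conjI ballI)
  show "w \<in> A \<times> B" "0 \<le> K'" using assms by (simp_all only: slope_le_def) linarith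
  fix z assume "z \<in> A \<times> B"
  then show "beta w z \<le> K' * dist w z + \<bar>lam\<bar> / 2 * (dist w z)\<^sup>2"
    using slope_leD[OF assms(1)] mult_right_mono[OF assms(2), of "dist w z"] by force
qed

text \<open>By the triangle inequality the squared increment in \<open>step_sum\<close> cancels and
  the cross term \<open>2 * dist w1 w * dist w1 z\<close> is left; after division by 2 \<tau> its
  coefficient is the difference quotient.\<close>

lemma step_slope:
  assumes "step \<tau> w w1" "0 < \<tau>"
  shows "slope_le (dist w1 w / \<tau>) w1"
proof -
  have "beta w1 z \<le> dist w1 w / \<tau> * dist w1 z + \<bar>lam\<bar> / 2 * (dist w1 z)\<^sup>2" if "z \<in> A \<times> B" for z
  proof -
    have "(dist w z)\<^sup>2 \<le> (dist w1 w + dist w1 z)\<^sup>2"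
      by (intro power_mono) (use dist_triangle[of w z w1] in \<open>auto simp: dist_commute\<close>)
    then have "2 * \<tau> * beta w1 z \<le> 2 * (dist w1 w * dist w1 z) + \<bar>lam\<bar> * \<tau> * (dist w1 z)\<^sup>2"
      using step_sum[OF assms that] beta_swap[of w1 z] by (simp add: power2_eq_square algebra_simps)
    also have "\<dots> = 2 * \<tau> * (dist w1 w / \<tau> * dist w1 z + \<bar>lam\<bar> / 2 * (dist w1 z)\<^sup>2)"
      using assms(2) by (simp add: field_simps)
    finally show ?thesis using assms(2) by simp
  qed
  moreover have "w1 \<in> A \<times> B" using assms(1) by (simp only: step_def)
  ultimately show ?thesis using assms(2) unfolding slope_le_def by simp
qed

definition scheme :: "real \<Rightarrow> (nat \<Rightarrow> 'a \<times> 'b) \<Rightarrow> bool" where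
  "scheme \<tau> w \<longleftrightarrow> (\<forall>n. step \<tau> (w n) (w (Suc n)))"

text \<open>The amplification per implicit step: the inverse of the coefficient that
  \<open>step_sum\<close> puts on the new squared distance.\<close>

definition theta :: "real \<Rightarrow> real" where "theta \<tau> = 1 / (1 - \<bar>lam\<bar> * \<tau>)"

lemma theta:
  assumes "0 < \<tau>" "\<tau> \<le> tau0"
  shows "1 \<le> theta \<tau>" "theta \<tau> \<le> 2" "theta \<tau> * (1 - \<bar>lam\<bar> * \<tau>) = 1" "0 < 1 - \<bar>lam\<bar> * \<tau>"
    "theta \<tau> ^ n \<le> exp (2 * \<bar>lam\<bar> * (real n * \<tau>))" "theta \<tau> - 1 \<le> 2 * \<bar>lam\<bar> * \<tau>"
proof -
  have k: "\<bar>lam\<bar> * \<tau> \<le> 1 / 4" "0 \<le> \<bar>lam\<bar> * \<tau>" using tau0D(1)[OF assms] assms by (auto simp: mult.commute)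
  show pos: "0 < 1 - \<bar>lam\<bar> * \<tau>" using k by linarith
  show 1: "theta \<tau> * (1 - \<bar>lam\<bar> * \<tau>) = 1" using pos by (simp add: theta_def)
  show "1 \<le> theta \<tau>" using pos k by (simp add: theta_def)
  show 2: "theta \<tau> \<le> 2" using pos k by (simp add: theta_def field_simps)
  have "theta \<tau> - 1 = theta \<tau> * (\<bar>lam\<bar> * \<tau>)" using 1 by (simp add: algebra_simps)
  also have "\<dots> \<le> 2 * (\<bar>lam\<bar> * \<tau>)" using 2 k by (intro mult_right_mono) auto
  finally show 3: "theta \<tau> - 1 \<le> 2 * \<bar>lam\<bar> * \<tau>" by simp
  have "theta \<tau> \<le> exp (2 * \<bar>lam\<bar> * \<tau>)" using 3 exp_ge_add_one_self[of "2 * \<bar>lam\<bar> * \<tau>"] by linarith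
  then have "theta \<tau> ^ n \<le> exp (2 * \<bar>lam\<bar> * \<tau>) ^ n"
    using pos by (intro power_mono) (auto simp: theta_def)
  then show "theta \<tau> ^ n \<le> exp (2 * \<bar>lam\<bar> * (real n * \<tau>))"
    by (simp add: exp_of_nat_mult[symmetric] mult_ac)
qed

lemma theta_mult:
  assumes "0 < \<tau>" "\<tau> \<le> tau0" "0 \<le> x"
  shows "x \<le> theta \<tau> * x"
  using mult_right_mono[OF theta(1)[OF assms(1,2)] assms(3)] by simp

lemma theta_cancel:
  assumes "0 < \<tau>" "\<tau> \<le> tau0"
  shows "theta \<tau> * ((1 - \<bar>lam\<bar> * \<tau>) * x) = x"
  using theta(3)[OF assms] by (simp only: mult.assoc[symmetric] mult_1_left)

lemma scheme_in: "scheme \<tau> w \<Longrightarrow> w (Suc n) \<in> A \<times> B"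
  by (auto simp: scheme_def step_def)

text \<open>Two consecutive steps are tested against each other, so \<open>beta\<close> cancels and
  each increment is at most \<open>theta \<tau>\<close> times the preceding one. The slope bound at
  \<open>w 0\<close> takes the place of an increment before the first step.\<close>

lemma scheme_increment:
  assumes "scheme \<tau> w" "0 < \<tau>" "\<tau> \<le> tau0" "slope_le K (w 0)"
  shows "dist (w (Suc n)) (w n) \<le> theta \<tau> ^ Suc n * (\<tau> * K)"
proof (induction n)
  case 0
  have st: "step \<tau> (w 0) (w (Suc 0))" using assms(1) by (simp add: scheme_def)
  let ?d = "dist (w (Suc 0)) (w 0)"
  have w0: "w 0 \<in> A \<times> B" using assms(4) by (simp only: slope_le_def)
  have b: "beta (w 0) (w (Suc 0)) \<le> K * ?d + \<bar>lam\<bar> / 2 * ?d\<^sup>2"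
    using slope_leD[OF assms(4) scheme_in[OF assms(1), of 0]] by (simp only: dist_commute)
  have "(1 - \<bar>lam\<bar> * \<tau>) * ?d\<^sup>2 + ?d\<^sup>2 \<le> 2 * \<tau> * (K * ?d + \<bar>lam\<bar> / 2 * ?d\<^sup>2)"
  proof (rule order_trans)
    show "(1 - \<bar>lam\<bar> * \<tau>) * ?d\<^sup>2 + ?d\<^sup>2 \<le> 2 * \<tau> * beta (w 0) (w (Suc 0))"
      using step_sum[OF st assms(2) w0] by simp
    show "2 * \<tau> * beta (w 0) (w (Suc 0)) \<le> 2 * \<tau> * (K * ?d + \<bar>lam\<bar> / 2 * ?d\<^sup>2)"
      using b assms(2) by (intro mult_left_mono) auto
  qed
  then have "?d * ((1 - \<bar>lam\<bar> * \<tau>) * ?d) \<le> ?d * (\<tau> * K)" by (simp add: power2_eq_square algebra_simps)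
  moreover have "0 \<le> \<tau> * K" using assms(2,4) by (simp add: slope_le_def)
  ultimately have "(1 - \<bar>lam\<bar> * \<tau>) * ?d \<le> \<tau> * K" by (cases "?d = 0") auto
  then have "theta \<tau> * ((1 - \<bar>lam\<bar> * \<tau>) * ?d) \<le> theta \<tau> * (\<tau> * K)"
    using theta(1)[OF assms(2,3)] by (intro mult_left_mono) auto
  then show ?case by (simp only: theta_cancel[OF assms(2,3)] power_one_right power_Suc0_right One_nat_def)
next
  case (Suc n)
  let ?a = "dist (w (Suc n)) (w n)" and ?b = "dist (w (Suc (Suc n))) (w (Suc n))"
  have st: "step \<tau> (w n) (w (Suc n))" "step \<tau> (w (Suc n)) (w (Suc (Suc n)))"
    using assms(1) by (simp_all add: scheme_def)
  \<comment> \<open>Step \<open>n\<close> is tested with the iterate after next, step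
    \<open>Suc n\<close> with its own starting point; the squares of \<open>?a\<close> and
    \<open>?b\<close> then cancel against those of the triangle inequality.\<close>
  have "(dist (w n) (w (Suc (Suc n))))\<^sup>2 \<le> (?a + ?b)\<^sup>2"
    by (intro power_mono) (use dist_triangle[of "w n" "w (Suc (Suc n))" "w (Suc n)"] in \<open>auto simp: dist_commute\<close>)
  then have "2 * ((1 - \<bar>lam\<bar> * \<tau>) * ?b\<^sup>2) \<le> 2 * (?a * ?b)"
    using step_sum[OF st(1) assms(2) scheme_in[OF assms(1), of "Suc n"]]
      step_sum[OF st(2) assms(2) scheme_in[OF assms(1), of "n"]]
      beta_swap[of "w (Suc n)" "w (Suc (Suc n))"]
    by (simp add: dist_commute power2_eq_square algebra_simps)
  then have "?b * ((1 - \<bar>lam\<bar> * \<tau>) * ?b) \<le> ?b * ?a" by (simp add: power2_eq_square algebra_simps)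
  then have "(1 - \<bar>lam\<bar> * \<tau>) * ?b \<le> ?a" by (cases "?b = 0") auto
  then have "theta \<tau> * ((1 - \<bar>lam\<bar> * \<tau>) * ?b) \<le> theta \<tau> * ?a"
    using theta(1)[OF assms(2,3)] by (intro mult_left_mono) auto
  also have "\<dots> \<le> theta \<tau> * (theta \<tau> ^ Suc n * (\<tau> * K))"
    using theta(1)[OF assms(2,3)] Suc.IH by (intro mult_left_mono) auto
  finally show ?case by (simp only: theta_cancel[OF assms(2,3)] power_Suc mult.assoc)
qed

text \<open>The sum of the increments. Time is measured with the effective step
  \<open>theta \<tau> * \<tau>\<close> to match the bracket in
  \<open>crandall_liggett\<close>.\<close>

lemma scheme_drift:
  assumes "scheme \<tau> w" "0 < \<tau>" "\<tau> \<le> tau0" "slope_le K (w 0)"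
  shows "dist (w n) (w 0) \<le> theta \<tau> ^ n * (K * (real n * (theta \<tau> * \<tau>)))"
proof (induction n)
  case (Suc n)
  have t1: "1 \<le> theta \<tau>" by (rule theta(1)[OF assms(2,3)])
  have K: "0 \<le> K" using assms(4) by (simp add: slope_le_def)
  have "dist (w (Suc n)) (w 0) \<le> dist (w (Suc n)) (w n) + dist (w n) (w 0)" by (rule dist_triangle)
  also have "\<dots> \<le> theta \<tau> ^ Suc n * (\<tau> * K) + theta \<tau> ^ n * (K * (real n * (theta \<tau> * \<tau>)))"
    using scheme_increment[OF assms] Suc.IH by (rule add_mono)
  also have "\<dots> = theta \<tau> ^ Suc n * (K * \<tau> + K * (real n * \<tau>))" by (simp add: algebra_simps)
  also have "\<dots> \<le> theta \<tau> ^ Suc n * (theta \<tau> * (K * \<tau> + K * (real n * \<tau>)))"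
    using t1 K assms(2) by (intro mult_left_mono theta_mult[OF assms(2,3)]) auto
  also have "\<dots> = theta \<tau> ^ Suc n * (K * (real (Suc n) * (theta \<tau> * \<tau>)))"
    by (simp add: algebra_simps)
  finally show ?case .
qed simp

text \<open>Supplies the boundary values of the comparison recursions. The factors 2 come from (a +
  b)^2 \<le> 2 a^2 + 2 b^2; strictness is kept because \<open>crossing\<close> starts from a strict
  inequality.\<close>

lemma scheme_drift_sq:
  assumes "scheme \<tau> w" "0 < \<tau>" "\<tau> \<le> tau0" "slope_le K (w 0)" "dist (w 0) z < \<delta>"
  shows "(dist (w n) z)\<^sup>2 < theta \<tau> ^ (2 * n) * (2 * \<delta>\<^sup>2 + 2 * K\<^sup>2 * (real n * (theta \<tau> * \<tau>))\<^sup>2)"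
proof -
  let ?D = "K * (real n * (theta \<tau> * \<tau>))"
  have t1: "1 \<le> theta \<tau> ^ n" using theta(1)[OF assms(2,3)] by (rule one_le_power)
  have \<delta>: "\<delta> > 0" using assms(5) zero_le_dist[of "w 0" z] by linarith
  have "dist (w n) z \<le> dist (w n) (w 0) + dist (w 0) z" by (rule dist_triangle)
  also have "\<dots> < theta \<tau> ^ n * ?D + \<delta>" using scheme_drift[OF assms(1-4), of n] assms(5) by linarith
  also have "\<dots> \<le> theta \<tau> ^ n * (?D + \<delta>)" using t1 \<delta> by (simp add: distrib_left)
  finally have "(dist (w n) z)\<^sup>2 < (theta \<tau> ^ n * (?D + \<delta>))\<^sup>2" by (intro power_strict_mono) auto
  also have "\<dots> = theta \<tau> ^ (2 * n) * (?D + \<delta>)\<^sup>2" by (simp add: power_mult_distrib power_mult[symmetric] mult.commute)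
  also have "\<dots> \<le> theta \<tau> ^ (2 * n) * (2 * \<delta>\<^sup>2 + 2 * ?D\<^sup>2)"
    using zero_le_power2[of "?D - \<delta>"] theta(1)[OF assms(2,3)]
    by (intro mult_left_mono) (auto simp: power2_sum power2_diff)
  finally show ?thesis by (simp add: power_mult_distrib mult.assoc)
qed

text \<open>The Crandall--Liggett estimate. With the effective time steps \<open>theta \<tau> * \<tau>\<close> and
  \<open>theta \<eta> * \<eta>\<close>, the bracket on the right solves the recursion for the squared distances with
  equality.\<close>

lemma crandall_liggett:
  fixes w z :: "nat \<Rightarrow> 'a \<times> 'b"
  assumes w: "scheme \<tau> w" "0 < \<tau>" "\<tau> \<le> tau0" "slope_le K (w 0)"
    and z: "scheme \<eta> z" "0 < \<eta>" "\<eta> \<le> tau0" "slope_le K (z 0)"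
    and \<delta>: "dist (w 0) (z 0) < \<delta>"
  shows "(dist (w n) (z m))\<^sup>2 \<le> theta \<tau> ^ (2 * n) * theta \<eta> ^ (2 * m) *
    (2 * \<delta>\<^sup>2 + 2 * K\<^sup>2 * ((real n * (theta \<tau> * \<tau>) - real m * (theta \<eta> * \<eta>))\<^sup>2
        + real n * (theta \<tau> * \<tau>)\<^sup>2 + real m * (theta \<eta> * \<eta>)\<^sup>2))"
    (is "_ \<le> ?W n m * ?R n m")
proof (induction "n + m" arbitrary: n m rule: less_induct)
  case less
  let ?c = "1 - \<bar>lam\<bar> * \<tau>" and ?e = "1 - \<bar>lam\<bar> * \<eta>"
  have th: "1 \<le> theta \<tau>" "1 \<le> theta \<eta>" "theta \<tau> * ?c = 1" "theta \<eta> * ?e = 1" "0 < ?c" "0 < ?e"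
    using theta[OF w(2,3)] theta[OF z(2,3)] by auto
  consider "m = 0" | "n = 0" "m > 0" | "n > 0" "m > 0" by blast
  then show ?case
  proof cases
    case 1
    have "(dist (w n) (z 0))\<^sup>2 \<le> theta \<tau> ^ (2 * n) * (2 * \<delta>\<^sup>2 + 2 * K\<^sup>2 * (real n * (theta \<tau> * \<tau>))\<^sup>2)"
      using scheme_drift_sq[OF w \<delta>] by (rule less_imp_le)
    also have "\<dots> \<le> theta \<tau> ^ (2 * n) * (2 * \<delta>\<^sup>2 + 2 * K\<^sup>2 * ((real n * (theta \<tau> * \<tau>))\<^sup>2 + real n * (theta \<tau> * \<tau>)\<^sup>2))"
      using th by (intro mult_left_mono add_left_mono) auto
    finally show ?thesis using 1 by simp
  next
    case 2
    have "(dist (z m) (w 0))\<^sup>2 \<le> theta \<eta> ^ (2 * m) * (2 * \<delta>\<^sup>2 + 2 * K\<^sup>2 * (real m * (theta \<eta> * \<eta>))\<^sup>2)"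
      using scheme_drift_sq[OF z] \<delta> by (intro less_imp_le) (simp add: dist_commute)
    also have "\<dots> \<le> theta \<eta> ^ (2 * m) * (2 * \<delta>\<^sup>2 + 2 * K\<^sup>2 * ((real m * (theta \<eta> * \<eta>))\<^sup>2 + real m * (theta \<eta> * \<eta>)\<^sup>2))"
      using th by (intro mult_left_mono add_left_mono) auto
    finally show ?thesis using 2 by (simp add: dist_commute)
  next
    case 3
    then obtain i j where ij: "n = Suc i" "m = Suc j" by (meson gr0_implies_Suc)
    let ?a = "\<lambda>n m. (dist (w n) (z m))\<^sup>2"
    let ?t = "theta \<tau> * \<tau>" and ?s = "theta \<eta> * \<eta>"
    have IH: "?a i m \<le> ?W i m * ?R i m" "?a n j \<le> ?W n j * ?R n j"
      by (rule less; simp add: ij)+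
    have R0: "0 \<le> ?W i' j' * ?R i' j'" for i' j' using th by (intro mult_nonneg_nonneg) auto
    have zw: "z m \<in> A \<times> B" "w n \<in> A \<times> B" using scheme_in[OF z(1), of j] scheme_in[OF w(1), of i] ij by auto
    have st: "step \<tau> (w i) (w n)" "step \<eta> (z j) (z m)" using w(1) z(1) ij by (simp_all add: scheme_def)
    have "?c * ?a n m - ?a i m \<le> 2 * \<tau> * beta (z m) (w n)"
      using step_sum[OF st(1) w(2) zw(1)] zero_le_power2[of "dist (w n) (w i)"] by linarith
    \<comment> \<open>The weights \<open>\<eta>\<close> and \<open>\<tau>\<close> give the two
      \<open>beta\<close> terms the common factor 2 \<tau> \<eta>, with opposite signs.\<close>
    then have 1: "\<eta> * (?c * ?a n m - ?a i m) \<le> \<eta> * (2 * \<tau> * beta (z m) (w n))"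
      using z(2) by (intro mult_left_mono) auto
    have "?e * ?a n m - ?a n j \<le> 2 * \<eta> * beta (w n) (z m)"
      using step_sum[OF st(2) z(2) zw(2)] zero_le_power2[of "dist (z m) (z j)"]
      unfolding dist_commute[of "z m" "w n"] dist_commute[of "z j" "w n"] by linarith
    then have 2: "\<tau> * (?e * ?a n m - ?a n j) \<le> \<tau> * (2 * \<eta> * beta (w n) (z m))"
      using w(2) by (intro mult_left_mono) auto
    have "(\<eta> * ?c + \<tau> * ?e) * ?a n m \<le> \<eta> * ?a i m + \<tau> * ?a n j"
      by (rule weights_add[OF 1 2[unfolded beta_swap[of "w n" "z m"]]])
    also have "\<dots> \<le> \<eta> * (?W i m * ?R i m) + \<tau> * (?W n j * ?R n j)"
      using IH w(2) z(2) by (intro add_mono mult_left_mono) auto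
    \<comment> \<open>\<open>?W\<close> has two factors \<open>theta\<close> per step. With the one
      inserted here, the identity \<open>theta \<tau> * ?c = 1\<close> writes the term as
      \<open>?c\<close> times the full weight \<open>?W n m\<close>, with the coefficient found on
      the left; the weights then become proportional to the effective steps \<open>?s\<close> and
      \<open>?t\<close>.\<close>
    also have "\<dots> \<le> \<eta> * (theta \<tau> * (?W i m * ?R i m)) + \<tau> * (theta \<eta> * (?W n j * ?R n j))"
      using w(2) z(2) by (intro add_mono mult_left_mono theta_mult[OF w(2,3) R0] theta_mult[OF z(2,3) R0]) auto
    also have "theta \<tau> * (?W i m * ?R i m) = ?c * (?W n m * ?R i m)"
    proof -
      have "?c * ?W n m = (theta \<tau> * ?c) * theta \<tau> * ?W i m" by (simp add: ij)
      from this[symmetric] have "theta \<tau> * ?W i m = ?c * ?W n m" unfolding th(3) mult_1_left mult.assoc .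
      then show ?thesis by (simp only: mult.assoc[symmetric])
    qed
    also have "theta \<eta> * (?W n j * ?R n j) = ?e * (?W n m * ?R n j)"
    proof -
      have "?e * ?W n m = (theta \<eta> * ?e) * theta \<eta> * ?W n j" by (simp add: ij)
      from this[symmetric] have "theta \<eta> * ?W n j = ?e * ?W n m" unfolding th(4) mult_1_left mult.assoc .
      then show ?thesis by (simp only: mult.assoc[symmetric])
    qed
    also have "\<eta> * (?c * (?W n m * ?R i m)) + \<tau> * (?e * (?W n m * ?R n j))
        = ?W n m * (?c * ?e) * (?s * ?R i m + ?t * ?R n j)"
    proof -
      have "\<eta> * ?c = ?c * ?e * ?s"
      proof -
        have "?c * ?e * ?s = (theta \<eta> * ?e) * (\<eta> * ?c)" by (simp only: mult_ac)
        then show ?thesis by (simp only: th(4) mult_1_left)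
      qed
      moreover have "\<tau> * ?e = ?c * ?e * ?t"
      proof -
        have "?c * ?e * ?t = (theta \<tau> * ?c) * (\<tau> * ?e)" by (simp only: mult_ac)
        then show ?thesis by (simp only: th(3) mult_1_left)
      qed
      ultimately show ?thesis by (rule weights_combine)
    qed
    also have "?s * ?R i m + ?t * ?R n j = (?s + ?t) * ?R n m"
      unfolding ij of_nat_Suc by (rule crandall_liggett_identity)
    also have "?W n m * (?c * ?e) * ((?s + ?t) * ?R n m) = (\<eta> * ?c + \<tau> * ?e) * (?W n m * ?R n m)"
    proof -
      have "?c * ?e * (?s + ?t) = (theta \<eta> * ?e) * (\<eta> * ?c) + (theta \<tau> * ?c) * (\<tau> * ?e)"
        by (simp only: distrib_left mult_ac)
      then have "\<eta> * ?c + \<tau> * ?e = ?c * ?e * (?s + ?t)" unfolding th(3,4) by simp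
      then show ?thesis by (simp only: mult_ac)
    qed
    finally have "(\<eta> * ?c + \<tau> * ?e) * ?a n m \<le> (\<eta> * ?c + \<tau> * ?e) * (?W n m * ?R n m)" .
    moreover have "0 < \<eta> * ?c + \<tau> * ?e" using th w(2) z(2) by (intro add_pos_pos mult_pos_pos) auto
    ultimately show ?thesis by (simp only: mult_le_cancel_left_pos)
  qed
qed

end

section \<open>Interpolation in time and convergence of the scheme\<close>

lemma floor_index:
  fixes t \<tau> :: real
  assumes "0 < \<tau>" "0 \<le> t"
  shows "real (nat \<lfloor>t / \<tau>\<rfloor>) * \<tau> \<le> t" "t < real (nat \<lfloor>t / \<tau>\<rfloor>) * \<tau> + \<tau>"
proof -
  have "0 \<le> \<lfloor>t / \<tau>\<rfloor>" using assms by simp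
  then have e: "real (nat \<lfloor>t / \<tau>\<rfloor>) = of_int \<lfloor>t / \<tau>\<rfloor>" by simp
  show "real (nat \<lfloor>t / \<tau>\<rfloor>) * \<tau> \<le> t" "t < real (nat \<lfloor>t / \<tau>\<rfloor>) * \<tau> + \<tau>"
    unfolding e using floor_divide_lower[OF assms(1), of t] floor_divide_upper[OF assms(1), of t]
    by (simp_all add: distrib_right)
qed

context saddle_system
begin

lemma scheme_exists:
  assumes "0 < \<tau>" "\<tau> \<le> tau0"
  shows "\<exists>w. scheme \<tau> w \<and> w 0 = z"
proof -
  obtain f where "\<And>w. step \<tau> w (f w)" using step_exists[OF assms] by metis
  then have "scheme \<tau> (rec_nat z (\<lambda>_. f)) \<and> rec_nat z (\<lambda>_. f) 0 = z" by (simp add: scheme_def)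
  then show ?thesis by blast
qed

definition iterates :: "real \<Rightarrow> 'a \<times> 'b \<Rightarrow> nat \<Rightarrow> 'a \<times> 'b" where
  "iterates \<tau> z = (SOME w. scheme \<tau> w \<and> w 0 = z)"

lemma iterates:
  assumes "0 < \<tau>" "\<tau> \<le> tau0"
  shows "scheme \<tau> (iterates \<tau> z)" "iterates \<tau> z 0 = z"
  using someI_ex[OF scheme_exists[OF assms, of z]] by (simp_all add: iterates_def)

definition interp :: "real \<Rightarrow> 'a \<times> 'b \<Rightarrow> real \<Rightarrow> 'a \<times> 'b" where
  "interp \<tau> z t = iterates \<tau> z (nat \<lfloor>t / \<tau>\<rfloor>)"

text \<open>Rounding costs one step, and the effective step exceeds \<open>\<tau>\<close> by a
  factor that costs at most 2 |\<open>lam\<close>| \<tau> per unit of time. The 4 in the second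
  bound is \<open>theta \<tau> \<le> 2\<close> squared.\<close>

lemma index_bounds:
  assumes \<tau>: "0 < \<tau>" "\<tau> \<le> tau0" and t: "0 \<le> t" "t \<le> T" and n: "n = nat \<lfloor>t / \<tau>\<rfloor>"
  shows "\<bar>real n * (theta \<tau> * \<tau>) - t\<bar> \<le> (1 + 2 * \<bar>lam\<bar> * T) * \<tau>"
    "real n * (theta \<tau> * \<tau>)\<^sup>2 \<le> 4 * T * \<tau>"
    "theta \<tau> ^ (2 * n) \<le> exp (4 * \<bar>lam\<bar> * T)"
proof -
  note th = theta[OF \<tau>]
  have n1: "real n * \<tau> \<le> t" "t < real n * \<tau> + \<tau>" using floor_index[OF \<tau>(1) t(1)] by (simp_all only: n)
  have nT: "real n * \<tau> \<le> T" "0 \<le> real n * \<tau>" using n1 t \<tau> by auto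
  have "(real n * \<tau>) * (theta \<tau> - 1) \<le> T * (2 * \<bar>lam\<bar> * \<tau>)"
    using nT th(1,6) \<tau>(1) t by (intro mult_mono) auto
  moreover have "0 \<le> (real n * \<tau>) * (theta \<tau> - 1)" by (rule mult_nonneg_nonneg) (use nT th(1) in linarith)+
  moreover have "real n * (theta \<tau> * \<tau>) = real n * \<tau> + (real n * \<tau>) * (theta \<tau> - 1)" by (simp add: algebra_simps)
  moreover have "(1 + 2 * \<bar>lam\<bar> * T) * \<tau> = \<tau> + T * (2 * \<bar>lam\<bar> * \<tau>)" by (simp add: algebra_simps)
  ultimately show "\<bar>real n * (theta \<tau> * \<tau>) - t\<bar> \<le> (1 + 2 * \<bar>lam\<bar> * T) * \<tau>" using n1 by linarith
  have "real n * (theta \<tau> * \<tau>)\<^sup>2 = (real n * \<tau>) * (theta \<tau> * theta \<tau>) * \<tau>" by (simp add: power2_eq_square)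
  also have "\<dots> \<le> T * (2 * 2) * \<tau>"
    using nT th(1,2) \<tau>(1) t by (intro mult_right_mono mult_mono) auto
  finally show "real n * (theta \<tau> * \<tau>)\<^sup>2 \<le> 4 * T * \<tau>" by simp
  have "theta \<tau> ^ (2 * n) \<le> exp (2 * \<bar>lam\<bar> * (real (2 * n) * \<tau>))" by (rule th(5))
  also have "\<dots> \<le> exp (4 * \<bar>lam\<bar> * T)" using mult_left_mono[OF nT(1), of "4 * \<bar>lam\<bar>"] by simp
  finally show "theta \<tau> ^ (2 * n) \<le> exp (4 * \<bar>lam\<bar> * T)" .
qed

lemma exp_8: "exp (8 * \<bar>lam\<bar> * T) = (exp (4 * \<bar>lam\<bar> * T))\<^sup>2"
  unfolding power2_eq_square exp_add[symmetric] by simp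

text \<open>The arguments are the time horizon, the slope bound, the distance of the initial points,
  the time lag and the sum of the step sizes. The exponent 8 collects one factor exp(4
  |\<open>lam\<close>| T) from each of two schemes.\<close>

definition err :: "real \<Rightarrow> real \<Rightarrow> real \<Rightarrow> real \<Rightarrow> real \<Rightarrow> real" where
  "err T K \<delta> a r = exp (8 * \<bar>lam\<bar> * T)
     * (2 * \<delta>\<^sup>2 + 2 * K\<^sup>2 * ((a + (1 + 2 * \<bar>lam\<bar> * T) * r)\<^sup>2 + 4 * T * r))"

lemma err_tendsto [tendsto_intros]:
  assumes "(f \<longlongrightarrow> \<delta>) G" "(g \<longlongrightarrow> r) G"
  shows "((\<lambda>k. err T K (f k) a (g k)) \<longlongrightarrow> err T K \<delta> a r) G"
  unfolding err_def by (intro tendsto_intros assms)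

lemma interp_estimate:
  assumes "slope_le K z" "slope_le K z'" "0 < \<tau>" "\<tau> \<le> tau0" "0 < \<eta>" "\<eta> \<le> tau0"
    and "0 \<le> s" "s \<le> T" "0 \<le> t" "t \<le> T"
  shows "(dist (interp \<tau> z s) (interp \<eta> z' t))\<^sup>2 \<le> err T K (dist z z') \<bar>s - t\<bar> (\<tau> + \<eta>)"
proof -
  have main: "(dist (interp \<tau> z s) (interp \<eta> z' t))\<^sup>2 \<le> err T K \<delta> \<bar>s - t\<bar> (\<tau> + \<eta>)" if \<delta>: "dist z z' < \<delta>" for \<delta>
  proof -
    define n where "n = nat \<lfloor>s / \<tau>\<rfloor>"
    define m where "m = nat \<lfloor>t / \<eta>\<rfloor>"
    note nb = index_bounds[OF assms(3,4,7,8) n_def]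
    note mb = index_bounds[OF assms(5,6,9,10) m_def]
    note it = iterates[OF assms(3,4), of z] iterates[OF assms(5,6), of z']
    let ?D = "real n * (theta \<tau> * \<tau>) - real m * (theta \<eta> * \<eta>)"
    have "\<bar>?D\<bar> \<le> \<bar>s - t\<bar> + (1 + 2 * \<bar>lam\<bar> * T) * \<tau> + (1 + 2 * \<bar>lam\<bar> * T) * \<eta>"
      using nb(1) mb(1) by linarith
    then have "\<bar>?D\<bar> \<le> \<bar>s - t\<bar> + (1 + 2 * \<bar>lam\<bar> * T) * (\<tau> + \<eta>)" by (simp only: distrib_left)
    then have "\<bar>?D\<bar>\<^sup>2 \<le> (\<bar>s - t\<bar> + (1 + 2 * \<bar>lam\<bar> * T) * (\<tau> + \<eta>))\<^sup>2" by (intro power_mono) auto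
    moreover have "4 * T * (\<tau> + \<eta>) = 4 * T * \<tau> + 4 * T * \<eta>" by (rule distrib_left)
    ultimately have D: "?D\<^sup>2 + real n * (theta \<tau> * \<tau>)\<^sup>2 + real m * (theta \<eta> * \<eta>)\<^sup>2
        \<le> (\<bar>s - t\<bar> + (1 + 2 * \<bar>lam\<bar> * T) * (\<tau> + \<eta>))\<^sup>2 + 4 * T * (\<tau> + \<eta>)"
      using nb(2) mb(2) unfolding power2_abs by linarith
    have "theta \<tau> ^ (2 * n) * theta \<eta> ^ (2 * m) \<le> exp (4 * \<bar>lam\<bar> * T) * exp (4 * \<bar>lam\<bar> * T)"
      using nb(3) mb(3) theta(1)[OF assms(3,4)] theta(1)[OF assms(5,6)] by (intro mult_mono) auto
    also have "\<dots> = exp (8 * \<bar>lam\<bar> * T)" unfolding exp_add[symmetric] by simp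
    finally have E: "theta \<tau> ^ (2 * n) * theta \<eta> ^ (2 * m) \<le> exp (8 * \<bar>lam\<bar> * T)" .
    have "(dist (iterates \<tau> z n) (iterates \<eta> z' m))\<^sup>2 \<le> theta \<tau> ^ (2 * n) * theta \<eta> ^ (2 * m) *
      (2 * \<delta>\<^sup>2 + 2 * K\<^sup>2 * (?D\<^sup>2 + real n * (theta \<tau> * \<tau>)\<^sup>2 + real m * (theta \<eta> * \<eta>)\<^sup>2))"
      using crandall_liggett[OF it(1) assms(3,4) _ it(3) assms(5,6)] assms(1,2) \<delta> unfolding it(2,4) by blast
    also have "\<dots> \<le> exp (8 * \<bar>lam\<bar> * T) *
      (2 * \<delta>\<^sup>2 + 2 * K\<^sup>2 * (?D\<^sup>2 + real n * (theta \<tau> * \<tau>)\<^sup>2 + real m * (theta \<eta> * \<eta>)\<^sup>2))"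
      by (rule mult_right_mono[OF E]) simp
    also have "\<dots> \<le> err T K \<delta> \<bar>s - t\<bar> (\<tau> + \<eta>)"
      unfolding err_def by (intro mult_left_mono add_left_mono D) auto
    finally show ?thesis by (simp add: interp_def n_def m_def)
  qed
  \<comment> \<open>\<open>crandall_liggett\<close> wants a strict bound on the initial distance;
    continuity of \<open>err\<close> in that argument permits the limit from the right.\<close>
  show ?thesis
  proof (rule tendsto_lowerbound)
    show "((\<lambda>\<delta>. err T K \<delta> \<bar>s - t\<bar> (\<tau> + \<eta>)) \<longlongrightarrow> err T K (dist z z') \<bar>s - t\<bar> (\<tau> + \<eta>)) (at_right (dist z z'))"
      by (intro tendsto_intros)
    show "\<forall>\<^sub>F \<delta> in at_right (dist z z'). (dist (interp \<tau> z s) (interp \<eta> z' t))\<^sup>2 \<le> err T K \<delta> \<bar>s - t\<bar> (\<tau> + \<eta>)"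
      unfolding eventually_at_right_field using main by (intro exI[of _ "dist z z' + 1"]) simp
  qed simp
qed

definition tauk :: "nat \<Rightarrow> real" where "tauk k = tau0 / real (Suc k)"

lemma tauk: "0 < tauk k" "tauk k \<le> tau0" "tauk \<longlonglongrightarrow> 0"
proof -
  show "0 < tauk k" "tauk k \<le> tau0" using tau0_pos by (auto simp: tauk_def field_simps)
  show "tauk \<longlonglongrightarrow> 0"
    using tendsto_mult_right_zero[OF LIMSEQ_Suc[OF lim_1_over_n], of tau0] by (simp add: tauk_def[abs_def])
qed

definition flow :: "'a \<times> 'b \<Rightarrow> real \<Rightarrow> 'a \<times> 'b" where
  "flow z t = lim (\<lambda>k. interp (tauk k) z t)"

lemma interp_tendsto_flow:
  assumes "slope_le K z" "0 \<le> t"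
  shows "(\<lambda>k. interp (tauk k) z t) \<longlonglongrightarrow> flow z t"
proof -
  have "Cauchy (\<lambda>k. interp (tauk k) z t)"
  proof (rule metric_CauchyI)
    fix e :: real assume "e > 0"
    have "((\<lambda>r. err t K 0 0 r) \<longlongrightarrow> err t K 0 0 0) (at_right 0)" by (intro tendsto_intros)
    then have "\<forall>\<^sub>F r in at_right 0. err t K 0 0 r < e\<^sup>2"
      by (rule order_tendstoD) (use \<open>e > 0\<close> in \<open>simp add: err_def\<close>)
    then obtain r0 where r0: "r0 > 0" "\<And>r. 0 < r \<Longrightarrow> r < r0 \<Longrightarrow> err t K 0 0 r < e\<^sup>2"
      by (auto simp: eventually_at_right_field)
    have "\<forall>\<^sub>F k in sequentially. tauk k < r0 / 2" by (rule order_tendstoD(2)[OF tauk(3)]) (use r0 in simp)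
    then obtain N where N: "\<And>k. k \<ge> N \<Longrightarrow> tauk k < r0 / 2" by (auto simp: eventually_sequentially)
    have "dist (interp (tauk i) z t) (interp (tauk j) z t) < e" if "i \<ge> N" "j \<ge> N" for i j
    proof -
      have "(dist (interp (tauk i) z t) (interp (tauk j) z t))\<^sup>2 \<le> err t K 0 0 (tauk i + tauk j)"
        using interp_estimate[OF assms(1,1) tauk(1,2) tauk(1,2) assms(2) order_refl assms(2) order_refl] by simp
      also have "\<dots> < e\<^sup>2" using N[OF that(1)] N[OF that(2)] tauk(1)[of i] tauk(1)[of j] by (intro r0) auto
      finally show ?thesis by (rule power2_less_imp_less) (use \<open>e > 0\<close> in simp)
    qed
    then show "\<exists>M. \<forall>m\<ge>M. \<forall>n\<ge>M. dist (interp (tauk m) z t) (interp (tauk n) z t) < e" by blast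
  qed
  then show ?thesis unfolding flow_def by (simp add: Cauchy_convergent_iff convergent_LIMSEQ_iff)
qed

text \<open>Only the second step size runs through \<open>tauk\<close>. As \<open>\<tau>\<close>
  stays arbitrary, all step sizes lead to the same limit.\<close>

lemma interp_flow_estimate:
  assumes "slope_le K z" "slope_le K z'" "0 < \<tau>" "\<tau> \<le> tau0" "0 \<le> s" "s \<le> T" "0 \<le> t" "t \<le> T"
  shows "(dist (interp \<tau> z s) (flow z' t))\<^sup>2 \<le> err T K (dist z z') \<bar>s - t\<bar> \<tau>"
proof (rule tendsto_le[OF sequentially_bot])
  show "(\<lambda>k. (dist (interp \<tau> z s) (interp (tauk k) z' t))\<^sup>2) \<longlonglongrightarrow> (dist (interp \<tau> z s) (flow z' t))\<^sup>2"
    by (intro tendsto_intros interp_tendsto_flow[OF assms(2,7)])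
  have "(\<lambda>k. err T K (dist z z') \<bar>s - t\<bar> (\<tau> + tauk k)) \<longlonglongrightarrow> err T K (dist z z') \<bar>s - t\<bar> (\<tau> + 0)"
    by (intro tendsto_intros tauk(3))
  then show "(\<lambda>k. err T K (dist z z') \<bar>s - t\<bar> (\<tau> + tauk k)) \<longlonglongrightarrow> err T K (dist z z') \<bar>s - t\<bar> \<tau>" by simp
qed (intro always_eventually allI interp_estimate assms tauk)

lemma flow_estimate:
  assumes "slope_le K z" "slope_le K z'" "0 \<le> s" "s \<le> T" "0 \<le> t" "t \<le> T"
  shows "(dist (flow z s) (flow z' t))\<^sup>2 \<le> err T K (dist z z') \<bar>s - t\<bar> 0"
proof (rule tendsto_le[OF sequentially_bot])
  show "(\<lambda>k. (dist (interp (tauk k) z s) (flow z' t))\<^sup>2) \<longlonglongrightarrow> (dist (flow z s) (flow z' t))\<^sup>2"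
    by (intro tendsto_intros interp_tendsto_flow[OF assms(1,3)])
  show "(\<lambda>k. err T K (dist z z') \<bar>s - t\<bar> (tauk k)) \<longlonglongrightarrow> err T K (dist z z') \<bar>s - t\<bar> 0"
    by (intro tendsto_intros tauk(3))
qed (intro always_eventually allI interp_flow_estimate assms tauk)

lemma flow_lipschitz_time:
  assumes "slope_le K z" "0 \<le> s" "s \<le> T" "0 \<le> t" "t \<le> T"
  shows "dist (flow z s) (flow z t) \<le> sqrt 2 * exp (4 * \<bar>lam\<bar> * T) * K * \<bar>s - t\<bar>"
proof (rule power2_le_imp_le)
  have "err T K 0 \<bar>s - t\<bar> 0 = (sqrt 2 * exp (4 * \<bar>lam\<bar> * T) * K * \<bar>s - t\<bar>)\<^sup>2"
    by (simp add: err_def power_mult_distrib exp_8)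
  then show "(dist (flow z s) (flow z t))\<^sup>2 \<le> (sqrt 2 * exp (4 * \<bar>lam\<bar> * T) * K * \<bar>s - t\<bar>)\<^sup>2"
    using flow_estimate[OF assms(1,1) assms(2-)] by simp
  show "0 \<le> sqrt 2 * exp (4 * \<bar>lam\<bar> * T) * K * \<bar>s - t\<bar>" using assms(1) by (simp add: slope_le_def)
qed

text \<open>At equal times and step size 0 the term of \<open>err\<close> with the slope bound
  vanishes. The resulting constant depends on the horizon alone, which lets the flow extend to the
  closure.\<close>

lemma flow_lipschitz_initial:
  assumes "slope_le K z" "slope_le K' z'" "0 \<le> t" "t \<le> T"
  shows "dist (flow z t) (flow z' t) \<le> sqrt 2 * exp (4 * \<bar>lam\<bar> * T) * dist z z'"
proof (rule power2_le_imp_le)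
  have s: "slope_le (max K K') z" "slope_le (max K K') z'" using assms slope_le_mono by auto
  have "err T (max K K') (dist z z') 0 0 = (sqrt 2 * exp (4 * \<bar>lam\<bar> * T) * dist z z')\<^sup>2"
    by (simp add: err_def power_mult_distrib exp_8)
  then show "(dist (flow z t) (flow z' t))\<^sup>2 \<le> (sqrt 2 * exp (4 * \<bar>lam\<bar> * T) * dist z z')\<^sup>2"
    using flow_estimate[OF s assms(3,4) assms(3,4)] by simp
qed simp

lemma flow_0:
  assumes "slope_le K z"
  shows "flow z 0 = z"
proof -
  have "interp (tauk k) z 0 = z" for k using iterates(2)[OF tauk(1,2)] by (simp add: interp_def)
  then have "(\<lambda>k. z) \<longlonglongrightarrow> flow z 0" using interp_tendsto_flow[OF assms order_refl] by simp
  then show ?thesis using LIMSEQ_unique tendsto_const by blast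
qed

section \<open>General initial values\<close>

text \<open>One implicit step from a nearby domain point has finite slope by
  \<open>step_slope\<close>. It is short because \<open>growth\<close> in both variables bounds
  \<open>beta z0 z\<close> by a constant plus a multiple of the squared increment, which a small
  \<tau> absorbs.\<close>

lemma finite_slope_dense:
  assumes "w \<in> closure (A \<times> B)" "e > 0"
  shows "\<exists>z K. slope_le K z \<and> dist z w < e"
proof -
  interpret sw: saddle_system lam B A "\<lambda>y x. - F x y" "\<lambda>y x. - P x y" "\<lambda>y. - q y" "\<lambda>x. - p x"
    by (rule swap)
  obtain z0 where z0: "z0 \<in> A \<times> B" "dist z0 w < e / 2"
    using assms closure_approachable[of w "A \<times> B"] half_gt_zero by blast
  obtain x0 y0 where xy: "z0 = (x0, y0)" "x0 \<in> A" "y0 \<in> B" using z0(1) by blast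
  obtain C1 where C1: "\<And>x. x \<in> A \<Longrightarrow> - C1 - (\<bar>lam\<bar> + 2) * (dist x x0)\<^sup>2 \<le> F x y0"
    using growth[OF xy(3,2)] by blast
  obtain C2 where C2: "\<And>y. y \<in> B \<Longrightarrow> - C2 - (\<bar>lam\<bar> + 2) * (dist y y0)\<^sup>2 \<le> - F x0 y"
    using sw.growth[OF xy(2,3)] by blast
  \<comment> \<open>The summand 1 makes \<open>C\<close> positive; the choice of
    \<open>\<tau>\<close> makes \<open>2 * \<tau> * C\<close> at most e^2 / 8, below (e /
    2)^2.\<close>
  define C where "C = \<bar>C1 + C2\<bar> + 1"
  define \<tau> where "\<tau> = min tau0 (e\<^sup>2 / (16 * C))"
  have C: "C > 0" "C1 + C2 \<le> C" by (auto simp: C_def)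
  have \<tau>: "0 < \<tau>" "\<tau> \<le> tau0" "\<tau> \<le> e\<^sup>2 / (16 * C)" using tau0_pos C assms(2) by (auto simp: \<tau>_def)
  have \<tau>C: "\<tau> * C \<le> e\<^sup>2 / 16" using \<tau>(3) C by (simp add: field_simps)
  obtain z where z: "step \<tau> z0 z" using step_exists[OF \<tau>(1,2)] by blast
  have zAB: "fst z \<in> A" "snd z \<in> B" using z by (auto simp: step_def)
  let ?D = "(dist z z0)\<^sup>2"
  have "beta z0 z \<le> C1 + C2 + (\<bar>lam\<bar> + 2) * ?D"
    using C1[OF zAB(1)] C2[OF zAB(2)] by (simp add: beta_def xy sq_dist_Pair algebra_simps)
  then have "beta z0 z \<le> C + (\<bar>lam\<bar> + 2) * ?D" using C(2) by linarith
  then have "2 * \<tau> * beta z0 z \<le> 2 * \<tau> * (C + (\<bar>lam\<bar> + 2) * ?D)"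
    using \<tau>(1) by (intro mult_left_mono) auto
  moreover have "(1 - \<bar>lam\<bar> * \<tau>) * ?D + ?D \<le> 2 * \<tau> * beta z0 z"
    using step_sum[OF z \<tau>(1) z0(1)] by simp
  moreover have "\<bar>lam\<bar> * \<tau> * ?D \<le> 1 / 4 * ?D"
    using tau0D(1)[OF \<tau>(1,2)] by (intro mult_right_mono) (auto simp: mult.commute)
  moreover have "2 * \<tau> * ((\<bar>lam\<bar> + 2) * ?D) \<le> 1 / 2 * ?D"
  proof -
    have "2 * \<tau> * (\<bar>lam\<bar> + 2) \<le> 1 / 2" using \<tau>(2) by (simp add: tau0_def field_simps)
    then have "2 * \<tau> * (\<bar>lam\<bar> + 2) * ?D \<le> 1 / 2 * ?D" by (intro mult_right_mono) auto
    then show ?thesis by (simp only: mult.assoc)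
  qed
  moreover have "2 * \<tau> * (C + (\<bar>lam\<bar> + 2) * ?D) = 2 * (\<tau> * C) + 2 * \<tau> * ((\<bar>lam\<bar> + 2) * ?D)"
    "(1 - \<bar>lam\<bar> * \<tau>) * ?D = ?D - \<bar>lam\<bar> * \<tau> * ?D" by (simp_all add: algebra_simps)
  ultimately have "?D \<le> 2 * (e\<^sup>2 / 16)" using \<tau>C zero_le_power2[of "dist z z0"] by linarith
  also have "\<dots> < (e / 2)\<^sup>2" using assms(2) by (simp add: power2_eq_square)
  finally have "dist z z0 < e / 2" by (rule power2_less_imp_less) (use assms(2) in simp)
  then have "dist z w < e" using z0(2) dist_triangle[of z w z0] by linarith
  then show ?thesis using step_slope[OF z \<tau>(1)] by blast
qed


text \<open>A diagonal choice: the slopes \<open>K k\<close> of the approximating points may blow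
  up, so the step size is chosen after \<open>K k\<close>, small enough for the scheme to stay
  within 1 / (k + 1) of the flow on [0, k]. The growing horizon gives uniform convergence on bounded
  intervals.\<close>

lemma discrete_approximation:
  assumes w0: "w0 \<in> closure (A \<times> B)"
  shows "\<exists>w \<tau> W. w 0 = w0 \<and> continuous_on {0..} w \<and> \<tau> \<longlonglongrightarrow> 0 \<and>
      (\<forall>k. 0 < \<tau> k \<and> \<tau> k \<le> tau0 \<and> scheme (\<tau> k) (W k)) \<and>
      (\<forall>T e. 0 < e \<longrightarrow> (\<forall>\<^sub>F k in sequentially. \<forall>t\<in>{0..T}. dist (W k (nat \<lfloor>t / \<tau> k\<rfloor>)) (w t) < e))"
proof -
  have "\<forall>k. \<exists>z K. slope_le K z \<and> dist z w0 < 1 / real (Suc k)"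
    using finite_slope_dense[OF w0] by simp
  then obtain z K where zK: "\<And>k. slope_le (K k) (z k)" and zd: "\<And>k. dist (z k) w0 < 1 / real (Suc k)"
    by metis
  have inv0: "(\<lambda>k. 1 / real (Suc k)) \<longlonglongrightarrow> 0" by (rule LIMSEQ_Suc[OF lim_1_over_n])
  have zlim: "z \<longlonglongrightarrow> w0"
  proof (subst tendsto_dist_iff, rule tendsto_sandwich[OF _ _ tendsto_const inv0])
    show "\<forall>\<^sub>F k in sequentially. dist (z k) w0 \<le> 1 / real (Suc k)" using zd by (intro always_eventually allI less_imp_le)
  qed simp
  define c where "c T = sqrt 2 * exp (4 * \<bar>lam\<bar> * T)" for T
  have c: "c T > 0" for T by (simp add: c_def)
  have fl: "dist (flow (z i) t) (flow (z j) t) \<le> c T * dist (z i) (z j)" if "0 \<le> t" "t \<le> T" for i j t T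
    unfolding c_def by (rule flow_lipschitz_initial[OF zK zK that])
  define w where "w t = lim (\<lambda>k. flow (z k) t)" for t
  have wlim: "(\<lambda>k. flow (z k) t) \<longlonglongrightarrow> w t" if t: "0 \<le> t" for t
  proof -
    have "Cauchy (\<lambda>k. flow (z k) t)"
    proof (rule metric_CauchyI)
      fix e :: real assume "e > 0"
      then have "e / c t > 0" using c by simp
      then obtain N where N: "\<And>i j. i \<ge> N \<Longrightarrow> j \<ge> N \<Longrightarrow> dist (z i) (z j) < e / c t"
        using LIMSEQ_imp_Cauchy[OF zlim] metric_CauchyD by blast
      have "dist (flow (z i) t) (flow (z j) t) < e" if "i \<ge> N" "j \<ge> N" for i j
      proof -
        have "c t * dist (z i) (z j) < e" using N[OF that] c[of t] by (simp add: pos_less_divide_eq mult.commute)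
        then show ?thesis using fl[OF t order_refl, of i j] by linarith
      qed
      then show "\<exists>M. \<forall>m\<ge>M. \<forall>n\<ge>M. dist (flow (z m) t) (flow (z n) t) < e" by blast
    qed
    then show ?thesis unfolding w_def by (simp add: Cauchy_convergent_iff convergent_LIMSEQ_iff)
  qed
  have est: "dist (flow (z k) t) (w t) \<le> c T * (1 / real (Suc k))" if t: "0 \<le> t" "t \<le> T" for k t T
  proof (rule order_trans)
    show "dist (flow (z k) t) (w t) \<le> c T * dist (z k) w0"
    proof (rule tendsto_le[OF sequentially_bot])
      show "(\<lambda>j. dist (flow (z k) t) (flow (z j) t)) \<longlonglongrightarrow> dist (flow (z k) t) (w t)"
        by (intro tendsto_intros wlim t)
      show "(\<lambda>j. c T * dist (z k) (z j)) \<longlonglongrightarrow> c T * dist (z k) w0" by (intro tendsto_intros zlim)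
    qed (intro always_eventually allI fl t)
    show "c T * dist (z k) w0 \<le> c T * (1 / real (Suc k))"
      using zd[of k] c[of T] by (intro mult_left_mono) auto
  qed
  have "w 0 = w0"
  proof -
    have "(\<lambda>k. flow (z k) 0) = z" using flow_0[OF zK] by blast
    then have "z \<longlonglongrightarrow> w 0" using wlim[OF order_refl] by simp
    then show ?thesis using zlim LIMSEQ_unique by blast
  qed
  \<comment> \<open>The Lipschitz constants in time depend on \<open>K k\<close>; continuity passes
    to the limit by uniform convergence.\<close>
  have contT: "continuous_on {0..T} w" for T
  proof (rule uniform_limit_theorem)
    show "\<forall>\<^sub>F k in sequentially. continuous_on {0..T} (flow (z k))"
    proof (intro always_eventually allI)
      fix k
      have "(sqrt 2 * exp (4 * \<bar>lam\<bar> * T) * K k)-lipschitz_on {0..T} (flow (z k))"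
      proof (rule lipschitz_onI)
        show "0 \<le> sqrt 2 * exp (4 * \<bar>lam\<bar> * T) * K k" using zK[of k] by (simp add: slope_le_def)
        show "dist (flow (z k) s) (flow (z k) t) \<le> sqrt 2 * exp (4 * \<bar>lam\<bar> * T) * K k * dist s t"
          if "s \<in> {0..T}" "t \<in> {0..T}" for s t
          using flow_lipschitz_time[OF zK, of s T t k] that by (simp add: dist_real_def)
      qed
      then show "continuous_on {0..T} (flow (z k))" by (rule lipschitz_on_continuous_on)
    qed
    show "uniform_limit {0..T} (\<lambda>k. flow (z k)) w sequentially"
    proof (rule uniform_limitI)
      fix e :: real assume "e > 0"
      have "(\<lambda>k. c T * (1 / real (Suc k))) \<longlonglongrightarrow> c T * 0" by (intro tendsto_intros inv0)
      then have "\<forall>\<^sub>F k in sequentially. c T * (1 / real (Suc k)) < e"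
        by (rule order_tendstoD(2)) (use \<open>e > 0\<close> in simp)
      then show "\<forall>\<^sub>F k in sequentially. \<forall>t\<in>{0..T}. dist (flow (z k) t) (w t) < e"
        by eventually_elim (meson est atLeastAtMost_iff le_less_trans)
    qed
  qed simp
  have cont: "continuous_on {0..} w"
    unfolding continuous_on_eq_continuous_within
  proof
    fix t :: real assume t: "t \<in> {0..}"
    have "at t within {0..} = at t within {0..t + 1}"
      by (rule at_within_nhd[of _ "{..<t + 1}"]) auto
    then show "continuous (at t within {0..}) w"
      using contT[of "t + 1"] t by (simp add: continuous_on_eq_continuous_within)
  qed
  have "\<exists>\<tau>. 0 < \<tau> \<and> \<tau> \<le> tau0 \<and> \<tau> \<le> 1 / real (Suc k) \<and> err (real k) (K k) 0 0 \<tau> < (1 / real (Suc k))\<^sup>2" for k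
  proof -
    have "((\<lambda>r. err (real k) (K k) 0 0 r) \<longlongrightarrow> err (real k) (K k) 0 0 0) (at_right 0)" by (intro tendsto_intros)
    then have "\<forall>\<^sub>F r in at_right 0. err (real k) (K k) 0 0 r < (1 / real (Suc k))\<^sup>2"
      by (rule order_tendstoD) (simp add: err_def)
    then obtain r0 where r0: "r0 > 0" "\<And>r. 0 < r \<Longrightarrow> r < r0 \<Longrightarrow> err (real k) (K k) 0 0 r < (1 / real (Suc k))\<^sup>2"
      by (auto simp: eventually_at_right_field)
    define \<tau> where "\<tau> = min (min tau0 (1 / real (Suc k))) (r0 / 2)"
    have "0 < \<tau>" "\<tau> \<le> tau0" "\<tau> \<le> 1 / real (Suc k)" "\<tau> < r0" using tau0_pos r0(1) by (auto simp: \<tau>_def)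
    then show ?thesis using r0(2) by blast
  qed
  then obtain \<tau> where \<tau>: "\<And>k. 0 < \<tau> k" "\<And>k. \<tau> k \<le> tau0" "\<And>k. \<tau> k \<le> 1 / real (Suc k)"
    "\<And>k. err (real k) (K k) 0 0 (\<tau> k) < (1 / real (Suc k))\<^sup>2" by metis
  have \<tau>lim: "\<tau> \<longlonglongrightarrow> 0"
    by (rule tendsto_sandwich[OF _ _ tendsto_const inv0]) (use \<tau> in \<open>auto intro!: always_eventually less_imp_le\<close>)
  define W where "W k = iterates (\<tau> k) (z k)" for k
  have near: "dist (W k (nat \<lfloor>t / \<tau> k\<rfloor>)) (flow (z k) t) \<le> 1 / real (Suc k)" if "0 \<le> t" "t \<le> real k" for k t
  proof (rule power2_le_imp_le)
    have "(dist (interp (\<tau> k) (z k) t) (flow (z k) t))\<^sup>2 \<le> err (real k) (K k) 0 0 (\<tau> k)"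
      using interp_flow_estimate[OF zK zK \<tau>(1,2) that that] by simp
    then show "(dist (W k (nat \<lfloor>t / \<tau> k\<rfloor>)) (flow (z k) t))\<^sup>2 \<le> (1 / real (Suc k))\<^sup>2"
      using \<tau>(4)[of k] unfolding W_def interp_def by linarith
  qed simp
  have "\<forall>\<^sub>F k in sequentially. \<forall>t\<in>{0..T}. dist (W k (nat \<lfloor>t / \<tau> k\<rfloor>)) (w t) < e" if "e > 0" for T e
  proof -
    have "(\<lambda>k. (1 + c T) * (1 / real (Suc k))) \<longlonglongrightarrow> (1 + c T) * 0" by (intro tendsto_intros inv0)
    then have "\<forall>\<^sub>F k in sequentially. (1 + c T) * (1 / real (Suc k)) < e"
      by (rule order_tendstoD(2)) (use \<open>e > 0\<close> in simp)
    moreover have "\<forall>\<^sub>F k in sequentially. T \<le> real k"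
      using filterlim_real_sequentially unfolding filterlim_at_top by blast
    ultimately show ?thesis
    proof eventually_elim
      case (elim k)
      show ?case
      proof
        fix t assume t: "t \<in> {0..T}"
        have "dist (W k (nat \<lfloor>t / \<tau> k\<rfloor>)) (w t)
            \<le> dist (W k (nat \<lfloor>t / \<tau> k\<rfloor>)) (flow (z k) t) + dist (flow (z k) t) (w t)" by (rule dist_triangle)
        also have "\<dots> \<le> 1 / real (Suc k) + c T * (1 / real (Suc k))"
          using t elim by (intro add_mono near est) auto
        also have "\<dots> < e" using elim(1) by (simp only: distrib_right mult_1_left)
        finally show "dist (W k (nat \<lfloor>t / \<tau> k\<rfloor>)) (w t) < e" .
      qed
    qed
  qed
  moreover have "scheme (\<tau> k) (W k)" for k using iterates(1)[OF \<tau>(1,2)] by (simp add: W_def)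
  ultimately show ?thesis using \<open>w 0 = w0\<close> cont \<tau>lim \<tau>(1,2) by blast
qed

end

section \<open>Limits of discrete solutions\<close>

lemma nat_increment_bound:
  fixes f :: "nat \<Rightarrow> real"
  assumes "\<And>n. i \<le> n \<Longrightarrow> n < j \<Longrightarrow> f (Suc n) \<le> f n + c" "i \<le> j"
  shows "f j \<le> f i + c * (real j - real i)"
  using assms(2,1)
proof (induction j rule: dec_induct)
  case (step n)
  have "f (Suc n) \<le> f n + c" using step by simp
  also have "f n \<le> f i + c * (real n - real i)" using step by simp
  finally show ?case by (simp add: algebra_simps)
qed simp

lemma floor_index_self:
  fixes \<tau> :: real
  assumes "0 < \<tau>"
  shows "nat \<lfloor>real n * \<tau> / \<tau>\<rfloor> = n"
  using assms by simp

lemma floor_index_tendsto: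
  fixes \<tau> :: "nat \<Rightarrow> real"
  assumes "\<tau> \<longlonglongrightarrow> 0" "\<And>k. 0 < \<tau> k" "0 \<le> t"
  shows "(\<lambda>k. real (nat \<lfloor>t / \<tau> k\<rfloor>) * \<tau> k) \<longlonglongrightarrow> t"
proof (rule tendsto_sandwich)
  show "\<forall>\<^sub>F k in sequentially. t - \<tau> k \<le> real (nat \<lfloor>t / \<tau> k\<rfloor>) * \<tau> k"
  proof (intro always_eventually allI)
    show "t - \<tau> k \<le> real (nat \<lfloor>t / \<tau> k\<rfloor>) * \<tau> k" for k
      using floor_index(2)[OF assms(2,3), of k] by linarith
  qed
  show "\<forall>\<^sub>F k in sequentially. real (nat \<lfloor>t / \<tau> k\<rfloor>) * \<tau> k \<le> t"
    using floor_index(1)[OF assms(2,3)] by (intro always_eventually allI)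
  show "(\<lambda>k. t - \<tau> k) \<longlonglongrightarrow> t" using tendsto_diff[OF tendsto_const assms(1), of t] by simp
qed simp

context saddle_system
begin

text \<open>Only the inequality for the first variable is recorded: the lemmas below are applied
  twice, the second time in the exchanged system with \<open>X\<close> and \<open>Y\<close>
  swapped.\<close>

definition approxX :: "(nat \<Rightarrow> real) \<Rightarrow> (nat \<Rightarrow> nat \<Rightarrow> 'a) \<Rightarrow> (nat \<Rightarrow> nat \<Rightarrow> 'b) \<Rightarrow>
    (real \<Rightarrow> 'a) \<Rightarrow> (real \<Rightarrow> 'b) \<Rightarrow> bool" where
  "approxX \<tau> X Y u v \<longleftrightarrow> (\<forall>k. 0 < \<tau> k \<and> \<tau> k \<le> tau0) \<and> \<tau> \<longlonglongrightarrow> 0 \<and>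
     continuous_on {0..} u \<and> continuous_on {0..} v \<and>
     (\<forall>k n. X k (Suc n) \<in> A \<and> Y k (Suc n) \<in> B \<and> stepX (\<tau> k) (X k n) (X k (Suc n)) (Y k (Suc n))) \<and>
     (\<forall>T e. 0 < e \<longrightarrow> (\<forall>\<^sub>F k in sequentially. \<forall>t\<in>{0..T}.
        dist (X k (nat \<lfloor>t / \<tau> k\<rfloor>)) (u t) < e \<and> dist (Y k (nat \<lfloor>t / \<tau> k\<rfloor>)) (v t) < e))"

lemma approxX_D:
  assumes "approxX \<tau> X Y u v"
  shows "0 < \<tau> k" "\<tau> k \<le> tau0" "\<tau> \<longlonglongrightarrow> 0" "continuous_on {0..} u" "continuous_on {0..} v"
    "X k (Suc n) \<in> A" "Y k (Suc n) \<in> B" "stepX (\<tau> k) (X k n) (X k (Suc n)) (Y k (Suc n))"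
    "0 < e \<Longrightarrow> \<forall>\<^sub>F k in sequentially. \<forall>t\<in>{0..T}.
        dist (X k (nat \<lfloor>t / \<tau> k\<rfloor>)) (u t) < e \<and> dist (Y k (nat \<lfloor>t / \<tau> k\<rfloor>)) (v t) < e"
  using assms unfolding approxX_def by blast+

lemma approxX_tendsto:
  assumes "approxX \<tau> X Y u v" "0 \<le> t"
  shows "(\<lambda>k. X k (nat \<lfloor>t / \<tau> k\<rfloor>)) \<longlonglongrightarrow> u t"
proof (rule tendstoI)
  fix e :: real assume "0 < e"
  from approxX_D(9)[OF assms(1) this, of t]
  show "\<forall>\<^sub>F k in sequentially. dist (X k (nat \<lfloor>t / \<tau> k\<rfloor>)) (u t) < e"
    by eventually_elim (use assms(2) in simp)
qed

text \<open>Uniform convergence is evaluated at the grid times \<open>real n * \<tau> k\<close>,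
  whose interpolation index is \<open>n\<close> itself.\<close>

lemma approxX_local:
  assumes ap: "approxX \<tau> X Y u v" and "0 < r"
    and close: "\<And>a. a \<in> {s..t} \<Longrightarrow> dist (u a) x < r / 2 \<and> dist (v a) y < r / 2" and "0 \<le> s"
  shows "\<forall>\<^sub>F k in sequentially. \<forall>n. s \<le> real n * \<tau> k \<and> real n * \<tau> k \<le> t \<longrightarrow>
      dist (X k n) x < r \<and> dist (Y k n) y < r"
proof -
  have "r / 2 > 0" using \<open>0 < r\<close> by simp
  from approxX_D(9)[OF ap this, of t] show ?thesis
  proof eventually_elim
    case (elim k)
    show ?case
    proof (intro allI impI)
      fix n assume n: "s \<le> real n * \<tau> k \<and> real n * \<tau> k \<le> t"
      then have "real n * \<tau> k \<in> {0..t}" "real n * \<tau> k \<in> {s..t}" using \<open>0 \<le> s\<close> by auto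
      then have "dist (X k n) (u (real n * \<tau> k)) < r / 2 \<and> dist (Y k n) (v (real n * \<tau> k)) < r / 2"
        "dist (u (real n * \<tau> k)) x < r / 2 \<and> dist (v (real n * \<tau> k)) y < r / 2"
        using elim close floor_index_self[OF approxX_D(1)[OF ap]] by metis+
      then show "dist (X k n) x < r \<and> dist (Y k n) y < r"
        using dist_triangle[of "X k n" x "u (real n * \<tau> k)"] dist_triangle[of "Y k n" y "v (real n * \<tau> k)"]
        by linarith
    qed
  qed
qed

lemma continuous_near:
  fixes u :: "real \<Rightarrow> 'c::metric_space" and v :: "real \<Rightarrow> 'd::metric_space"
  assumes "continuous_on {0..} u" "continuous_on {0..} v" "0 \<le> t" "0 < r"
  shows "\<exists>d>0. \<forall>a\<ge>0. \<bar>a - t\<bar> < d \<longrightarrow> dist (u a) (u t) < r \<and> dist (v a) (v t) < r"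
proof -
  obtain d1 where d1: "d1 > 0" "\<And>a. 0 \<le> a \<Longrightarrow> dist a t < d1 \<Longrightarrow> dist (u a) (u t) < r"
    using assms(1,3,4) unfolding continuous_on_iff by (metis atLeast_iff)
  obtain d2 where d2: "d2 > 0" "\<And>a. 0 \<le> a \<Longrightarrow> dist a t < d2 \<Longrightarrow> dist (v a) (v t) < r"
    using assms(2,3,4) unfolding continuous_on_iff by (metis atLeast_iff)
  show ?thesis
    by (rule exI[of _ "min d1 d2"]) (use d1 d2 in \<open>auto simp: dist_real_def\<close>)
qed

text \<open>Instantaneous regularization. Since the squared distance to a fixed point stays bounded,
  \<open>p (X k n)\<close> cannot be large throughout a time window; the local Lipschitz bound on \<open>P\<close>
  prevents it from growing by more than \<open>L\<^sup>2 \<tau>\<close> per step afterwards.\<close>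

lemma limit_in_A:
  assumes ap: "approxX \<tau> X Y u v" and t: "0 < t"
  shows "u t \<in> A"
proof -
  obtain x' y' where x': "x' \<in> A" and y': "y' \<in> B" using A_nonempty B_nonempty by blast
  \<comment> \<open>\<open>P\<close> is controlled near three points: \<open>(u t, v t)\<close> for
    the iterates, \<open>(x', v t)\<close> for testing with \<open>x'\<close>, and
    \<open>(u t, y')\<close> to turn a bound on \<open>p\<close> into one on
    \<open>\<lambda>x. F x y'\<close>.\<close>
  obtain r1 L where r1: "r1 > 0" "L \<ge> 0" and L: "\<forall>x1\<in>ball (u t) r1. \<forall>x2\<in>ball (u t) r1.
      \<forall>y1\<in>ball (v t) r1. \<forall>y2\<in>ball (v t) r1. \<bar>P x1 y1 - P x2 y2\<bar> \<le> L * (dist x1 x2 + dist y1 y2)"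
    using lipschitzP[of "u t" "v t"] by meson
  obtain r2 L2 where r2: "r2 > 0" "L2 \<ge> 0" and L2: "\<forall>x1\<in>ball x' r2. \<forall>x2\<in>ball x' r2.
      \<forall>y1\<in>ball (v t) r2. \<forall>y2\<in>ball (v t) r2. \<bar>P x1 y1 - P x2 y2\<bar> \<le> L2 * (dist x1 x2 + dist y1 y2)"
    using lipschitzP[of x' "v t"] by meson
  obtain r3 L3 where r3: "r3 > 0" "L3 \<ge> 0" and L3: "\<forall>x1\<in>ball (u t) r3. \<forall>x2\<in>ball (u t) r3.
      \<forall>y1\<in>ball y' r3. \<forall>y2\<in>ball y' r3. \<bar>P x1 y1 - P x2 y2\<bar> \<le> L3 * (dist x1 x2 + dist y1 y2)"
    using lipschitzP[of "u t" y'] by meson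
  define r where "r = min r1 (min r2 r3)"
  have r: "r > 0" "r \<le> r1" "r \<le> r2" "r \<le> r3" using r1 r2 r3 by (auto simp: r_def)
  have Llip: "\<bar>P x1 y1 - P x2 y2\<bar> \<le> L * (dist x1 x2 + dist y1 y2)"
    if "dist x1 (u t) < r" "dist x2 (u t) < r" "dist y1 (v t) < r" "dist y2 (v t) < r" for x1 x2 y1 y2
    using L[rule_format, of x1 x2 y1 y2] that r by (simp add: dist_commute)
  define M1 where "M1 = \<bar>P x' (v t)\<bar> + L2 * r"
  have M1: "P x' y \<le> M1" if y: "dist y (v t) < r" for y
  proof -
    have "\<bar>P x' y - P x' (v t)\<bar> \<le> L2 * (dist x' x' + dist y (v t))"
      using y r r2 by (intro L2[rule_format]) (auto simp: dist_commute)
    also have "\<dots> \<le> L2 * r" using y r2(2) by (intro mult_left_mono) auto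
    finally show ?thesis by (simp add: M1_def)
  qed
  define M2 where "M2 = \<bar>P (u t) (v t)\<bar> + L * (2 * r)"
  have M2: "- P x y \<le> M2" if xy: "dist x (u t) < r" "dist y (v t) < r" for x y
  proof -
    have "\<bar>P x y - P (u t) (v t)\<bar> \<le> L * (dist x (u t) + dist y (v t))"
      using xy r(1) by (intro Llip) auto
    also have "\<dots> \<le> L * (2 * r)" using xy r1(2) by (intro mult_left_mono) auto
    finally show ?thesis by (simp add: M2_def)
  qed
  define M3 where "M3 = \<bar>P (u t) y'\<bar> + L3 * r"
  have M3: "P x y' \<le> M3" if x: "dist x (u t) < r" for x
  proof -
    have "\<bar>P x y' - P (u t) y'\<bar> \<le> L3 * (dist x (u t) + dist y' y')"
      using x r r3 by (intro L3[rule_format]) (auto simp: dist_commute)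
    also have "\<dots> \<le> L3 * r" using x r3(2) by (intro mult_left_mono) auto
    finally show ?thesis by (simp add: M3_def)
  qed
  define R where "R = r + dist (u t) x'"
  have R: "(dist x x')\<^sup>2 \<le> R\<^sup>2" if x: "dist x (u t) < r" for x
    using x dist_triangle[of x x' "u t"] by (intro power_mono) (auto simp: R_def)
  obtain d where d: "d > 0" "\<And>a. 0 \<le> a \<Longrightarrow> \<bar>a - t\<bar> < d \<Longrightarrow> dist (u a) (u t) < r / 2 \<and> dist (v a) (v t) < r / 2"
    using continuous_near[OF approxX_D(4,5)[OF ap], of t "r / 2"] t r(1) by auto
  \<comment> \<open>Start of a window before \<open>t\<close>, away from 0, in which both curves
    stay near their values at \<open>t\<close>.\<close>
  define s where "s = max (t / 2) (t - d / 2)"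
  have s: "0 < s" "s < t" using t d by (auto simp: s_def)
  have near: "\<forall>\<^sub>F k in sequentially. \<forall>n. s \<le> real n * \<tau> k \<and> real n * \<tau> k \<le> t \<longrightarrow>
      dist (X k n) (u t) < r \<and> dist (Y k n) (v t) < r"
  proof (rule approxX_local[OF ap r(1)])
    fix a assume "a \<in> {s..t}"
    then have "0 \<le> a" "\<bar>a - t\<bar> < d" using s d by (auto simp: s_def max_def split: if_splits)
    then show "dist (u a) (u t) < r / 2 \<and> dist (v a) (v t) < r / 2" by (rule d)
  qed (use s in simp)
  \<comment> \<open>Leaves at least half of the window between the first grid time after
    \<open>s\<close> and the last one up to \<open>t\<close>.\<close>
  have tausmall: "\<forall>\<^sub>F k in sequentially. \<tau> k < (t - s) / 4"
    by (rule order_tendstoD(2)[OF approxX_D(3)[OF ap]]) (use s in simp)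
  \<comment> \<open>\<open>C\<close> bounds the part of the inequality tested with \<open>x'\<close>
    that is free of \<open>p\<close> at the iterate. \<open>M\<close> is so much larger that
    \<open>p > M\<close> throughout the window would push the squared distance to \<open>x'\<close>,
    at most \<open>R\<^sup>2\<close> at its start, below 0.\<close>
  define C where "C = M1 + M2 + p x' + \<bar>lam\<bar> * R\<^sup>2"
  define M where "M = C + (R\<^sup>2 + 1) / (t - s)"
  define E where "E = M + L\<^sup>2 * t + M3 + q y'"
  have "\<forall>\<^sub>F k in sequentially. X k (nat \<lfloor>t / \<tau> k\<rfloor>) \<in> {x \<in> A. F x y' \<le> E}"
    using near tausmall
  proof eventually_elim
    case (elim k)
    define T where "T = \<tau> k"
    have T: "0 < T" "T \<le> tau0" "T < (t - s) / 4" using approxX_D(1,2)[OF ap] elim(2) by (auto simp: T_def)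
    \<comment> \<open>The first grid index strictly after \<open>s\<close>; it is positive, and
      \<open>approxX\<close> records membership in the domain for positive indices.\<close>
    define i where "i = Suc (nat \<lfloor>s / T\<rfloor>)"
    define j where "j = nat \<lfloor>t / T\<rfloor>"
    have i: "s < real i * T" "real i * T \<le> s + T"
    proof -
      have "real i * T = real (nat \<lfloor>s / T\<rfloor>) * T + T" by (simp only: i_def of_nat_Suc distrib_right mult_1_left)
      then show "s < real i * T" "real i * T \<le> s + T"
        using floor_index[OF T(1), of s] s by linarith+
    qed
    have j: "real j * T \<le> t" "t < real j * T + T"
      unfolding j_def using floor_index[OF T(1), of t] t by linarith+
    have gap: "(real j - real i) * T \<ge> (t - s) / 2" using i j T by (simp add: left_diff_distrib)
    then have ij: "i < j"
      using s T(1) by (smt (verit) zero_less_mult_pos2 divide_pos_pos of_nat_less_iff)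
    have win: "s \<le> real n * \<tau> k \<and> real n * \<tau> k \<le> t" if "i \<le> n" "n \<le> j" for n
    proof -
      have "real i * T \<le> real n * T" "real n * T \<le> real j * T" using that T(1) by (auto intro: mult_right_mono)
      then show ?thesis using i j unfolding T_def[symmetric] by (intro conjI) linarith+
    qed
    have nr: "dist (X k n) (u t) < r" "dist (Y k n) (v t) < r" if "i \<le> n" "n \<le> j" for n
      using elim(1) win[OF that] by blast+
    have inA: "X k n \<in> A" "Y k n \<in> B" if "i \<le> n" for n
      using that approxX_D(6,7)[OF ap, of k "n - 1"] by (auto simp: i_def)
    have decr: "(dist (X k (Suc n)) x')\<^sup>2 \<le> (dist (X k n) x')\<^sup>2 + 2 * T * (C - p (X k (Suc n)))"
      if n: "i \<le> n" "n < j" for n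
    proof -
      let ?x = "X k (Suc n)" and ?y = "Y k (Suc n)"
      have near': "dist ?x (u t) < r" "dist ?y (v t) < r" using nr[of "Suc n"] n by auto
      have AB: "?x \<in> A" "?y \<in> B" using inA[of "Suc n"] n by auto
      have "(1 + lam * T) * (dist ?x x')\<^sup>2 - (dist (X k n) x')\<^sup>2 + (dist ?x (X k n))\<^sup>2
          \<le> 2 * T * (F x' ?y - F ?x ?y)"
        using approxX_D(8)[OF ap, of k n] x' by (simp add: stepX_def T_def)
      moreover have "F x' ?y - F ?x ?y \<le> M1 + M2 + p x' - p ?x"
        using M1[OF near'(2)] M2[OF near'] split[OF x' AB(2)] split[OF AB] by linarith
      then have "2 * T * (F x' ?y - F ?x ?y) \<le> 2 * T * (M1 + M2 + p x' - p ?x)"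
        using T(1) by (intro mult_left_mono) auto
      moreover have "- (lam * T) * (dist ?x x')\<^sup>2 \<le> (\<bar>lam\<bar> * T) * R\<^sup>2"
        using R[OF near'(1)] T(1) by (intro mult_mono) (auto simp: mult_right_mono[of "- lam" "\<bar>lam\<bar>" T, simplified])
      moreover have "0 \<le> \<bar>lam\<bar> * T * R\<^sup>2" using T(1) by simp
      moreover have "(1 + lam * T) * (dist ?x x')\<^sup>2 = (dist ?x x')\<^sup>2 - (- (lam * T) * (dist ?x x')\<^sup>2)"
        "2 * T * (C - p ?x) = 2 * T * (M1 + M2 + p x' - p ?x) + 2 * (\<bar>lam\<bar> * T * R\<^sup>2)"
        by (simp_all add: C_def algebra_simps)
      ultimately show ?thesis using zero_le_power2[of "dist ?x (X k n)"] by linarith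
    qed
    have "\<exists>n. i \<le> n \<and> n < j \<and> p (X k (Suc n)) \<le> M"
    proof (rule ccontr)
      assume "\<not> ?thesis"
      then have big: "M < p (X k (Suc n))" if "i \<le> n" "n < j" for n using that by force
      have "(dist (X k j) x')\<^sup>2 \<le> (dist (X k i) x')\<^sup>2 + (2 * T * (C - M)) * (real j - real i)"
      proof (rule nat_increment_bound)
        fix n assume n: "i \<le> n" "n < j"
        have "2 * T * (C - p (X k (Suc n))) \<le> 2 * T * (C - M)"
          using big[OF n] T(1) by (intro mult_left_mono) auto
        then show "(dist (X k (Suc n)) x')\<^sup>2 \<le> (dist (X k n) x')\<^sup>2 + 2 * T * (C - M)"
          using decr[OF n] by linarith
      qed (use ij in simp)
      moreover have "(2 * T * (C - M)) * (real j - real i) = - (2 * ((real j - real i) * T) * ((R\<^sup>2 + 1) / (t - s)))"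
      proof -
        have e: "C - M = - ((R\<^sup>2 + 1) / (t - s))" by (simp add: M_def)
        show ?thesis unfolding e by (simp only: mult_minus_left mult_minus_right mult_ac)
      qed
      moreover have "2 * ((t - s) / 2) * ((R\<^sup>2 + 1) / (t - s)) \<le> 2 * ((real j - real i) * T) * ((R\<^sup>2 + 1) / (t - s))"
        using gap s by (intro mult_right_mono mult_left_mono) auto
      moreover have "2 * ((t - s) / 2) * ((R\<^sup>2 + 1) / (t - s)) = R\<^sup>2 + 1" using s by simp
      moreover have "(dist (X k i) x')\<^sup>2 \<le> R\<^sup>2" using nr[of i] ij by (intro R) auto
      ultimately show False using zero_le_power2[of "dist (X k j) x'"] by linarith
    qed
    then obtain m where m: "i \<le> m" "m < j" "p (X k (Suc m)) \<le> M" by blast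
    \<comment> \<open>Testing with the preceding iterate compares values of \<open>F\<close> at the
      same \<open>?y\<close>, so \<open>q\<close> cancels and \<open>p\<close> can grow only through
      \<open>P\<close>.\<close>
    have "p (X k j) \<le> p (X k (Suc m)) + (L\<^sup>2 * T) * (real j - real (Suc m))"
    proof (rule nat_increment_bound)
      fix n assume n: "Suc m \<le> n" "n < j"
      let ?x = "X k (Suc n)" and ?y = "Y k (Suc n)" and ?z = "X k n"
      let ?\<delta> = "dist ?x ?z"
      have near': "dist ?x (u t) < r" "dist ?y (v t) < r" "dist ?z (u t) < r" using nr[of "Suc n"] nr[of n] n m by auto
      have AB: "?x \<in> A" "?y \<in> B" "?z \<in> A" using inA[of "Suc n"] inA[of n] n m by auto
      have "(1 + lam * T) * ?\<delta>\<^sup>2 - (dist ?z ?z)\<^sup>2 + ?\<delta>\<^sup>2 \<le> 2 * T * (F ?z ?y - F ?x ?y)"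
        using approxX_D(8)[OF ap, of k n] AB by (simp only: stepX_def T_def)
      moreover have "0 \<le> (1 + lam * T) * ?\<delta>\<^sup>2"
      proof -
        have "\<bar>lam * T\<bar> \<le> 1" using tau0D(1)[OF T(1,2)] T(1) by (simp add: abs_mult mult.commute)
        then have "0 \<le> 1 + lam * T" by linarith
        then show ?thesis by simp
      qed
      moreover have "P ?z ?y - P ?x ?y \<le> L * ?\<delta>"
        using Llip[OF near'(3,1,2,2)] by (simp add: dist_commute)
      then have "F ?z ?y - F ?x ?y \<le> L * ?\<delta> + p ?z - p ?x"
        using split[OF AB(1,2)] split[OF AB(3,2)] by linarith
      then have "2 * T * (F ?z ?y - F ?x ?y) \<le> 2 * T * (L * ?\<delta> + p ?z - p ?x)"
        using T(1) by (intro mult_left_mono) auto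
      \<comment> \<open>The squared increment on the left absorbs the Lipschitz term, so that
        \<open>p\<close> gains only a multiple of \<open>T\<close> per step.\<close>
      moreover have "2 * (L * T) * ?\<delta> \<le> (L * T)\<^sup>2 + ?\<delta>\<^sup>2" by (rule sum_squares_bound)
      ultimately have "2 * T * (p ?x - p ?z) \<le> (L * T)\<^sup>2"
        by (simp add: algebra_simps)
      also have "\<dots> = 2 * T * (L\<^sup>2 * T / 2)" by (simp add: power2_eq_square)
      finally have "p ?x - p ?z \<le> L\<^sup>2 * T / 2" using T(1) by (simp only: mult_le_cancel_left_pos)
      moreover have "0 \<le> L\<^sup>2 * T" using T(1) by simp
      ultimately show "p ?x \<le> p ?z + L\<^sup>2 * T" by linarith
    qed (use m in simp)
    also have "\<dots> \<le> M + L\<^sup>2 * t"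
    proof -
      have "L\<^sup>2 * ((real j - real (Suc m)) * T) \<le> L\<^sup>2 * t"
      proof (rule mult_left_mono)
        have "0 \<le> real (Suc m) * T" using T(1) by simp
        then show "(real j - real (Suc m)) * T \<le> t" using j(1) unfolding left_diff_distrib by linarith
      qed simp
      moreover have "L\<^sup>2 * ((real j - real (Suc m)) * T) = L\<^sup>2 * T * (real j - real (Suc m))"
        by (simp only: mult_ac)
      ultimately show ?thesis using m(3) by linarith
    qed
    finally have "p (X k j) \<le> M + L\<^sup>2 * t" .
    moreover have "P (X k j) y' \<le> M3" using nr[of j] ij by (intro M3) auto
    moreover have "X k j \<in> A" using inA[of j] ij by simp
    ultimately show "X k (nat \<lfloor>t / \<tau> k\<rfloor>) \<in> {x \<in> A. F x y' \<le> E}"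
      using split[OF _ y', of "X k j"] by (simp add: E_def j_def T_def)
  qed
  \<comment> \<open>\<open>E\<close> is the same for all \<open>k\<close>, so closedness of the
    sublevel set brings the limit into \<open>A\<close>.\<close>
  then have "u t \<in> {x \<in> A. F x y' \<le> E}"
    by (rule Lim_in_closed_set[OF closedX[OF y'] _ _ approxX_tendsto[OF ap]]) (use t in auto)
  then show ?thesis by simp
qed

section \<open>Passage to the limit in the EVI\<close>

lemma P_near:
  assumes "0 < e"
  shows "\<exists>d>0. \<forall>a b. dist a x < d \<longrightarrow> dist b y < d \<longrightarrow> \<bar>P a b - P x y\<bar> < e"
proof -
  obtain r L where r: "r > 0" "L \<ge> 0" and L: "\<forall>x1\<in>ball x r. \<forall>x2\<in>ball x r.
      \<forall>y1\<in>ball y r. \<forall>y2\<in>ball y r. \<bar>P x1 y1 - P x2 y2\<bar> \<le> L * (dist x1 x2 + dist y1 y2)"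
    using lipschitzP[of x y] by meson
  define d where "d = min r (e / (2 * (L + 1)))"
  have d: "0 < d" "d \<le> r" using r assms by (auto simp: d_def)
  have Ld: "(L + 1) * (2 * d) \<le> e"
  proof -
    have "d \<le> e / (2 * (L + 1))" by (simp add: d_def)
    then show ?thesis using r(2) by (simp add: field_simps)
  qed
  have "\<bar>P a b - P x y\<bar> < e" if ab: "dist a x < d" "dist b y < d" for a b
  proof -
    have "\<bar>P a b - P x y\<bar> \<le> L * (dist a x + dist b y)"
      using ab d r(1) by (intro L[rule_format]) (auto simp: dist_commute)
    also have "\<dots> \<le> L * (2 * d)" using ab r(2) by (intro mult_left_mono) auto
    also have "\<dots> < (L + 1) * (2 * d)" using d(1) by (simp add: distrib_right)
    finally show ?thesis using Ld by linarith
  qed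
  then show ?thesis using d(1) by blast
qed

text \<open>Lower semicontinuity of \<open>p\<close> on \<open>A\<close>, inherited from
  \<open>closedX\<close> at one fixed \<open>y\<close> and the continuity of
  \<open>P\<close>.\<close>

lemma p_near:
  assumes "x \<in> A" "0 < e"
  shows "\<exists>d>0. \<forall>a\<in>A. dist a x < d \<longrightarrow> p x - e < p a"
proof -
  obtain y where y: "y \<in> B" using B_nonempty by blast
  have "open (- {a \<in> A. F a y \<le> F x y - e / 2})" using closedX[OF y] by blast
  moreover have "x \<in> - {a \<in> A. F a y \<le> F x y - e / 2}" using assms(2) by simp
  ultimately obtain r where r: "r > 0" "ball x r \<subseteq> - {a \<in> A. F a y \<le> F x y - e / 2}"
    by (rule openE)
  obtain d where d: "d > 0" "\<And>a b. dist a x < d \<Longrightarrow> dist b y < d \<Longrightarrow> \<bar>P a b - P x y\<bar> < e / 2"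
    using P_near[of "e / 2" x y] assms(2) by auto
  have "p x - e < p a" if a: "a \<in> A" "dist a x < min r d" for a
  proof -
    have "a \<in> ball x r" using a(2) by (simp add: dist_commute)
    then have "F x y - e / 2 < F a y" using r(2) a(1) by auto
    moreover have "\<bar>P a y - P x y\<bar> < e / 2" using d(2)[of a y] a(2) d(1) by simp
    ultimately show ?thesis using split[OF a(1) y] split[OF assms(1) y] by linarith
  qed
  then show ?thesis using r(1) d(1) by (intro exI[of _ "min r d"]) auto
qed

text \<open>In \<open>F x b - F a b\<close> the term \<open>q b\<close> cancels, so the second
  variable enters only through the continuous \<open>P\<close>. What remains is -\<open>p a\<close>,
  controlled by \<open>p_near\<close>, and continuous terms. Three errors e/8 under the factor 2 and
  one outside add up to less than e.\<close>

lemma EVI_rhs_usc: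
  assumes "x \<in> A" "a0 \<in> A" "b0 \<in> B" "0 < e"
  shows "\<exists>d>0. \<forall>a\<in>A. \<forall>b\<in>B. dist a a0 < d \<longrightarrow> dist b b0 < d \<longrightarrow>
    2 * (F x b - F a b) - lam * (dist a x)\<^sup>2 \<le> 2 * (F x b0 - F a0 b0) - lam * (dist a0 x)\<^sup>2 + e"
proof -
  have e: "0 < e / 8" using assms(4) by simp
  obtain d1 where d1: "d1 > 0" "\<And>a b. dist a x < d1 \<Longrightarrow> dist b b0 < d1 \<Longrightarrow> \<bar>P a b - P x b0\<bar> < e / 8"
    using P_near[OF e, of x b0] by blast
  obtain d2 where d2: "d2 > 0" "\<And>a b. dist a a0 < d2 \<Longrightarrow> dist b b0 < d2 \<Longrightarrow> \<bar>P a b - P a0 b0\<bar> < e / 8"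
    using P_near[OF e, of a0 b0] by blast
  obtain d3 where d3: "d3 > 0" "\<And>a. a \<in> A \<Longrightarrow> dist a a0 < d3 \<Longrightarrow> p a0 - e / 8 < p a"
    using p_near[OF assms(2) e] by blast
  have "continuous_on UNIV (\<lambda>a. lam * (dist a x)\<^sup>2)" by (intro continuous_intros)
  then obtain d4 where d4: "d4 > 0" "\<And>a. dist a a0 < d4 \<Longrightarrow> dist (lam * (dist a x)\<^sup>2) (lam * (dist a0 x)\<^sup>2) < e / 8"
    using e unfolding continuous_on_iff by (metis UNIV_I)
  define d where "d = min (min d1 d2) (min d3 d4)"
  have "2 * (F x b - F a b) - lam * (dist a x)\<^sup>2 \<le> 2 * (F x b0 - F a0 b0) - lam * (dist a0 x)\<^sup>2 + e"
    if ab: "a \<in> A" "b \<in> B" "dist a a0 < d" "dist b b0 < d" for a b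
  proof -
    have "\<bar>P x b - P x b0\<bar> < e / 8" using d1(2)[of x b] d1(1) ab by (simp add: d_def)
    moreover have "\<bar>P a b - P a0 b0\<bar> < e / 8" using d2(2)[of a b] ab by (simp add: d_def)
    moreover have "p a0 - e / 8 < p a" using d3(2)[of a] ab by (simp add: d_def)
    moreover have "\<bar>lam * (dist a x)\<^sup>2 - lam * (dist a0 x)\<^sup>2\<bar> < e / 8"
      using d4(2)[of a] ab by (simp add: d_def dist_real_def)
    moreover note split[OF assms(1) ab(2)] split[OF assms(1,3)] split[OF ab(1,2)] split[OF assms(2,3)]
    ultimately show ?thesis using assms(4) by argo
  qed
  moreover have "d > 0" using d1 d2 d3 d4 by (simp add: d_def)
  ultimately show ?thesis by blast
qed

text \<open>Near \<open>(u t, v t)\<close> the right-hand side is at most the constant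
  \<open>c\<close>. The discrete inequalities are summed over the steps in [t, t + h] with this
  constant, so that the limit in \<open>k\<close> involves only distances and grid times.\<close>

lemma limit_EVI:
  assumes ap: "approxX \<tau> X Y u v" and t: "0 < t" and uv: "u t \<in> A" "v t \<in> B" and x: "x \<in> A" and e: "0 < e"
  shows "\<forall>\<^sub>F h in at_right 0. (dist (u (t + h)) x)\<^sup>2 - (dist (u t) x)\<^sup>2
      \<le> h * (2 * (F x (v t) - F (u t) (v t)) - lam * (dist (u t) x)\<^sup>2 + e)"
proof -
  define c where "c = 2 * (F x (v t) - F (u t) (v t)) - lam * (dist (u t) x)\<^sup>2 + e"
  obtain r where r: "r > 0" "\<And>a b. a \<in> A \<Longrightarrow> b \<in> B \<Longrightarrow> dist a (u t) < r \<Longrightarrow> dist b (v t) < r \<Longrightarrow>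
      2 * (F x b - F a b) - lam * (dist a x)\<^sup>2 \<le> c"
    using EVI_rhs_usc[OF x uv e] unfolding c_def by blast
  have "0 \<le> t" "0 < r / 2" using t r(1) by auto
  then obtain d where d: "d > 0" "\<And>a. 0 \<le> a \<Longrightarrow> \<bar>a - t\<bar> < d \<Longrightarrow> dist (u a) (u t) < r / 2 \<and> dist (v a) (v t) < r / 2"
    using continuous_near[OF approxX_D(4,5)[OF ap]] by blast
  have "(dist (u (t + h)) x)\<^sup>2 - (dist (u t) x)\<^sup>2 \<le> h * c" if h: "0 < h" "h < d" for h
  proof -
    define i where "i k = nat \<lfloor>t / \<tau> k\<rfloor>" for k
    define j where "j k = nat \<lfloor>(t + h) / \<tau> k\<rfloor>" for k
    have near: "\<forall>\<^sub>F k in sequentially. \<forall>n. t \<le> real n * \<tau> k \<and> real n * \<tau> k \<le> t + h \<longrightarrow>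
        dist (X k n) (u t) < r \<and> dist (Y k n) (v t) < r"
    proof (rule approxX_local[OF ap r(1)])
      fix a assume "a \<in> {t..t + h}"
      then show "dist (u a) (u t) < r / 2 \<and> dist (v a) (v t) < r / 2" using h t by (intro d) auto
    qed (use t in simp)
    have th: "0 \<le> t + h" using t h by simp
    have "(dist (u (t + h)) x)\<^sup>2 \<le> (dist (u t) x)\<^sup>2 + c * (t + h - t)"
    proof (rule tendsto_le[OF sequentially_bot])
      show "(\<lambda>k. (dist (X k (j k)) x)\<^sup>2) \<longlonglongrightarrow> (dist (u (t + h)) x)\<^sup>2"
        unfolding j_def by (intro tendsto_intros approxX_tendsto[OF ap th])
      show "(\<lambda>k. (dist (X k (i k)) x)\<^sup>2 + c * (real (j k) * \<tau> k - real (i k) * \<tau> k))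
          \<longlonglongrightarrow> (dist (u t) x)\<^sup>2 + c * (t + h - t)"
        unfolding i_def j_def
        by (intro tendsto_intros approxX_tendsto[OF ap \<open>0 \<le> t\<close>]
            floor_index_tendsto[OF approxX_D(3)[OF ap] approxX_D(1)[OF ap]] th \<open>0 \<le> t\<close>)
      show "\<forall>\<^sub>F k in sequentially. (dist (X k (j k)) x)\<^sup>2
          \<le> (dist (X k (i k)) x)\<^sup>2 + c * (real (j k) * \<tau> k - real (i k) * \<tau> k)"
        using near
      proof eventually_elim
        case (elim k)
        note tk = approxX_D(1)[OF ap, of k]
        have ib: "t < real (i k) * \<tau> k + \<tau> k" using floor_index(2)[OF tk \<open>0 \<le> t\<close>] by (simp only: i_def)
        have jb: "real (j k) * \<tau> k \<le> t + h" using floor_index(1)[OF tk th] by (simp only: j_def)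
        have "i k \<le> j k"
          unfolding i_def j_def using tk h by (intro nat_mono floor_mono divide_right_mono) auto
        then have "(dist (X k (j k)) x)\<^sup>2 \<le> (dist (X k (i k)) x)\<^sup>2 + (\<tau> k * c) * (real (j k) - real (i k))"
        proof (rule nat_increment_bound[rotated])
          fix n assume n: "i k \<le> n" "n < j k"
          have "real (i k) * \<tau> k \<le> real n * \<tau> k" "real (Suc n) * \<tau> k \<le> real (j k) * \<tau> k"
            using n tk by (auto intro!: mult_right_mono)
          moreover have "real (Suc n) * \<tau> k = real n * \<tau> k + \<tau> k" by (simp add: algebra_simps)
          \<comment> \<open>Only the new iterate \<open>Suc n\<close> is evaluated; its grid time
            lies after \<open>t\<close> even when \<open>n = i k\<close>.\<close>
          ultimately have "t \<le> real (Suc n) * \<tau> k \<and> real (Suc n) * \<tau> k \<le> t + h" using ib jb by linarith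
          then have nr: "dist (X k (Suc n)) (u t) < r" "dist (Y k (Suc n)) (v t) < r" using elim by blast+
          let ?x = "X k (Suc n)" and ?y = "Y k (Suc n)"
          have "(1 + lam * \<tau> k) * (dist ?x x)\<^sup>2 - (dist (X k n) x)\<^sup>2 + (dist ?x (X k n))\<^sup>2
              \<le> 2 * \<tau> k * (F x ?y - F ?x ?y)"
            using approxX_D(8)[OF ap, of k n] x by (simp add: stepX_def)
          moreover have "\<tau> k * (2 * (F x ?y - F ?x ?y) - lam * (dist ?x x)\<^sup>2) \<le> \<tau> k * c"
            using tk by (intro mult_left_mono r nr approxX_D(6,7)[OF ap]) auto
          moreover have "\<tau> k * (2 * (F x ?y - F ?x ?y) - lam * (dist ?x x)\<^sup>2)
              = 2 * \<tau> k * (F x ?y - F ?x ?y) - lam * \<tau> k * (dist ?x x)\<^sup>2"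
            "(1 + lam * \<tau> k) * (dist ?x x)\<^sup>2 = (dist ?x x)\<^sup>2 + lam * \<tau> k * (dist ?x x)\<^sup>2"
            by (simp_all add: algebra_simps)
          ultimately show "(dist ?x x)\<^sup>2 \<le> (dist (X k n) x)\<^sup>2 + \<tau> k * c"
            using zero_le_power2[of "dist ?x (X k n)"] by linarith
        qed
        then show ?case by (simp add: algebra_simps)
      qed
    qed
    then show ?thesis by (simp add: mult.commute)
  qed
  then show ?thesis unfolding eventually_at_right_field c_def using d(1) by auto
qed

end

section \<open>Uniqueness and stability\<close>

text \<open>At the last time \<open>s\<close> in [0, T] with \<open>f s \<le> g s\<close> the two
  functions agree. The upper right slope of \<open>f\<close> there lies below the derivative of
  \<open>g\<close>, which forces \<open>f < g\<close> just after \<open>s\<close> and contradicts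
  the choice of \<open>s\<close>.\<close>

lemma crossing:
  fixes f g :: "real \<Rightarrow> real"
  assumes f: "continuous_on {0..} f" and g: "continuous_on {0..} g"
    and g': "\<And>t. 0 < t \<Longrightarrow> (g has_real_derivative g' t) (at t)"
    and init: "f 0 < g 0"
    and touch: "\<And>t. 0 < t \<Longrightarrow> f t = g t \<Longrightarrow> \<exists>c<g' t. \<forall>\<^sub>F h in at_right 0. f (t + h) - f t \<le> h * c"
    and "0 \<le> T"
  shows "f T \<le> g T"
proof (rule ccontr)
  assume "\<not> f T \<le> g T"
  then have fT: "g T < f T" by simp
  define S where "S = {t \<in> {0..T}. f t \<le> g t}"
  have cont: "continuous_on {0..T} f" "continuous_on {0..T} g"
    using f g by (auto elim: continuous_on_subset)
  have "closed S" unfolding S_def by (intro continuous_on_closed_Collect_le cont closed_atLeastAtMost)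
  moreover have "S \<subseteq> {0..T}" by (auto simp: S_def)
  ultimately have "compact S" using compact_Int_closed[OF compact_Icc, of S 0 T] by (simp add: inf.absorb2)
  moreover have "0 \<in> S" using \<open>0 \<le> T\<close> init by (simp add: S_def)
  ultimately obtain s where s: "s \<in> S" and smax: "\<And>a. a \<in> S \<Longrightarrow> a \<le> s"
    using compact_attains_sup[of S] by blast
  have sT: "0 \<le> s" "s < T" using s fT by (auto simp: S_def order_less_le)
  have eq: "f s = g s"
  proof (rule ccontr)
    assume "f s \<noteq> g s"
    then have "f s - g s \<le> 0" "0 \<le> f T - g T" using s fT by (auto simp: S_def)
    moreover have "continuous_on {s..T} (\<lambda>a. f a - g a)"
      using cont sT by (intro continuous_intros) (auto elim!: continuous_on_subset)
    ultimately obtain a where a: "s \<le> a" "a \<le> T" "f a - g a = 0"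
      using IVT'[of "\<lambda>a. f a - g a" s 0 T] sT by auto
    then have "a = s" using smax[of a] sT by (auto simp: S_def)
    then show False using a \<open>f s \<noteq> g s\<close> by simp
  qed
  then have "0 < s" using init sT by (cases "s = 0") auto
  obtain c where c: "c < g' s" "\<forall>\<^sub>F h in at_right 0. f (s + h) - f s \<le> h * c"
    using touch[OF \<open>0 < s\<close> eq] by blast
  have "((\<lambda>h. (g (s + h) - g s) / h) \<longlongrightarrow> g' s) (at 0)" using g'[OF \<open>0 < s\<close>] by (simp add: DERIV_def)
  then have "((\<lambda>h. (g (s + h) - g s) / h) \<longlongrightarrow> g' s) (at_right 0)" by (simp add: filterlim_at_split)
  then have "\<forall>\<^sub>F h in at_right 0. c < (g (s + h) - g s) / h" using c(1) by (rule order_tendstoD(1))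
  moreover have "\<forall>\<^sub>F h in at_right 0. (0::real) < h \<and> h < T - s"
    using eventually_at_right_real[of 0 "T - s"] sT by simp
  ultimately have "\<forall>\<^sub>F h in at_right 0. s + h \<in> S \<and> 0 < h"
    using c(2)
  proof eventually_elim
    case (elim h)
    have "h * c < g (s + h) - g s" using elim by (simp add: pos_less_divide_eq mult.commute)
    then show ?case using elim eq sT by (simp add: S_def)
  qed
  then obtain h where "s + h \<in> S" "0 < h"
    using eventually_happens trivial_limit_at_right_real by blast
  then show False using smax[of "s + h"] by simp
qed

context saddle_system
begin

text \<open>Continuity includes time 0, where the value may lie outside \<open>A \<times> B\<close>;
  the inequality is imposed at positive times. The slack \<open>e\<close> encodes an upper Dini
  derivative.\<close>

definition evi_sum :: "(real \<Rightarrow> 'a \<times> 'b) \<Rightarrow> bool" where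
  "evi_sum w \<longleftrightarrow> continuous_on {0..} w \<and> (\<forall>t>0. w t \<in> A \<times> B) \<and>
     (\<forall>t>0. \<forall>z\<in>A \<times> B. \<forall>e>0. \<forall>\<^sub>F h in at_right 0. (dist (w (t + h)) z)\<^sup>2 - (dist (w t) z)\<^sup>2
        \<le> h * (2 * beta z (w t) + \<bar>lam\<bar> * (dist (w t) z)\<^sup>2 + e))"

lemma evi_sumD:
  assumes "evi_sum w"
  shows "continuous_on {0..} w" "0 < t \<Longrightarrow> w t \<in> A \<times> B"
    "0 < t \<Longrightarrow> z \<in> A \<times> B \<Longrightarrow> 0 < e \<Longrightarrow> \<forall>\<^sub>F h in at_right 0. (dist (w (t + h)) z)\<^sup>2 - (dist (w t) z)\<^sup>2
        \<le> h * (2 * beta z (w t) + \<bar>lam\<bar> * (dist (w t) z)\<^sup>2 + e)"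
proof -
  show "continuous_on {0..} w" "0 < t \<Longrightarrow> w t \<in> A \<times> B" using assms by (simp_all only: evi_sum_def)
  assume "0 < t" "z \<in> A \<times> B" "0 < e"
  then show "\<forall>\<^sub>F h in at_right 0. (dist (w (t + h)) z)\<^sup>2 - (dist (w t) z)\<^sup>2
        \<le> h * (2 * beta z (w t) + \<bar>lam\<bar> * (dist (w t) z)\<^sup>2 + e)"
    by (rule assms[unfolded evi_sum_def, THEN conjunct2, THEN conjunct2, rule_format])
qed

text \<open>Testing the EVI against a discrete solution and vice versa, \<open>beta\<close> cancels and the squared
  distances to the iterates satisfy a system of differential inequalities of Poisson type. No
  regularity in time of the solution is needed.\<close>

lemma evi_discrete_comparison:
  fixes z :: "nat \<Rightarrow> 'a \<times> 'b"
  assumes w: "evi_sum w" and z: "scheme \<eta> z" "0 < \<eta>" "\<eta> \<le> tau0" "slope_le K (z 0)"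
    and \<delta>: "dist (w 0) (z 0) < \<delta>" and t: "0 \<le> t"
  shows "(dist (w t) (z m))\<^sup>2 \<le> exp ((4 * \<bar>lam\<bar> + 1) * t) * (theta \<eta> ^ (2 * m) *
    (2 * \<delta>\<^sup>2 + 2 * K\<^sup>2 * ((t - real m * (theta \<eta> * \<eta>))\<^sup>2 + real m * (theta \<eta> * \<eta>)\<^sup>2)))"
  using t
proof (induction m arbitrary: t)
  case 0
  \<comment> \<open>The \<open>lam\<close> terms consume at most 2 |\<open>lam\<close>| times the
    barrier. The summand 1 provides the strict margin for \<open>crossing\<close>, half of which
    pays for the slack \<open>e\<close> of \<open>evi_sum\<close>.\<close>
  define \<omega> where "\<omega> = 4 * \<bar>lam\<bar> + 1"
  have K: "0 \<le> K" and z0: "z 0 \<in> A \<times> B" using z(4) by (simp_all only: slope_le_def)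
  have \<delta>0: "0 < \<delta>" using \<delta> zero_le_dist[of "w 0" "z 0"] by linarith
  have "(dist (w t) (z 0))\<^sup>2 \<le> exp (\<omega> * t) * (\<delta> + K * t)\<^sup>2"
  proof (rule crossing[where T = t and f = "\<lambda>t. (dist (w t) (z 0))\<^sup>2"
        and g = "\<lambda>t. exp (\<omega> * t) * (\<delta> + K * t)\<^sup>2"
        and g' = "\<lambda>t. \<omega> * (exp (\<omega> * t) * (\<delta> + K * t)\<^sup>2) + exp (\<omega> * t) * (2 * (\<delta> + K * t) * K)"])
    show "continuous_on {0..} (\<lambda>t. (dist (w t) (z 0))\<^sup>2)"
      by (intro continuous_intros evi_sumD(1)[OF w])
    show "continuous_on {0..} (\<lambda>t. exp (\<omega> * t) * (\<delta> + K * t)\<^sup>2)" by (intro continuous_intros)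
    show "(dist (w 0) (z 0))\<^sup>2 < exp (\<omega> * 0) * (\<delta> + K * 0)\<^sup>2" using \<delta> by (simp add: power_strict_mono)
    show "((\<lambda>t. exp (\<omega> * t) * (\<delta> + K * t)\<^sup>2) has_real_derivative
        \<omega> * (exp (\<omega> * t) * (\<delta> + K * t)\<^sup>2) + exp (\<omega> * t) * (2 * (\<delta> + K * t) * K)) (at t)" for t
      by (auto intro!: derivative_eq_intros simp: algebra_simps)
    fix t :: real assume t: "0 < t" and eq: "(dist (w t) (z 0))\<^sup>2 = exp (\<omega> * t) * (\<delta> + K * t)\<^sup>2"
    define g where "g = exp (\<omega> * t) * (\<delta> + K * t)\<^sup>2"
    let ?d = "dist (w t) (z 0)"
    have pos: "0 < \<delta> + K * t" using \<delta>0 K t by (simp add: add_pos_nonneg)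
    then have g: "0 < g" by (simp add: g_def)
    \<comment> \<open>The root of the barrier contains exp(\<omega> t / 2), replaced here by the
      larger exp(\<omega> t).\<close>
    have "?d \<le> exp (\<omega> * t) * (\<delta> + K * t)"
    proof (rule power2_le_imp_le)
      have "1 \<le> exp (\<omega> * t)" using t by (simp add: \<omega>_def)
      then have "exp (\<omega> * t) * (\<delta> + K * t)\<^sup>2 \<le> exp (\<omega> * t) * (exp (\<omega> * t) * (\<delta> + K * t)\<^sup>2)"
        using mult_right_mono[of 1 "exp (\<omega> * t)" g] g unfolding g_def mult_1_left by linarith
      then show "?d\<^sup>2 \<le> (exp (\<omega> * t) * (\<delta> + K * t))\<^sup>2"
        unfolding eq by (simp add: power_mult_distrib power2_eq_square mult_ac)
    qed (use pos in simp)
    then have "2 * K * ?d \<le> 2 * K * (exp (\<omega> * t) * (\<delta> + K * t))" using K by (intro mult_left_mono) auto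
    moreover have "beta (z 0) (w t) \<le> K * ?d + \<bar>lam\<bar> / 2 * ?d\<^sup>2"
      using slope_leD[OF z(4) evi_sumD(2)[OF w t]] by (simp only: dist_commute)
    moreover have dg: "?d\<^sup>2 = g" using eq by (simp add: g_def)
    moreover have "\<omega> * g = 4 * (\<bar>lam\<bar> * g) + g" by (simp add: \<omega>_def algebra_simps)
    moreover have "0 \<le> \<bar>lam\<bar> * g" using g by simp
    moreover have "exp (\<omega> * t) * (2 * (\<delta> + K * t) * K) = 2 * K * (exp (\<omega> * t) * (\<delta> + K * t))" by simp
    ultimately have "2 * beta (z 0) (w t) + \<bar>lam\<bar> * ?d\<^sup>2 + g / 2 < \<omega> * g + exp (\<omega> * t) * (2 * (\<delta> + K * t) * K)"
      using g unfolding dg by linarith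
    then show "\<exists>c<\<omega> * (exp (\<omega> * t) * (\<delta> + K * t)\<^sup>2) + exp (\<omega> * t) * (2 * (\<delta> + K * t) * K).
        \<forall>\<^sub>F h in at_right 0. (dist (w (t + h)) (z 0))\<^sup>2 - (dist (w t) (z 0))\<^sup>2 \<le> h * c"
      using evi_sumD(3)[OF w t z0, of "g / 2"] g unfolding g_def[symmetric] by auto
  qed (use 0 in auto)
  also have "\<dots> \<le> exp (\<omega> * t) * (2 * \<delta>\<^sup>2 + 2 * K\<^sup>2 * t\<^sup>2)"
    using zero_le_power2[of "\<delta> - K * t"]
    by (intro mult_left_mono) (auto simp: power2_sum power2_diff power_mult_distrib)
  finally show ?case by (simp add: \<omega>_def)
next
  case (Suc m)
  define \<omega> where "\<omega> = 4 * \<bar>lam\<bar> + 1"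
  define c where "c = 1 - \<bar>lam\<bar> * \<eta>"
  define s where "s = theta \<eta> * \<eta>"
  define W where "W = theta \<eta> ^ (2 * Suc m)"
  \<comment> \<open>The Crandall-Liggett bracket after the first step size has tended to 0: its time
    becomes \<open>t\<close> and its quadratic error term vanishes.\<close>
  define Q where "Q n t = 2 * \<delta>\<^sup>2 + 2 * K\<^sup>2 * ((t - real n * s)\<^sup>2 + real n * s\<^sup>2)" for n t
  note th = theta[OF z(2,3)]
  have c: "0 < c" "c \<le> 1" "theta \<eta> * c = 1" using th(3,4) z(2) by (auto simp: c_def)
  have \<delta>0: "0 < \<delta>" using \<delta> zero_le_dist[of "w 0" "z 0"] by linarith
  have Qpos: "0 < Q n t" for n t
    unfolding Q_def using \<delta>0 by (intro add_pos_nonneg mult_nonneg_nonneg add_nonneg_nonneg) auto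
  have W: "0 < W" using th(1) by (simp add: W_def)
  have Wm: "theta \<eta> ^ (2 * m) = c\<^sup>2 * W"
  proof -
    have "c\<^sup>2 * W = (theta \<eta> * c)\<^sup>2 * theta \<eta> ^ (2 * m)" by (simp add: W_def power2_eq_square)
    then show ?thesis by (simp add: c(3))
  qed
  have zm: "z (Suc m) \<in> A \<times> B" by (rule scheme_in[OF z(1)])
  have "(dist (w t) (z (Suc m)))\<^sup>2 \<le> exp (\<omega> * t) * (W * Q (Suc m) t)"
  proof (rule crossing[where T = t and f = "\<lambda>t. (dist (w t) (z (Suc m)))\<^sup>2"
        and g = "\<lambda>t. exp (\<omega> * t) * (W * Q (Suc m) t)"
        and g' = "\<lambda>t. \<omega> * (exp (\<omega> * t) * (W * Q (Suc m) t))
        + exp (\<omega> * t) * (W * (2 * K\<^sup>2 * (2 * (t - real (Suc m) * s))))"])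
    show "continuous_on {0..} (\<lambda>t. (dist (w t) (z (Suc m)))\<^sup>2)"
      by (intro continuous_intros evi_sumD(1)[OF w])
    show "continuous_on {0..} (\<lambda>t. exp (\<omega> * t) * (W * Q (Suc m) t))"
      unfolding Q_def by (intro continuous_intros)
    show "((\<lambda>t. exp (\<omega> * t) * (W * Q (Suc m) t)) has_real_derivative \<omega> * (exp (\<omega> * t) * (W * Q (Suc m) t))
        + exp (\<omega> * t) * (W * (2 * K\<^sup>2 * (2 * (t - real (Suc m) * s))))) (at t)" for t
      unfolding Q_def by (auto intro!: derivative_eq_intros)
    have "(dist (z (Suc m)) (w 0))\<^sup>2 < W * (2 * \<delta>\<^sup>2 + 2 * K\<^sup>2 * (real (Suc m) * s)\<^sup>2)"
      unfolding W_def s_def by (rule scheme_drift_sq[OF z]) (use \<delta> in \<open>simp add: dist_commute\<close>)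
    also have "\<dots> \<le> W * Q (Suc m) 0"
      unfolding Q_def using W by (intro mult_left_mono add_left_mono) auto
    finally show "(dist (w 0) (z (Suc m)))\<^sup>2 < exp (\<omega> * 0) * (W * Q (Suc m) 0)" by (simp add: dist_commute)
    fix t :: real assume t: "0 < t" and eq: "(dist (w t) (z (Suc m)))\<^sup>2 = exp (\<omega> * t) * (W * Q (Suc m) t)"
    define g where "g = exp (\<omega> * t) * (W * Q (Suc m) t)"
    define G where "G = exp (\<omega> * t) * (W * Q m t)"
    let ?D = "exp (\<omega> * t) * (W * (2 * K\<^sup>2 * (2 * (t - real (Suc m) * s))))"
    have g: "0 < g" "0 < G" using W Qpos by (simp_all add: g_def G_def)
    \<comment> \<open>Differential form of \<open>crandall_liggett_identity\<close>: the
      \<open>t\<close>-derivative of \<open>Q (Suc m) t\<close> times \<open>s\<close> equals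
      \<open>Q m t - Q (Suc m) t\<close>.\<close>
    have D: "\<eta> * ?D = c * (G - g)"
    proof -
      have "Q m t - Q (Suc m) t = 2 * K\<^sup>2 * (2 * (t - real (Suc m) * s)) * s"
        by (simp add: Q_def power2_eq_square algebra_simps)
      moreover have "G - g = exp (\<omega> * t) * (W * (Q m t - Q (Suc m) t))"
        by (simp only: G_def g_def right_diff_distrib)
      ultimately have "G - g = ?D * s" by (simp only: mult.assoc)
      then have "c * (G - g) = (theta \<eta> * c) * (\<eta> * ?D)" by (simp only: s_def mult_ac)
      then show ?thesis by (simp only: c(3) mult_1_left)
    qed
    have "(dist (w t) (z m))\<^sup>2 \<le> c\<^sup>2 * G"
      using Suc.IH[of t] t unfolding Wm G_def Q_def s_def \<omega>_def by (simp only: mult_ac less_imp_le)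
    \<comment> \<open>One of the two factors \<open>c\<close> from \<open>Wm\<close> is given up;
      the other matches the coefficient in \<open>step_sum\<close>.\<close>
    also have "\<dots> \<le> c * G" using c(1,2) g by (simp add: power2_eq_square mult_right_mono mult_left_le)
    finally have IH: "(dist (w t) (z m))\<^sup>2 \<le> c * G" .
    have "step \<eta> (z m) (z (Suc m))" using z(1) by (simp add: scheme_def)
    from step_sum[OF this z(2) evi_sumD(2)[OF w t]]
    have st: "c * g - (dist (w t) (z m))\<^sup>2 \<le> - (2 * \<eta> * beta (z (Suc m)) (w t))"
    proof -
      have "2 * \<eta> * beta (w t) (z (Suc m)) = - (2 * \<eta> * beta (z (Suc m)) (w t))"
        by (subst beta_swap) simp
      then show ?thesis
        using \<open>(1 - \<bar>lam\<bar> * \<eta>) * (dist (z (Suc m)) (w t))\<^sup>2 - (dist (z m) (w t))\<^sup>2 + (dist (z (Suc m)) (z m))\<^sup>2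
            \<le> 2 * \<eta> * beta (w t) (z (Suc m))\<close> zero_le_power2[of "dist (z (Suc m)) (z m)"]
        unfolding c_def[symmetric] dist_commute[of "z (Suc m)" "w t"] dist_commute[of "z m" "w t"] eq g_def[symmetric]
        by linarith
    qed
    have "\<eta> * (2 * beta (z (Suc m)) (w t)) \<le> c * G - c * g" using st IH by simp
    also have "\<dots> = \<eta> * ?D" unfolding D by (simp only: right_diff_distrib)
    finally have "2 * beta (z (Suc m)) (w t) \<le> ?D" using z(2) by (simp only: mult_le_cancel_left_pos)
    moreover have "\<omega> * g = 4 * (\<bar>lam\<bar> * g) + g" by (simp add: \<omega>_def algebra_simps)
    moreover have "0 \<le> \<bar>lam\<bar> * g" using g by simp
    ultimately have "2 * beta (z (Suc m)) (w t) + \<bar>lam\<bar> * (dist (w t) (z (Suc m)))\<^sup>2 + g / 2 < \<omega> * g + ?D"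
      using g(1) unfolding eq g_def[symmetric] by linarith
    then show "\<exists>c<\<omega> * (exp (\<omega> * t) * (W * Q (Suc m) t)) + ?D.
        \<forall>\<^sub>F h in at_right 0. (dist (w (t + h)) (z (Suc m)))\<^sup>2 - (dist (w t) (z (Suc m)))\<^sup>2 \<le> h * c"
      using evi_sumD(3)[OF w t zm, of "g / 2"] g unfolding g_def[symmetric] by auto
  qed (use Suc.prems in auto)
  then show ?case by (simp only: \<omega>_def W_def Q_def s_def)
qed

text \<open>As the step size tends to 0 the effective time approaches \<open>t\<close>, so the term
  with \<open>K\<close> disappears and only the initial distance is left.\<close>

lemma evi_flow:
  assumes w: "evi_sum w" and z: "slope_le K z" and \<delta>: "dist (w 0) z < \<delta>" and t: "0 \<le> t"
  shows "(dist (w t) (flow z t))\<^sup>2 \<le> exp ((8 * \<bar>lam\<bar> + 1) * t) * (2 * \<delta>\<^sup>2)"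
proof (rule tendsto_le[OF sequentially_bot])
  let ?r = "\<lambda>k. (1 + 2 * \<bar>lam\<bar> * t) * tauk k"
  show "(\<lambda>k. (dist (w t) (interp (tauk k) z t))\<^sup>2) \<longlonglongrightarrow> (dist (w t) (flow z t))\<^sup>2"
    by (intro tendsto_intros interp_tendsto_flow[OF z t])
  have "(\<lambda>k. exp ((8 * \<bar>lam\<bar> + 1) * t) * (2 * \<delta>\<^sup>2 + 2 * K\<^sup>2 * ((?r k)\<^sup>2 + 4 * t * tauk k)))
      \<longlonglongrightarrow> exp ((8 * \<bar>lam\<bar> + 1) * t) * (2 * \<delta>\<^sup>2 + 2 * K\<^sup>2 * (((1 + 2 * \<bar>lam\<bar> * t) * 0)\<^sup>2 + 4 * t * 0))"
    by (intro tendsto_intros tauk(3))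
  then show "(\<lambda>k. exp ((8 * \<bar>lam\<bar> + 1) * t) * (2 * \<delta>\<^sup>2 + 2 * K\<^sup>2 * ((?r k)\<^sup>2 + 4 * t * tauk k)))
      \<longlonglongrightarrow> exp ((8 * \<bar>lam\<bar> + 1) * t) * (2 * \<delta>\<^sup>2)" by simp
  show "\<forall>\<^sub>F k in sequentially. (dist (w t) (interp (tauk k) z t))\<^sup>2
      \<le> exp ((8 * \<bar>lam\<bar> + 1) * t) * (2 * \<delta>\<^sup>2 + 2 * K\<^sup>2 * ((?r k)\<^sup>2 + 4 * t * tauk k))"
  proof (intro always_eventually allI)
    fix k
    define m where "m = nat \<lfloor>t / tauk k\<rfloor>"
    define R where "R = 2 * \<delta>\<^sup>2 + 2 * K\<^sup>2 * ((?r k)\<^sup>2 + 4 * t * tauk k)"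
    let ?s = "theta (tauk k) * tauk k"
    note mb = index_bounds[OF tauk(1,2) t order_refl m_def]
    note it = iterates[OF tauk(1,2), of k z]
    have "\<bar>t - real m * ?s\<bar>\<^sup>2 \<le> (?r k)\<^sup>2"
      using mb(1) by (intro power_mono) (auto simp: abs_minus_commute)
    then have R: "2 * \<delta>\<^sup>2 + 2 * K\<^sup>2 * ((t - real m * ?s)\<^sup>2 + real m * ?s\<^sup>2) \<le> R"
      using mb(2) unfolding R_def power2_abs by (intro add_left_mono mult_left_mono add_mono) auto
    have R0: "0 \<le> 2 * \<delta>\<^sup>2 + 2 * K\<^sup>2 * ((t - real m * ?s)\<^sup>2 + real m * ?s\<^sup>2)" by simp
    have "(dist (w t) (iterates (tauk k) z m))\<^sup>2 \<le> exp ((4 * \<bar>lam\<bar> + 1) * t) * (theta (tauk k) ^ (2 * m) *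
        (2 * \<delta>\<^sup>2 + 2 * K\<^sup>2 * ((t - real m * ?s)\<^sup>2 + real m * ?s\<^sup>2)))"
      using evi_discrete_comparison[OF w it(1) tauk(1,2) _ _ t] z \<delta> unfolding it(2) by blast
    also have "\<dots> \<le> exp ((4 * \<bar>lam\<bar> + 1) * t) * (exp (4 * \<bar>lam\<bar> * t) * R)"
      using mult_mono[OF mb(3) R _ R0] by (intro mult_left_mono) auto
    also have "\<dots> = exp ((8 * \<bar>lam\<bar> + 1) * t) * R"
    proof -
      have "exp ((4 * \<bar>lam\<bar> + 1) * t) * exp (4 * \<bar>lam\<bar> * t) = exp ((8 * \<bar>lam\<bar> + 1) * t)"
        unfolding exp_add[symmetric] by (simp add: algebra_simps)
      then show ?thesis by (simp only: mult.assoc[symmetric])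
    qed
    finally show "(dist (w t) (interp (tauk k) z t))\<^sup>2 \<le> exp ((8 * \<bar>lam\<bar> + 1) * t) * R"
      by (simp add: interp_def m_def)
  qed
qed

text \<open>All solutions are compared with one flow, started at a finite slope point near
  \<open>w 0\<close>, and then with each other by the triangle inequality. Constant sequences give
  uniqueness.\<close>

lemma evi_stable:
  assumes wn: "\<And>n. evi_sum (wn n)" and w: "evi_sum w" and lim: "(\<lambda>n. wn n 0) \<longlonglongrightarrow> w 0"
    and w0: "w 0 \<in> closure (A \<times> B)" and t: "0 \<le> t"
  shows "(\<lambda>n. wn n t) \<longlonglongrightarrow> w t"
proof (rule tendstoI)
  fix e :: real assume e: "0 < e"
  define M where "M = exp ((8 * \<bar>lam\<bar> + 1) * t) * 2"
  have M: "0 < M" by (simp add: M_def)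
  \<comment> \<open>Ensures M \<delta>^2 \<le> (e / 4)^2; the estimate M \<le> (M + 1)^2 avoids a
    root.\<close>
  define \<delta> where "\<delta> = e / (4 * (M + 1))"
  have \<delta>: "0 < \<delta>" using e M by (simp add: \<delta>_def)
  have small: "a \<le> e / 4" if "0 \<le> a" "a\<^sup>2 \<le> exp ((8 * \<bar>lam\<bar> + 1) * t) * (2 * \<delta>\<^sup>2)" for a :: real
  proof (rule power2_le_imp_le)
    have "M * \<delta>\<^sup>2 \<le> (M + 1)\<^sup>2 * \<delta>\<^sup>2"
      using M by (intro mult_right_mono) (auto simp: power2_eq_square algebra_simps)
    also have "\<dots> = ((M + 1) * \<delta>)\<^sup>2" by (simp only: power_mult_distrib)
    also have "(M + 1) * \<delta> = e / 4" using M by (simp add: \<delta>_def field_simps)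
    finally show "a\<^sup>2 \<le> (e / 4)\<^sup>2" using that(2) by (simp add: M_def mult_ac)
  qed (use e in simp)
  obtain z K where z: "slope_le K z" "dist z (w 0) < \<delta> / 2"
    using finite_slope_dense[OF w0, of "\<delta> / 2"] \<delta> by auto
  have "dist (w 0) z < \<delta>" using z(2) \<delta> by (simp add: dist_commute)
  then have wz: "dist (w t) (flow z t) \<le> e / 4" using evi_flow[OF w z(1) _ t] small by simp
  have "\<forall>\<^sub>F n in sequentially. dist (wn n 0) (w 0) < \<delta> / 2" by (rule tendstoD[OF lim]) (use \<delta> in simp)
  then show "\<forall>\<^sub>F n in sequentially. dist (wn n t) (w t) < e"
  proof eventually_elim
    case (elim n)
    have "dist (wn n 0) z < \<delta>"
      using elim z(2) dist_triangle[of "wn n 0" z "w 0"] by (simp add: dist_commute)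
    then have "dist (wn n t) (flow z t) \<le> e / 4" using evi_flow[OF wn z(1) _ t] small by simp
    then show ?case using wz dist_triangle2[of "wn n t" "w t" "flow z t"] e by linarith
  qed
qed

end

section \<open>Existence and translation to extended real values\<close>

context saddle_system
begin

text \<open>Both EVIs multiplied by 2, with the Dini derivative expressed by a slack
  \<open>e\<close> as in \<open>dini_upper_le_iff\<close>.\<close>

definition evi_real :: "(real \<Rightarrow> 'a) \<Rightarrow> (real \<Rightarrow> 'b) \<Rightarrow> bool" where
  "evi_real u v \<longleftrightarrow> (\<forall>t>0. u t \<in> A \<and> v t \<in> B \<and>
     (\<forall>x\<in>A. \<forall>e>0. \<forall>\<^sub>F h in at_right 0. (dist (u (t + h)) x)\<^sup>2 - (dist (u t) x)\<^sup>2
        \<le> h * (2 * (F x (v t) - F (u t) (v t)) - lam * (dist (u t) x)\<^sup>2 + e)) \<and>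
     (\<forall>y\<in>B. \<forall>e>0. \<forall>\<^sub>F h in at_right 0. (dist (v (t + h)) y)\<^sup>2 - (dist (v t) y)\<^sup>2
        \<le> h * (2 * (F (u t) (v t) - F (u t) y) - lam * (dist (v t) y)\<^sup>2 + e)))"

lemma evi_real_D:
  assumes "evi_real u v" "0 < t"
  shows "u t \<in> A" "v t \<in> B"
    "x \<in> A \<Longrightarrow> 0 < e \<Longrightarrow> \<forall>\<^sub>F h in at_right 0. (dist (u (t + h)) x)\<^sup>2 - (dist (u t) x)\<^sup>2
        \<le> h * (2 * (F x (v t) - F (u t) (v t)) - lam * (dist (u t) x)\<^sup>2 + e)"
    "y \<in> B \<Longrightarrow> 0 < e \<Longrightarrow> \<forall>\<^sub>F h in at_right 0. (dist (v (t + h)) y)\<^sup>2 - (dist (v t) y)\<^sup>2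
        \<le> h * (2 * (F (u t) (v t) - F (u t) y) - lam * (dist (v t) y)\<^sup>2 + e)"
  using assms unfolding evi_real_def by blast+

lemma evi_real_exists:
  assumes "w0 \<in> closure (A \<times> B)"
  shows "\<exists>u v. evi_real u v \<and> continuous_on {0..} u \<and> continuous_on {0..} v \<and> (u 0, v 0) = w0"
proof -
  interpret sw: saddle_system lam B A "\<lambda>y x. - F x y" "\<lambda>y x. - P x y" "\<lambda>y. - q y" "\<lambda>x. - p x"
    by (rule swap)
  obtain w \<tau> W where *: "w 0 = w0 \<and> continuous_on {0..} w \<and> \<tau> \<longlonglongrightarrow> 0 \<and>
      (\<forall>k. 0 < \<tau> k \<and> \<tau> k \<le> tau0 \<and> scheme (\<tau> k) (W k)) \<and>
      (\<forall>T e. 0 < e \<longrightarrow> (\<forall>\<^sub>F k in sequentially. \<forall>t\<in>{0..T}. dist (W k (nat \<lfloor>t / \<tau> k\<rfloor>)) (w t) < e))"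
    using discrete_approximation[OF assms] by (elim exE)
  then have w: "w 0 = w0" "continuous_on {0..} w" and \<tau>: "\<tau> \<longlonglongrightarrow> 0" "\<And>k. 0 < \<tau> k" "\<And>k. \<tau> k \<le> tau0"
    and W: "\<And>k. scheme (\<tau> k) (W k)"
    and near: "\<And>T e. 0 < e \<Longrightarrow> \<forall>\<^sub>F k in sequentially. \<forall>t\<in>{0..T}. dist (W k (nat \<lfloor>t / \<tau> k\<rfloor>)) (w t) < e"
    by simp_all
  define u where "u t = fst (w t)" for t
  define v where "v t = snd (w t)" for t
  define X where "X k n = fst (W k n)" for k n
  define Y where "Y k n = snd (W k n)" for k n
  have cont: "continuous_on {0..} u" "continuous_on {0..} v"
    unfolding u_def v_def by (intro continuous_intros w)+
  have close: "\<forall>\<^sub>F k in sequentially. \<forall>t\<in>{0..T}.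
        dist (X k (nat \<lfloor>t / \<tau> k\<rfloor>)) (u t) < e \<and> dist (Y k (nat \<lfloor>t / \<tau> k\<rfloor>)) (v t) < e" if "0 < e" for T e
    using near[OF that, of T]
  proof eventually_elim
    case (elim k)
    then show ?case
      unfolding X_def Y_def u_def v_def by (meson dist_fst_le dist_snd_le order_le_less_trans)
  qed
  have st: "step (\<tau> k) (W k n) (W k (Suc n))" for k n using W by (simp add: scheme_def)
  then have AB: "X k (Suc n) \<in> A" "Y k (Suc n) \<in> B"
    and stX: "stepX (\<tau> k) (X k n) (X k (Suc n)) (Y k (Suc n))"
    and stY: "stepY (\<tau> k) (Y k n) (X k (Suc n)) (Y k (Suc n))" for k n
    by (simp_all only: X_def Y_def step_def mem_Times_iff)
  have ap: "approxX \<tau> X Y u v"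
    unfolding approxX_def by (intro conjI allI impI \<tau> cont AB stX close)
  \<comment> \<open>The same approximation seen in the exchanged system, so that
    \<open>limit_in_A\<close> and \<open>limit_EVI\<close> also serve the second component.\<close>
  have stY': "sw.stepX (\<tau> k) (Y k n) (Y k (Suc n)) (X k (Suc n))" for k n
    using stY[of k n] by (simp add: sw.stepX_def stepY_def)
  have close': "\<forall>\<^sub>F k in sequentially. \<forall>t\<in>{0..T}.
        dist (Y k (nat \<lfloor>t / \<tau> k\<rfloor>)) (v t) < e \<and> dist (X k (nat \<lfloor>t / \<tau> k\<rfloor>)) (u t) < e" if "0 < e" for T e
    using close[OF that, of T] by eventually_elim blast
  have ap': "sw.approxX \<tau> Y X v u"
    unfolding sw.approxX_def by (intro conjI allI impI \<tau> cont AB stY' close')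
  have uv: "u t \<in> A" "v t \<in> B" if "0 < t" for t
    using limit_in_A[OF ap that] sw.limit_in_A[OF ap' that] by auto
  have "evi_real u v"
    unfolding evi_real_def
  proof (intro allI impI conjI ballI)
    fix t :: real assume t: "0 < t"
    show "u t \<in> A" "v t \<in> B" using uv[OF t] by auto
    fix e :: real assume e: "0 < e"
    show "\<forall>\<^sub>F h in at_right 0. (dist (u (t + h)) x)\<^sup>2 - (dist (u t) x)\<^sup>2
        \<le> h * (2 * (F x (v t) - F (u t) (v t)) - lam * (dist (u t) x)\<^sup>2 + e)" if "x \<in> A" for x
      by (rule limit_EVI[OF ap t uv[OF t] that e])
    show "\<forall>\<^sub>F h in at_right 0. (dist (v (t + h)) y)\<^sup>2 - (dist (v t) y)\<^sup>2
        \<le> h * (2 * (F (u t) (v t) - F (u t) y) - lam * (dist (v t) y)\<^sup>2 + e)" if "y \<in> B" for y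
      using sw.limit_EVI[OF ap' t uv(2)[OF t] uv(1)[OF t] that e] by (simp add: algebra_simps)
  qed
  moreover have "(u 0, v 0) = w0" using w(1) by (simp add: u_def v_def)
  ultimately show ?thesis using cont by blast
qed

lemma evi_real_imp_sum:
  assumes evi: "evi_real u v" and w: "continuous_on {0..} w" "\<And>t. 0 < t \<Longrightarrow> w t = (u t, v t)"
  shows "evi_sum w"
  unfolding evi_sum_def
proof (intro conjI allI impI ballI)
  show "continuous_on {0..} w" by (rule w(1))
  fix t :: real assume t: "0 < t"
  note D = evi_real_D[OF evi t]
  show "w t \<in> A \<times> B" using D(1,2) w(2)[OF t] by simp
  fix z e assume z: "z \<in> A \<times> B" and e: "(0::real) < e"
  have "fst z \<in> A" "snd z \<in> B" "0 < e / 2" using z e by auto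
  then have "\<forall>\<^sub>F h in at_right 0. (dist (u (t + h)) (fst z))\<^sup>2 - (dist (u t) (fst z))\<^sup>2
        \<le> h * (2 * (F (fst z) (v t) - F (u t) (v t)) - lam * (dist (u t) (fst z))\<^sup>2 + e / 2)"
    "\<forall>\<^sub>F h in at_right 0. (dist (v (t + h)) (snd z))\<^sup>2 - (dist (v t) (snd z))\<^sup>2
        \<le> h * (2 * (F (u t) (v t) - F (u t) (snd z)) - lam * (dist (v t) (snd z))\<^sup>2 + e / 2)"
    using D(3,4) by blast+
  moreover have "\<forall>\<^sub>F h in at_right 0. (0::real) < h"
    by (auto simp: eventually_at_right_field intro: exI[of _ 1])
  ultimately show "\<forall>\<^sub>F h in at_right 0. (dist (w (t + h)) z)\<^sup>2 - (dist (w t) z)\<^sup>2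
        \<le> h * (2 * beta z (w t) + \<bar>lam\<bar> * (dist (w t) z)\<^sup>2 + e)"
  proof eventually_elim
    case (elim h)
    let ?S = "2 * beta z (w t) - lam * (dist (w t) z)\<^sup>2 + e"
    have "(dist (w (t + h)) z)\<^sup>2 - (dist (w t) z)\<^sup>2 \<le> h * ?S"
      using elim(1,2) w(2)[OF t] w(2)[of "t + h"] t elim(3)
      by (simp add: sq_dist_Pair beta_def algebra_simps)
    also have "\<dots> \<le> h * (2 * beta z (w t) + \<bar>lam\<bar> * (dist (w t) z)\<^sup>2 + e)"
      using elim(3) mult_right_mono[of "- lam" "\<bar>lam\<bar>" "(dist (w t) z)\<^sup>2"] by (intro mult_left_mono) auto
    finally show ?case .
  qed
qed

end

section \<open>Extended real values: from the assumptions to a saddle system\<close>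

lemma lsc_closed:
  assumes "lsc f"
  shows "closed {x. f x \<le> c}"
proof -
  have "open {x. c < f x}"
  proof (subst open_subopen, intro ballI)
    fix x assume "x \<in> {x. c < f x}"
    then have "c < Liminf (at x) f" using assms unfolding lsc_def by (auto intro: less_le_trans)
    then have "\<forall>\<^sub>F a in at x. c < f a" by (rule less_LiminfD)
    then obtain S where "open S" "x \<in> S" "\<And>a. a \<in> S \<Longrightarrow> a \<noteq> x \<Longrightarrow> c < f a"
      unfolding eventually_at_topological by blast
    \<comment> \<open>The filter \<open>at x\<close> ignores the point itself, which satisfies
      \<open>c < f x\<close> by assumption.\<close>
    then show "\<exists>T. open T \<and> x \<in> T \<and> T \<subseteq> {x. c < f x}" using \<open>x \<in> {x. c < f x}\<close> by blast
  qed
  moreover have "{x. f x \<le> c} = - {x. c < f x}" by auto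
  ultimately show ?thesis by (simp add: closed_def)
qed

lemma dini_upper_le_iff:
  "dini_upper f t \<le> ereal c \<longleftrightarrow> (\<forall>e>0. \<forall>\<^sub>F h in at_right 0. f (t + h) - f t \<le> h * (c + e))"
proof -
  have pos: "\<forall>\<^sub>F h in at_right 0. (0::real) < h"
    by (auto simp: eventually_at_right_field intro: exI[of _ 1])
  show ?thesis
  proof
    assume le: "dini_upper f t \<le> ereal c"
    show "\<forall>e>0. \<forall>\<^sub>F h in at_right 0. f (t + h) - f t \<le> h * (c + e)"
    proof (intro allI impI)
      fix e :: real assume "0 < e"
      then have "Limsup (at_right 0) (\<lambda>h. ereal ((f (t + h) - f t) / h)) < ereal (c + e)"
        using le unfolding dini_upper_def by (auto intro: le_less_trans)
      then have "\<forall>\<^sub>F h in at_right 0. ereal ((f (t + h) - f t) / h) < ereal (c + e)" by (rule Limsup_lessD)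
      then show "\<forall>\<^sub>F h in at_right 0. f (t + h) - f t \<le> h * (c + e)"
        using pos by eventually_elim (simp add: pos_divide_less_eq mult.commute)
    qed
  next
    assume R: "\<forall>e>0. \<forall>\<^sub>F h in at_right 0. f (t + h) - f t \<le> h * (c + e)"
    show "dini_upper f t \<le> ereal c"
    proof (rule ereal_le_epsilon2)
      fix e :: real assume "0 < e"
      then have "\<forall>\<^sub>F h in at_right 0. f (t + h) - f t \<le> h * (c + e)" using R by blast
      then have "\<forall>\<^sub>F h in at_right 0. ereal ((f (t + h) - f t) / h) \<le> ereal (c + e)"
        using pos by eventually_elim (simp add: pos_divide_le_eq mult.commute)
      then show "dini_upper f t \<le> ereal c + ereal e"
        unfolding dini_upper_def by (auto intro: Limsup_bounded)
    qed
  qed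
qed

text \<open>\<open>D\<close> may be infinite: \<infinity> falsifies both sides, -\<infinity>
  satisfies both.\<close>

lemma EVI_ereal_iff:
  fixes d a f g :: real
  shows "ereal (1 / 2) * D + ereal (a / 2 * d) + ereal f \<le> ereal g \<longleftrightarrow> D \<le> ereal (2 * (g - f) - a * d)"
  by (cases D) (auto simp: field_simps)

text \<open>\<open>real_of_ereal\<close> sends infinite values to 0; on
  \<open>DX \<phi> \<times> DY \<phi>\<close> all values are finite and nothing is lost.\<close>

definition real_val :: "('a \<Rightarrow> 'b \<Rightarrow> ereal) \<Rightarrow> 'a \<Rightarrow> 'b \<Rightarrow> real" where
  "real_val \<phi> x y = real_of_ereal (\<phi> x y)"

lemma real_val:
  assumes "x \<in> DX \<phi>" "y \<in> DY \<phi>"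
  shows "\<phi> x y = ereal (real_val \<phi> x y)"
proof -
  have "\<phi> x y < \<infinity>" "- \<infinity> < \<phi> x y" using assms by (auto simp: DX_def DY_def)
  then show ?thesis by (cases "\<phi> x y") (auto simp: real_val_def)
qed

text \<open>By \<open>A1\<close> the value outside \<open>DX \<phi>\<close> is \<infinity>, so the
  sublevel set taken in the whole space already lies in \<open>DX \<phi>\<close>. It is closed in
  the whole space although the domain need not be.\<close>

lemma closed_real_valX:
  assumes "closed_sp \<phi>" "A1 \<phi>" "y \<in> DY \<phi>"
  shows "closed {x \<in> DX \<phi>. real_val \<phi> x y \<le> c}"
proof -
  have "{x \<in> DX \<phi>. real_val \<phi> x y \<le> c} = {x. \<phi> x y \<le> ereal c}"
  proof (intro set_eqI iffI)
    fix x assume "x \<in> {x \<in> DX \<phi>. real_val \<phi> x y \<le> c}"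
    then show "x \<in> {x. \<phi> x y \<le> ereal c}" using real_val[of x \<phi> y] assms(3) by simp
  next
    fix x assume x: "x \<in> {x. \<phi> x y \<le> ereal c}"
    then have "\<phi> x y \<noteq> \<infinity>" by auto
    then have "x \<in> DX \<phi>" using assms(2,3) unfolding A1_def by blast
    then show "x \<in> {x \<in> DX \<phi>. real_val \<phi> x y \<le> c}" using x real_val[of x \<phi> y] assms(3) by simp
  qed
  moreover have "lsc (\<lambda>x. \<phi> x y)" using assms(1,3) by (simp add: closed_sp_def)
  ultimately show ?thesis using lsc_closed by simp
qed

lemma closed_real_valY:
  assumes "closed_sp \<phi>" "A1 \<phi>" "x \<in> DX \<phi>"
  shows "closed {y \<in> DY \<phi>. - real_val \<phi> x y \<le> c}"
proof -
  have "{y \<in> DY \<phi>. - real_val \<phi> x y \<le> c} = {y. - \<phi> x y \<le> ereal c}"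
  proof (intro set_eqI iffI)
    fix y assume "y \<in> {y \<in> DY \<phi>. - real_val \<phi> x y \<le> c}"
    then show "y \<in> {y. - \<phi> x y \<le> ereal c}" using real_val[of x \<phi> y] assms(3) by simp
  next
    fix y assume y: "y \<in> {y. - \<phi> x y \<le> ereal c}"
    then have "\<phi> x y \<noteq> - \<infinity>" by auto
    then have "y \<in> DY \<phi>" using assms(2,3) unfolding A1_def by blast
    then show "y \<in> {y \<in> DY \<phi>. - real_val \<phi> x y \<le> c}" using y real_val[of x \<phi> y] assms(3) by simp
  qed
  moreover have "lsc (\<lambda>y. - \<phi> x y)"
    using assms(1,3) by (simp add: closed_sp_def usc_def lsc_def ereal_Liminf_uminus)
  ultimately show ?thesis using lsc_closed by simp
qed

text \<open>Finite values at the ends bound \<phi> along the curves, and by \<open>A1\<close> such a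
  bound keeps the curves in the domains. With the other variable fixed, its squared distance
  contributes the same amount to both sides and drops out.\<close>

lemma A2_curves:
  assumes "A2 lam \<phi>" "A1 \<phi>" "x0 \<in> DX \<phi>" "x1 \<in> DX \<phi>" "y0 \<in> DY \<phi>" "y1 \<in> DY \<phi>"
  shows "\<exists>\<gamma> \<sigma>. \<forall>t\<in>{0..1}. \<gamma> t \<in> DX \<phi> \<and> \<sigma> t \<in> DY \<phi> \<and>
    (\<forall>\<tau>. 0 < \<tau> \<and> \<tau> * \<bar>lam\<bar> < 1 \<longrightarrow>
      (\<forall>y\<in>DY \<phi>. real_val \<phi> (\<gamma> t) y + (dist (\<gamma> t) x')\<^sup>2 / (2 * \<tau>)
          \<le> (1 - t) * (real_val \<phi> x0 y + (dist x0 x')\<^sup>2 / (2 * \<tau>))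
            + t * (real_val \<phi> x1 y + (dist x1 x')\<^sup>2 / (2 * \<tau>))
            - (1 / \<tau> + lam) / 2 * t * (1 - t) * (dist x0 x1)\<^sup>2) \<and>
      (\<forall>x\<in>DX \<phi>. - real_val \<phi> x (\<sigma> t) + (dist (\<sigma> t) y')\<^sup>2 / (2 * \<tau>)
          \<le> (1 - t) * (- real_val \<phi> x y0 + (dist y0 y')\<^sup>2 / (2 * \<tau>))
            + t * (- real_val \<phi> x y1 + (dist y1 y')\<^sup>2 / (2 * \<tau>))
            - (1 / \<tau> + lam) / 2 * t * (1 - t) * (dist y0 y1)\<^sup>2))"
proof -
  have "(x0, y0) \<in> Dom \<phi>" "(x1, y1) \<in> Dom \<phi>" using assms by (auto simp: Dom_def)
  then obtain \<gamma> \<sigma> where \<gamma>: "\<gamma> 0 = x0" "\<gamma> 1 = x1" and \<sigma>: "\<sigma> 0 = y0" "\<sigma> 1 = y1"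
    and cc: "\<And>\<tau>. 0 < \<tau> \<Longrightarrow> \<tau> * max (- lam) 0 < 1 \<Longrightarrow> convex_concave_along (1 / \<tau> + lam) (Phi_tau \<tau> \<phi> x' y') \<gamma> \<sigma>"
    using assms(1) unfolding A2_def by metis
  have adm: "\<tau> * max (- lam) 0 < 1" if "0 < \<tau>" "\<tau> * \<bar>lam\<bar> < 1" for \<tau> :: real
    using mult_left_mono[of "max (- lam) 0" "\<bar>lam\<bar>" \<tau>] that by simp
  let ?k = "\<lambda>\<tau> x y. 1 / (2 * \<tau>) * ((dist x x')\<^sup>2 - (dist y y')\<^sup>2)"
  have X: "\<phi> (\<gamma> t) y + ereal (?k \<tau> (\<gamma> t) y) \<le> ereal ((1 - t) * (real_val \<phi> x0 y + ?k \<tau> x0 y)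
      + t * (real_val \<phi> x1 y + ?k \<tau> x1 y) - (1 / \<tau> + lam) / 2 * t * (1 - t) * (dist x0 x1)\<^sup>2)"
    if "t \<in> {0..1}" "0 < \<tau>" "\<tau> * \<bar>lam\<bar> < 1" "y \<in> DY \<phi>" for t \<tau> y
  proof -
    have "Phi_tau \<tau> \<phi> x' y' (\<gamma> t) y \<le> ereal (1 - t) * Phi_tau \<tau> \<phi> x' y' x0 y + ereal t * Phi_tau \<tau> \<phi> x' y' x1 y
        - ereal ((1 / \<tau> + lam) / 2 * t * (1 - t) * (dist x0 x1)\<^sup>2)"
      using cc[OF that(2) adm[OF that(2,3)]] that(1) unfolding convex_concave_along_def \<gamma> by blast
    then show ?thesis
      unfolding Phi_tau_def real_val[OF assms(3) that(4)] real_val[OF assms(4) that(4)] by simp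
  qed
  have Y: "ereal ((1 - t) * (real_val \<phi> x y0 + ?k \<tau> x y0) + t * (real_val \<phi> x y1 + ?k \<tau> x y1)
      + (1 / \<tau> + lam) / 2 * t * (1 - t) * (dist y0 y1)\<^sup>2) \<le> \<phi> x (\<sigma> t) + ereal (?k \<tau> x (\<sigma> t))"
    if "t \<in> {0..1}" "0 < \<tau>" "\<tau> * \<bar>lam\<bar> < 1" "x \<in> DX \<phi>" for t \<tau> x
  proof -
    have "ereal (1 - t) * Phi_tau \<tau> \<phi> x' y' x y0 + ereal t * Phi_tau \<tau> \<phi> x' y' x y1
        + ereal ((1 / \<tau> + lam) / 2 * t * (1 - t) * (dist y0 y1)\<^sup>2) \<le> Phi_tau \<tau> \<phi> x' y' x (\<sigma> t)"
      using cc[OF that(2) adm[OF that(2,3)]] that(1) unfolding convex_concave_along_def \<sigma> by blast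
    then show ?thesis
      unfolding Phi_tau_def real_val[OF that(4) assms(5)] real_val[OF that(4) assms(6)] by simp
  qed
  \<comment> \<open>Membership in the domains does not involve the step size, so one admissible
    value suffices.\<close>
  define \<tau>0 where "\<tau>0 = 1 / (\<bar>lam\<bar> + 1)"
  have \<tau>0: "0 < \<tau>0" "\<tau>0 * \<bar>lam\<bar> < 1" by (auto simp: \<tau>0_def field_simps)
  have \<gamma>D: "\<gamma> t \<in> DX \<phi>" if "t \<in> {0..1}" for t
  proof -
    have "\<phi> (\<gamma> t) y0 \<noteq> \<infinity>" using X[OF that \<tau>0 assms(5)] by auto
    then show ?thesis using assms(2,5) unfolding A1_def by blast
  qed
  have \<sigma>D: "\<sigma> t \<in> DY \<phi>" if "t \<in> {0..1}" for t
  proof -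
    have "\<phi> x0 (\<sigma> t) \<noteq> - \<infinity>" using Y[OF that \<tau>0 assms(3)] by auto
    then show ?thesis using assms(2,3) unfolding A1_def by blast
  qed
  have cancelX: "f + a / (2 * \<tau>) \<le> (1 - t) * (f0 + a0 / (2 * \<tau>)) + t * (f1 + a1 / (2 * \<tau>)) - m"
    if "f + 1 / (2 * \<tau>) * (a - b) \<le> (1 - t) * (f0 + 1 / (2 * \<tau>) * (a0 - b)) + t * (f1 + 1 / (2 * \<tau>) * (a1 - b)) - m"
    for f a b t f0 a0 f1 a1 m \<tau> :: real
    using that by (simp add: diff_divide_distrib algebra_simps)
  have cancelY: "- f + a / (2 * \<tau>) \<le> (1 - t) * (- f0 + a0 / (2 * \<tau>)) + t * (- f1 + a1 / (2 * \<tau>)) - m"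
    if "(1 - t) * (f0 + 1 / (2 * \<tau>) * (b - a0)) + t * (f1 + 1 / (2 * \<tau>) * (b - a1)) + m \<le> f + 1 / (2 * \<tau>) * (b - a)"
    for f a b t f0 a0 f1 a1 m \<tau> :: real
    using that by (simp add: diff_divide_distrib algebra_simps)
  show ?thesis
  proof (intro exI[of _ \<gamma>] exI[of _ \<sigma>] ballI conjI allI impI)
    fix t :: real assume t: "t \<in> {0..1}"
    show "\<gamma> t \<in> DX \<phi>" "\<sigma> t \<in> DY \<phi>" using \<gamma>D[OF t] \<sigma>D[OF t] by auto
    fix \<tau> :: real assume \<tau>: "0 < \<tau> \<and> \<tau> * \<bar>lam\<bar> < 1"
    show "real_val \<phi> (\<gamma> t) y + (dist (\<gamma> t) x')\<^sup>2 / (2 * \<tau>)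
          \<le> (1 - t) * (real_val \<phi> x0 y + (dist x0 x')\<^sup>2 / (2 * \<tau>))
            + t * (real_val \<phi> x1 y + (dist x1 x')\<^sup>2 / (2 * \<tau>))
            - (1 / \<tau> + lam) / 2 * t * (1 - t) * (dist x0 x1)\<^sup>2" if "y \<in> DY \<phi>" for y
    proof (rule cancelX)
      show "real_val \<phi> (\<gamma> t) y + ?k \<tau> (\<gamma> t) y \<le> (1 - t) * (real_val \<phi> x0 y + ?k \<tau> x0 y)
          + t * (real_val \<phi> x1 y + ?k \<tau> x1 y) - (1 / \<tau> + lam) / 2 * t * (1 - t) * (dist x0 x1)\<^sup>2"
        using X[OF t _ _ that, of \<tau>] \<tau> unfolding real_val[OF \<gamma>D[OF t] that] plus_ereal.simps ereal_less_eq by blast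
    qed
    show "- real_val \<phi> x (\<sigma> t) + (dist (\<sigma> t) y')\<^sup>2 / (2 * \<tau>)
          \<le> (1 - t) * (- real_val \<phi> x y0 + (dist y0 y')\<^sup>2 / (2 * \<tau>))
            + t * (- real_val \<phi> x y1 + (dist y1 y')\<^sup>2 / (2 * \<tau>))
            - (1 / \<tau> + lam) / 2 * t * (1 - t) * (dist y0 y1)\<^sup>2" if "x \<in> DX \<phi>" for x
    proof (rule cancelY)
      show "(1 - t) * (real_val \<phi> x y0 + ?k \<tau> x y0) + t * (real_val \<phi> x y1 + ?k \<tau> x y1)
          + (1 / \<tau> + lam) / 2 * t * (1 - t) * (dist y0 y1)\<^sup>2 \<le> real_val \<phi> x (\<sigma> t) + ?k \<tau> x (\<sigma> t)"
        using Y[OF t _ _ that, of \<tau>] \<tau> unfolding real_val[OF that \<sigma>D[OF t]] plus_ereal.simps ereal_less_eq by blast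
    qed
  qed
qed

lemma locally_lipschitz_curried:
  assumes "locally_lipschitz f"
  shows "\<exists>r>0. \<exists>L\<ge>0. \<forall>x1\<in>ball x r. \<forall>x2\<in>ball x r. \<forall>y1\<in>ball y r. \<forall>y2\<in>ball y r.
        \<bar>f (x1, y1) - f (x2, y2)\<bar> \<le> L * (dist x1 x2 + dist y1 y2)"
proof -
  obtain r L where r: "r > 0" and L: "\<And>a b. a \<in> ball (x, y) r \<Longrightarrow> b \<in> ball (x, y) r \<Longrightarrow> dist (f a) (f b) \<le> L * dist a b"
    using assms unfolding locally_lipschitz_def by meson
  have le: "dist (a, b) (c, d) \<le> dist a c + dist b d" for a c :: 'a and b d :: 'b
    unfolding dist_Pair_Pair by (rule sqrt_sum_squares_le_sum) auto
  \<comment> \<open>Half the radius puts the product of balls inside the ball of the product space;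
    |\<open>L\<close>| covers a negative constant.\<close>
  have "\<bar>f (x1, y1) - f (x2, y2)\<bar> \<le> \<bar>L\<bar> * (dist x1 x2 + dist y1 y2)"
    if "x1 \<in> ball x (r / 2)" "x2 \<in> ball x (r / 2)" "y1 \<in> ball y (r / 2)" "y2 \<in> ball y (r / 2)" for x1 x2 y1 y2
  proof -
    have "(x1, y1) \<in> ball (x, y) r" "(x2, y2) \<in> ball (x, y) r"
      using that le[of x y x1 y1] le[of x y x2 y2] by auto
    then have "\<bar>f (x1, y1) - f (x2, y2)\<bar> \<le> L * dist (x1, y1) (x2, y2)" using L by (simp add: dist_real_def)
    also have "\<dots> \<le> \<bar>L\<bar> * (dist x1 x2 + dist y1 y2)" using le by (intro mult_mono) auto
    finally show ?thesis .
  qed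
  then show ?thesis using r by (intro exI[of _ "r / 2"] conjI exI[of _ "\<bar>L\<bar>"]) auto
qed

lemma saddle_system_of_assumptions:
  assumes "proper_sp \<phi>" "closed_sp \<phi>" "A3_ii \<phi>" "A1 \<phi>" "A2 lam \<phi>"
  shows "\<exists>P p q. saddle_system lam (DX \<phi>) (DY \<phi>) (real_val \<phi>) P p q"
proof -
  obtain x00 y00 where ne: "x00 \<in> DX \<phi>" "y00 \<in> DY \<phi>" using assms(1) by (auto simp: proper_sp_def Dom_def)
  obtain \<psi>X \<psi>Y \<Phi>0 where psi: "\<And>x. \<psi>X x \<noteq> - \<infinity>" "\<And>y. \<psi>Y y \<noteq> \<infinity>"
    and lip: "locally_lipschitz \<Phi>0"
    and sp: "\<And>x y. (x, y) \<in> Dom \<phi> \<Longrightarrow> \<phi> x y = ereal (\<Phi>0 (x, y)) + \<psi>X x + \<psi>Y y"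
    using assms(3) unfolding A3_ii_def by metis
  have "saddle_system lam (DX \<phi>) (DY \<phi>) (real_val \<phi>) (\<lambda>x y. \<Phi>0 (x, y))
      (\<lambda>x. real_of_ereal (\<psi>X x)) (\<lambda>y. real_of_ereal (\<psi>Y y))"
  proof
    show "DX \<phi> \<noteq> {}" "DY \<phi> \<noteq> {}" using ne by auto
    show "closed {x \<in> DX \<phi>. real_val \<phi> x y \<le> c}" if "y \<in> DY \<phi>" for y c
      by (rule closed_real_valX[OF assms(2,4) that])
    show "closed {y \<in> DY \<phi>. - real_val \<phi> x y \<le> c}" if "x \<in> DX \<phi>" for x c
      by (rule closed_real_valY[OF assms(2,4) that])
    show "real_val \<phi> x y = \<Phi>0 (x, y) + real_of_ereal (\<psi>X x) + real_of_ereal (\<psi>Y y)"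
      if xy: "x \<in> DX \<phi>" "y \<in> DY \<phi>" for x y
    proof -
      have "ereal (real_val \<phi> x y) = ereal (\<Phi>0 (x, y)) + \<psi>X x + \<psi>Y y"
        using sp[of x y] xy real_val[OF xy] by (simp add: Dom_def)
      then show ?thesis using psi(1)[of x] psi(2)[of y] by (cases "\<psi>X x"; cases "\<psi>Y y") auto
    qed
    show "\<exists>r>0. \<exists>L\<ge>0. \<forall>x1\<in>ball x r. \<forall>x2\<in>ball x r. \<forall>y1\<in>ball y r. \<forall>y2\<in>ball y r.
        \<bar>\<Phi>0 (x1, y1) - \<Phi>0 (x2, y2)\<bar> \<le> L * (dist x1 x2 + dist y1 y2)" for x y
      by (rule locally_lipschitz_curried[OF lip])
    fix x0 x1 x' assume "x0 \<in> DX \<phi>" "x1 \<in> DX \<phi>"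
    \<comment> \<open>(A2) joins pairs: both ends receive the same second component
      \<open>y00\<close>, which also serves as the centre of the second penalty.\<close>
    from A2_curves[OF assms(5,4) this ne(2) ne(2), of x' y00] show "\<exists>\<gamma>. \<forall>t\<in>{0..1}. \<gamma> t \<in> DX \<phi> \<and>
      (\<forall>\<tau> y. 0 < \<tau> \<and> \<tau> * \<bar>lam\<bar> < 1 \<and> y \<in> DY \<phi> \<longrightarrow>
        real_val \<phi> (\<gamma> t) y + (dist (\<gamma> t) x')\<^sup>2 / (2 * \<tau>)
          \<le> (1 - t) * (real_val \<phi> x0 y + (dist x0 x')\<^sup>2 / (2 * \<tau>))
            + t * (real_val \<phi> x1 y + (dist x1 x')\<^sup>2 / (2 * \<tau>))
            - (1 / \<tau> + lam) / 2 * t * (1 - t) * (dist x0 x1)\<^sup>2)" by meson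
  next
    fix y0 y1 y' assume "y0 \<in> DY \<phi>" "y1 \<in> DY \<phi>"
    from A2_curves[OF assms(5,4) ne(1) ne(1) this, of x00 y'] show "\<exists>\<sigma>. \<forall>t\<in>{0..1}. \<sigma> t \<in> DY \<phi> \<and>
      (\<forall>\<tau> x. 0 < \<tau> \<and> \<tau> * \<bar>lam\<bar> < 1 \<and> x \<in> DX \<phi> \<longrightarrow>
        - real_val \<phi> x (\<sigma> t) + (dist (\<sigma> t) y')\<^sup>2 / (2 * \<tau>)
          \<le> (1 - t) * (- real_val \<phi> x y0 + (dist y0 y')\<^sup>2 / (2 * \<tau>))
            + t * (- real_val \<phi> x y1 + (dist y1 y')\<^sup>2 / (2 * \<tau>))
            - (1 / \<tau> + lam) / 2 * t * (1 - t) * (dist y0 y1)\<^sup>2)" by meson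
  qed
  then show ?thesis by blast
qed

section \<open>Solutions with extended real values\<close>

lemma EVI_solution_iff:
  fixes \<phi> :: "'a::complete_space \<Rightarrow> 'b::complete_space \<Rightarrow> ereal"
  assumes "saddle_system lam (DX \<phi>) (DY \<phi>) (real_val \<phi>) P p q"
  shows "EVI_solution lam \<phi> u v \<longleftrightarrow> continuous_on {0<..} u \<and> continuous_on {0<..} v \<and>
    saddle_system.evi_real lam (DX \<phi>) (DY \<phi>) (real_val \<phi>) u v"
proof -
  interpret saddle_system lam "DX \<phi>" "DY \<phi>" "real_val \<phi>" P p q by (rule assms)
  \<comment> \<open>\<open>EVI_solution\<close> quantifies over pairs; these points complete a test
    point for one component to a pair in the domain.\<close>
  obtain x0 y0 where ne: "x0 \<in> DX \<phi>" "y0 \<in> DY \<phi>" using A_nonempty B_nonempty by blast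
  have X: "ereal (1/2) * dini_upper (\<lambda>s. (dist (u s) x)\<^sup>2) t + ereal (lam/2 * (dist (u t) x)\<^sup>2) + \<phi> (u t) (v t) \<le> \<phi> x (v t)
      \<longleftrightarrow> (\<forall>e>0. \<forall>\<^sub>F h in at_right 0. (dist (u (t + h)) x)\<^sup>2 - (dist (u t) x)\<^sup>2
        \<le> h * (2 * (real_val \<phi> x (v t) - real_val \<phi> (u t) (v t)) - lam * (dist (u t) x)\<^sup>2 + e))"
    if "u t \<in> DX \<phi>" "v t \<in> DY \<phi>" "x \<in> DX \<phi>" for t x
    unfolding real_val[OF that(1,2)] real_val[OF that(3,2)] EVI_ereal_iff dini_upper_le_iff ..
  have Y: "ereal (1/2) * dini_upper (\<lambda>s. (dist (v s) y)\<^sup>2) t + ereal (lam/2 * (dist (v t) y)\<^sup>2) + \<phi> (u t) y \<le> \<phi> (u t) (v t)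
      \<longleftrightarrow> (\<forall>e>0. \<forall>\<^sub>F h in at_right 0. (dist (v (t + h)) y)\<^sup>2 - (dist (v t) y)\<^sup>2
        \<le> h * (2 * (real_val \<phi> (u t) (v t) - real_val \<phi> (u t) y) - lam * (dist (v t) y)\<^sup>2 + e))"
    if "u t \<in> DX \<phi>" "v t \<in> DY \<phi>" "y \<in> DY \<phi>" for t y
    unfolding real_val[OF that(1,2)] real_val[OF that(1,3)] EVI_ereal_iff dini_upper_le_iff ..
  have D: "(\<forall>t>0. (u t, v t) \<in> Dom \<phi>) \<longleftrightarrow> (\<forall>t>0. u t \<in> DX \<phi> \<and> v t \<in> DY \<phi>)"
    by (simp add: Dom_def)
  show ?thesis
  proof
    assume E: "EVI_solution lam \<phi> u v"
    then have uv: "u t \<in> DX \<phi>" "v t \<in> DY \<phi>" if "0 < t" for t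
      using that D unfolding EVI_solution_def by blast+
    have EX: "\<forall>t>0. \<forall>x y. (x, y) \<in> Dom \<phi> \<longrightarrow>
        ereal (1/2) * dini_upper (\<lambda>s. (dist (u s) x)\<^sup>2) t + ereal (lam/2 * (dist (u t) x)\<^sup>2) + \<phi> (u t) (v t) \<le> \<phi> x (v t) \<and>
        ereal (1/2) * dini_upper (\<lambda>s. (dist (v s) y)\<^sup>2) t + ereal (lam/2 * (dist (v t) y)\<^sup>2) + \<phi> (u t) y \<le> \<phi> (u t) (v t)"
      using E unfolding EVI_solution_def by (elim conjE)
    have "evi_real u v"
      unfolding evi_real_def
    proof (intro allI impI conjI)
      fix t :: real assume t: "0 < t"
      show "u t \<in> DX \<phi>" "v t \<in> DY \<phi>" using uv[OF t] by auto
      show "\<forall>x\<in>DX \<phi>. \<forall>e>0. \<forall>\<^sub>F h in at_right 0. (dist (u (t + h)) x)\<^sup>2 - (dist (u t) x)\<^sup>2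
        \<le> h * (2 * (real_val \<phi> x (v t) - real_val \<phi> (u t) (v t)) - lam * (dist (u t) x)\<^sup>2 + e)"
      proof
        fix x assume "x \<in> DX \<phi>"
        then show "\<forall>e>0. \<forall>\<^sub>F h in at_right 0. (dist (u (t + h)) x)\<^sup>2 - (dist (u t) x)\<^sup>2
          \<le> h * (2 * (real_val \<phi> x (v t) - real_val \<phi> (u t) (v t)) - lam * (dist (u t) x)\<^sup>2 + e)"
          using EX[rule_format, OF t, of x y0] ne(2) X[OF uv[OF t]] by (simp add: Dom_def)
      qed
      show "\<forall>y\<in>DY \<phi>. \<forall>e>0. \<forall>\<^sub>F h in at_right 0. (dist (v (t + h)) y)\<^sup>2 - (dist (v t) y)\<^sup>2
        \<le> h * (2 * (real_val \<phi> (u t) (v t) - real_val \<phi> (u t) y) - lam * (dist (v t) y)\<^sup>2 + e)"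
      proof
        fix y assume "y \<in> DY \<phi>"
        then show "\<forall>e>0. \<forall>\<^sub>F h in at_right 0. (dist (v (t + h)) y)\<^sup>2 - (dist (v t) y)\<^sup>2
          \<le> h * (2 * (real_val \<phi> (u t) (v t) - real_val \<phi> (u t) y) - lam * (dist (v t) y)\<^sup>2 + e)"
          using EX[rule_format, OF t, of x0 y] ne(1) Y[OF uv[OF t]] by (simp add: Dom_def)
      qed
    qed
    moreover have "continuous_on {0<..} u" "continuous_on {0<..} v"
      using E unfolding EVI_solution_def by blast+
    ultimately show "continuous_on {0<..} u \<and> continuous_on {0<..} v \<and> evi_real u v" by blast
  next
    assume R: "continuous_on {0<..} u \<and> continuous_on {0<..} v \<and> evi_real u v"
    then have R': "evi_real u v" by blast
    have uv: "u t \<in> DX \<phi>" "v t \<in> DY \<phi>" if "0 < t" for t using evi_real_D(1,2)[OF R' that] .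
    show "EVI_solution lam \<phi> u v"
      unfolding EVI_solution_def
    proof (intro conjI allI impI)
      show "continuous_on {0<..} u" "continuous_on {0<..} v" using R by blast+
      fix t :: real assume t: "0 < t"
      show "(u t, v t) \<in> Dom \<phi>" using uv[OF t] by (simp add: Dom_def)
      fix x y assume "(x, y) \<in> Dom \<phi>"
      then have xy: "x \<in> DX \<phi>" "y \<in> DY \<phi>" by (auto simp: Dom_def)
      show "ereal (1/2) * dini_upper (\<lambda>s. (dist (u s) x)\<^sup>2) t + ereal (lam/2 * (dist (u t) x)\<^sup>2) + \<phi> (u t) (v t) \<le> \<phi> x (v t)"
        using X[OF uv[OF t] xy(1)] evi_real_D(3)[OF R' t xy(1)] by blast
      show "ereal (1/2) * dini_upper (\<lambda>s. (dist (v s) y)\<^sup>2) t + ereal (lam/2 * (dist (v t) y)\<^sup>2) + \<phi> (u t) y \<le> \<phi> (u t) (v t)"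
        using Y[OF uv[OF t] xy(2)] evi_real_D(4)[OF R' t xy(2)] by blast
    qed
  qed
qed

text \<open>Filling in the limit for nonpositive times makes the curve continuous on
  \<open>{0..}\<close>, as \<open>evi_sum\<close> demands, and leaves positive times
  unchanged.\<close>

lemma EVI_solution_extend:
  fixes \<phi> :: "'a::complete_space \<Rightarrow> 'b::complete_space \<Rightarrow> ereal"
  assumes sys: "saddle_system lam (DX \<phi>) (DY \<phi>) (real_val \<phi>) P p q"
    and E: "EVI_solution lam \<phi> u v" and lim: "((\<lambda>t. (u t, v t)) \<longlongrightarrow> w0) (at_right 0)"
  shows "saddle_system.evi_sum lam (DX \<phi>) (DY \<phi>) (real_val \<phi>) (\<lambda>t. if t \<le> 0 then w0 else (u t, v t))"
    (is "saddle_system.evi_sum _ _ _ _ ?w")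
proof -
  interpret saddle_system lam "DX \<phi>" "DY \<phi>" "real_val \<phi>" P p q by (rule sys)
  have E': "continuous_on {0<..} u" "continuous_on {0<..} v" "evi_real u v"
    using E EVI_solution_iff[OF sys] by blast+
  have "continuous_on {0..} ?w"
    unfolding continuous_on_def
  proof
    fix t :: real assume "t \<in> {0..}"
    then consider "t = 0" | "0 < t" by fastforce
    then show "(?w \<longlongrightarrow> ?w t) (at t within {0..})"
    proof cases
      case 1
      have "\<forall>\<^sub>F s in at_right 0. (u s, v s) = ?w s"
        by (auto simp: eventually_at_right_field intro: exI[of _ 1])
      then have "(?w \<longlongrightarrow> w0) (at_right 0)" by (rule Lim_transform_eventually[OF lim])
      then show ?thesis using 1 by (simp add: at_within_Ici_at_right)
    next
      case 2
      have "continuous_on {0<..} (\<lambda>t. (u t, v t))" by (intro continuous_intros E')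
      then have "((\<lambda>t. (u t, v t)) \<longlongrightarrow> (u t, v t)) (at t)"
        using 2 by (simp add: continuous_on_eq_continuous_at isCont_def)
      moreover have "\<forall>\<^sub>F s in at t. (u s, v s) = ?w s"
        using order_tendstoD(1)[OF tendsto_ident_at 2] by eventually_elim simp
      ultimately have "(?w \<longlongrightarrow> (u t, v t)) (at t)" by (rule Lim_transform_eventually)
      from tendsto_within_subset[OF this subset_UNIV]
      show ?thesis using 2 by simp
    qed
  qed
  then show ?thesis by (rule evi_real_imp_sum[OF E'(3)]) auto
qed

theorem mainTheorem1:
  fixes lam :: real
    and \<phi> :: "'a::complete_space \<Rightarrow> 'b::complete_space \<Rightarrow> ereal"
  assumes "proper_sp \<phi>" and "closed_sp \<phi>"
    and "A3_ii \<phi>" and "A1 \<phi>" and "A2 lam \<phi>"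
  shows "(\<forall>w0 \<in> closure (Dom \<phi>).
            \<exists>u v. EVI_solution lam \<phi> u v \<and> ((\<lambda>t. (u t, v t)) \<longlongrightarrow> w0) (at_right 0) \<and>
              (\<forall>u' v'. EVI_solution lam \<phi> u' v' \<and> ((\<lambda>t. (u' t, v' t)) \<longlongrightarrow> w0) (at_right 0)
                 \<longrightarrow> (\<forall>t>0. u' t = u t \<and> v' t = v t)))
       \<and> (\<forall>(w0n :: nat \<Rightarrow> 'a \<times> 'b) w0 (un :: nat \<Rightarrow> real \<Rightarrow> 'a) (vn :: nat \<Rightarrow> real \<Rightarrow> 'b) u v.
            (\<forall>n. w0n n \<in> closure (Dom \<phi>)) \<and> w0 \<in> closure (Dom \<phi>) \<and> w0n \<longlonglongrightarrow> w0 \<and>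
            (\<forall>n. EVI_solution lam \<phi> (un n) (vn n) \<and> ((\<lambda>t. (un n t, vn n t)) \<longlongrightarrow> w0n n) (at_right 0)) \<and>
            EVI_solution lam \<phi> u v \<and> ((\<lambda>t. (u t, v t)) \<longlongrightarrow> w0) (at_right 0)
            \<longrightarrow> (\<forall>t>0. (\<lambda>n. (un n t, vn n t)) \<longlonglongrightarrow> (u t, v t)))"
proof -
  obtain P p q where sys: "saddle_system lam (DX \<phi>) (DY \<phi>) (real_val \<phi>) P p q"
    using saddle_system_of_assumptions[OF assms] by blast
  interpret saddle_system lam "DX \<phi>" "DY \<phi>" "real_val \<phi>" P p q by (rule sys)
  have stable: "(\<lambda>n. (un n t, vn n t)) \<longlonglongrightarrow> (u t, v t)"
    if w0: "w0 \<in> closure (Dom \<phi>)" "w0n \<longlonglongrightarrow> w0"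
      and n: "\<And>n. EVI_solution lam \<phi> (un n) (vn n)" "\<And>n. ((\<lambda>t. (un n t, vn n t)) \<longlongrightarrow> w0n n) (at_right 0)"
      and E: "EVI_solution lam \<phi> u v" "((\<lambda>t. (u t, v t)) \<longlongrightarrow> w0) (at_right 0)" and t: "0 < t"
    for w0n :: "nat \<Rightarrow> 'a \<times> 'b" and w0 un vn u v t
    using evi_stable[OF EVI_solution_extend[OF sys n] EVI_solution_extend[OF sys E], where t = t] w0 t
    by (simp add: Dom_def)
  have "\<exists>u v. EVI_solution lam \<phi> u v \<and> ((\<lambda>t. (u t, v t)) \<longlongrightarrow> w0) (at_right 0) \<and>
      (\<forall>u' v'. EVI_solution lam \<phi> u' v' \<and> ((\<lambda>t. (u' t, v' t)) \<longlongrightarrow> w0) (at_right 0)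
        \<longrightarrow> (\<forall>t>0. u' t = u t \<and> v' t = v t))" if w0: "w0 \<in> closure (Dom \<phi>)" for w0
  proof -
    obtain u v where uv: "evi_real u v" "continuous_on {0..} u" "continuous_on {0..} v" "(u 0, v 0) = w0"
      using evi_real_exists[of w0] w0 by (auto simp: Dom_def)
    have E: "EVI_solution lam \<phi> u v"
      unfolding EVI_solution_iff[OF sys] using uv by (auto elim: continuous_on_subset)
    have "continuous_on {0..} (\<lambda>t. (u t, v t))" by (intro continuous_intros uv)
    then have "((\<lambda>t. (u t, v t)) \<longlongrightarrow> (u 0, v 0)) (at 0 within {0..})" by (simp add: continuous_on_def)
    then have lim: "((\<lambda>t. (u t, v t)) \<longlongrightarrow> w0) (at_right 0)" by (simp add: uv(4) at_within_Ici_at_right)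
    \<comment> \<open>Uniqueness is stability for a constant sequence of initial values, with the
      second solution repeated as the approximating sequence.\<close>
    have "u' t = u t \<and> v' t = v t"
      if "EVI_solution lam \<phi> u' v'" "((\<lambda>t. (u' t, v' t)) \<longlongrightarrow> w0) (at_right 0)" "0 < t" for u' v' t
      using stable[OF w0 tendsto_const that(1,2) E lim that(3)] by (simp add: LIMSEQ_const_iff)
    then show ?thesis using E lim by blast
  qed
  then show ?thesis using stable by blast
qed

end
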